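(* Let $\lambda\ne0$ and let $\{g_n(\omega)\}_{n\ge1}$ be independent real random variables with (i) $\mathbb{E}[g_n]=0$, (ii) $\mathbb{E}[g_n^2]=\lambda^2$, (iii) $\sum_{n\ge1}\mathbb{E}[g_n^4]n^{-2}<\infty$, (iv) $\mathbb{P}[\lim_{n\to\infty}g_nn^{-1/4}=0]=1$. Fix $F>0$, $E\in\mathbb{R}$, $\theta_0\in[0,\pi)$, and let $\psi$ be the solution of the generalized eigenvalue equation on $(0,\infty)$ with couplings $g_n(\omega)$ and initial data $\psi(0)=\sin\theta_0$, $\psi'(0^+)=\cos\theta_0$. Then almost surely its Prüfer radius satisfies $$\lim_{n\to\infty}\frac{\log R(n)}{\log n}=\frac{\lambda^2}{8F}.$$
   Context: Generalized eigenvalue equation on $(0,\infty)$: $-\psi''-Fx\psi=E\psi$ on $(0,\infty)\setminus\mathbb{Z}$, $\psi$ continuous at each $n\ge1$, and $\lim_{\epsilon\to0^+}(\psi'(n+\epsilon)-\psi'(n-\epsilon))=g_n\psi(n)$ for $n\ge1$. Reference solution: $\zeta(x)=(\pi/F^{1/3})^{1/2}(i\,\mathrm{Ai}(-F^{1/3}(x+E/F))+\mathrm{Bi}(-F^{1/3}(x+E/F)))$ (Airy functions $\mathrm{Ai},\mathrm{Bi}$), which has no real zeros. Prüfer radius: for a real-valued solution $\psi$ and each $n\ge1$ there is a unique $\alpha(n)\in\mathbb{C}$ with $\psi(x)=\alpha(n)\zeta(x)+\overline{\alpha(n)}\,\overline{\zeta(x)}$ for $x\in(n-1,n)$; set $R(n)=|2i\alpha(n)|=2|\alpha(n)|$.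 *)

theory Defs
  imports "HOL-Probability.Probability"
begin

section \<open>Airy functions (power series, DLMF 9.4.1--9.4.2)\<close>

definition airy_f :: "real \<Rightarrow> real" where
  "airy_f x = (\<Sum>k. 3 ^ k * pochhammer (1/3) k * x ^ (3*k) / fact (3*k))"

definition airy_g :: "real \<Rightarrow> real" where
  "airy_g x = (\<Sum>k. 3 ^ k * pochhammer (2/3) k * x ^ (3*k+1) / fact (3*k+1))"

definition airy_c1 :: real where
  "airy_c1 = 1 / (3 powr (2/3) * Gamma (2/3))"   \<comment> \<open>= Ai(0)\<close>

definition airy_c2 :: real where
  "airy_c2 = 1 / (3 powr (1/3) * Gamma (1/3))"   \<comment> \<open>= -Ai'(0)\<close>

definition Ai :: "real \<Rightarrow> real" where
  "Ai x = airy_c1 * airy_f x - airy_c2 * airy_g x"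

definition Bi :: "real \<Rightarrow> real" where
  "Bi x = sqrt 3 * (airy_c1 * airy_f x + airy_c2 * airy_g x)"

definition zeta :: "real \<Rightarrow> real \<Rightarrow> real \<Rightarrow> complex" where
  "zeta F E x = complex_of_real (sqrt (pi / F powr (1/3))) *
     (\<i> * complex_of_real (Ai (- (F powr (1/3)) * (x + E / F)))
      + complex_of_real (Bi (- (F powr (1/3)) * (x + E / F))))"

definition prufer_alpha :: "real \<Rightarrow> real \<Rightarrow> (real \<Rightarrow> real) \<Rightarrow> nat \<Rightarrow> complex" where
  "prufer_alpha F E \<psi> n = (THE \<alpha>. \<forall>x\<in>{real n - 1<..<real n}.
      complex_of_real (\<psi> x) = \<alpha> * zeta F E x + cnj \<alpha> * cnj (zeta F E x))"

definition prufer_R :: "real \<Rightarrow> real \<Rightarrow> (real \<Rightarrow> real) \<Rightarrow> nat \<Rightarrow> real" where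
  "prufer_R F E \<psi> n = cmod (2 * \<i> * prufer_alpha F E \<psi> n)"

definition is_gen_solution ::
  "real \<Rightarrow> real \<Rightarrow> (nat \<Rightarrow> real) \<Rightarrow> real \<Rightarrow> (real \<Rightarrow> real) \<Rightarrow> bool" where
  "is_gen_solution F E g \<theta>0 \<psi> \<longleftrightarrow>
     (\<forall>x. 0 < x \<and> x \<notin> \<int> \<longrightarrow>
        (\<psi> has_real_derivative deriv \<psi> x) (at x) \<and>
        (deriv \<psi> has_real_derivative (- (F * x + E) * \<psi> x)) (at x)) \<and>
     (\<forall>n::nat. n \<ge> 1 \<longrightarrow> isCont \<psi> (real n)) \<and>
     (\<forall>n::nat. n \<ge> 1 \<longrightarrow>
        ((\<lambda>\<epsilon>. deriv \<psi> (real n + \<epsilon>) - deriv \<psi> (real n - \<epsilon>)) \<longlongrightarrow> g n * \<psi> (real n))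
          (at_right 0)) \<and>
     (\<psi> \<longlongrightarrow> sin \<theta>0) (at_right 0) \<and>
     (deriv \<psi> \<longlongrightarrow> cos \<theta>0) (at_right 0)"

end

(* The connection formulas for Ai and Bi are not needed: two bases of the solution space give
  comparable radii, so zeta may be replaced by the solution Z that is asymptotic to the WKB
  function y^(-1/4) exp (2 i y^(3/2) / (3 F)), y = F x + E.  Writing U = g |Z(n)|^2 / 2 and z for the
  square of the phase of alpha(n) Z(n), the jump at n multiplies |alpha|^2 by
  1 - 2 U Im z + 2 U^2 (1 + Re z), whose logarithm is
  - 2 U Im z + U^2 (1 + 2 Re z + Re z^2) + o(U^2).  Since |Z(n)|^4 is asymptotic to 1 / (F n), the mean
  of the U^2 term sums to lam^2 / (4 F) * log n.  The remaining terms are o(log n): those that are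
  centred given the past by a maximal inequality along the times 2^(2^k), and the sums of
  z / n and z^2 / n because z turns by about 2 sqrt (F n) at each step. *)

theory Submission
  imports Defs "HOL-Real_Asymp.Real_Asymp"
begin

section \<open>The Airy equation\<close>

text \<open>The phase z is itself random and obeys only z(n+1) = z(n) * cis (2 * sqrt (F * n)) +
  o(1), whose errors accumulate, so no formula for z is available. Hence only boundedly many
  consecutive steps are compared: over such a block the rotation angle is nearly constant, and its
  powers cis (2 * k * sqrt (F * j)) with k nonzero have vanishing mean for the weights 1 / j. The
  two conditions on the size of g enter at different places. The fourth moments control the variance
  of |Z(n)|^4 * (g(n)^2 - lam^2), because |Z(n)|^8 has order n^-2. The bound g(n) = o(n^(1/4)) makes
  U tend to 0 along almost every path, which both the expansion of the logarithm and the rotation of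
  z use. Centring given the past is possible because z(n) depends on g(1), ..., g(n-1) only.
  Everything random is read off one complex recursion with deterministic data, so a single null set
  serves all solutions. Since R is comparable to |alpha| and not to its square, the rate is half of
  lam^2 / (4 * F).\<close>

lemma powser_airy_ode:
  fixes c :: "nat \<Rightarrow> real"
  assumes summ: "\<And>x. summable (\<lambda>n. c n * x ^ n)"
    and c2: "c 2 = 0"
    and rec: "\<And>n. real (n + 3) * real (n + 2) * c (n + 3) = c n"
  defines "f \<equiv> \<lambda>x. \<Sum>n. c n * x ^ n"
    and "f' \<equiv> \<lambda>x. \<Sum>n. diffs c n * x ^ n"
  shows "(f has_real_derivative f' x) (at x)"
    and "(f' has_real_derivative x * f x) (at x)"
    and "f 0 = c 0" and "f' 0 = c 1"
proof -
  show "(f has_real_derivative f' x) (at x)"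
    unfolding f_def f'_def by (rule termdiffs_strong_converges_everywhere[OF summ])
  have s1: "summable (\<lambda>n. diffs c n * x ^ n)" for x
    by (rule termdiff_converges_all[OF summ])
  have "(f' has_real_derivative (\<Sum>n. diffs (diffs c) n * x ^ n)) (at x)"
    unfolding f'_def by (rule termdiffs_strong_converges_everywhere[OF s1])
  moreover have "(\<lambda>n. diffs (diffs c) n * x ^ n) sums (x * f x)"
  proof -
    have *: "diffs (diffs c) (Suc n) * x ^ Suc n = x * (c n * x ^ n)" for n
    proof -
      have "diffs (diffs c) (Suc n) = real (n + 3) * real (n + 2) * c (n + 3)"
        by (simp add: diffs_def eval_nat_numeral algebra_simps)
      then show ?thesis by (simp only: rec) (simp add: mult_ac)
    qed
    have "(\<lambda>n. x * (c n * x ^ n)) sums (x * f x)"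
      unfolding f_def by (intro sums_mult summable_sums summ)
    then have "(\<lambda>n. diffs (diffs c) (Suc n) * x ^ Suc n) sums (x * f x)"
      by (simp only: *)
    moreover have "diffs (diffs c) 0 = 0" using c2 by (simp add: diffs_def numeral_2_eq_2)
    ultimately show ?thesis using sums_Suc_iff[of "\<lambda>n. diffs (diffs c) n * x ^ n" "x * f x"] by simp
  qed
  ultimately show "(f' has_real_derivative x * f x) (at x)" by (simp add: sums_iff)
  show "f 0 = c 0" "f' 0 = c 1" by (simp_all add: f_def f'_def powser_zero diffs_def)
qed

lemma airy_coeff_summable:
  fixes p x :: real and s :: nat
  assumes p: "0 < p" "p \<le> 1"
  shows "summable (\<lambda>k. 3 ^ k * pochhammer p k * x ^ (3*k+s) / fact (3*k+s))"
\<comment> \<open>With \<open>m = 3 * k + s\<close> the quotient of consecutive terms is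
  \<open>3 * (p + k) / (m + 3)\<close>, at most 1, times \<open>x ^ 3 / ((m + 2) * (m + 1))\<close>.
  The last denominator is at least \<open>k\<close>, so the quotient is at most 1/2 in absolute
  value once \<open>k\<close> reaches twice the cube of \<open>\<bar>x\<bar>\<close>.\<close>
proof (rule summable_ratio_test[where c = "1/2" and N = "nat \<lceil>2 * \<bar>x\<bar>^3\<rceil>"])
  fix k assume k: "nat \<lceil>2 * \<bar>x\<bar>^3\<rceil> \<le> k"
  then have xk: "2 * \<bar>x\<bar>^3 \<le> real k" by linarith
  let ?t = "\<lambda>k. 3 ^ k * pochhammer p k * x ^ (3*k+s) / fact (3*k+s)"
  define m where "m = 3 * k + s"
  have e: "?t (Suc k) = ?t k * (3 * (p + k) * x ^ 3 / (real (m+3) * real (m+2) * real (m+1)))"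
  proof -
    have "fact (3 * Suc k + s) = real (m+3) * real (m+2) * real (m+1) * fact m"
      by (simp add: m_def eval_nat_numeral algebra_simps)
    moreover have "x ^ (3 * Suc k + s) = x ^ m * x ^ 3" by (simp add: m_def power_add[symmetric] add_ac)
    moreover have "real (m+3) * real (m+2) * real (m+1) \<noteq> 0" by simp
    ultimately show ?thesis unfolding m_def[symmetric]
      by (simp add: pochhammer_Suc divide_simps)
  qed
  have "\<bar>3 * (p + k) * x ^ 3 / (real (m+3) * real (m+2) * real (m+1))\<bar> 
     = (3 * (p+k) / real (m+3)) * (\<bar>x\<bar>^3 / (real (m+2) * real (m+1)))"
    using p by (simp add: abs_mult power_abs abs_divide)
  also have "\<dots> \<le> 1 * (1/2)"
  proof (intro mult_mono)
    show "3 * (p + real k) / real (m + 3) \<le> 1" using p by (simp add: m_def)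
    have "real k * 1 \<le> real (m+2) * real (m+1)" 
      by (intro mult_mono) (simp_all add: m_def)
    then have "2 * \<bar>x\<bar>^3 \<le> real (m+2) * real (m+1)" using xk by linarith
    moreover have "real (m+2) * real (m+1) > 0" by simp
    ultimately show "\<bar>x\<bar>^3 / (real (m+2) * real (m+1)) \<le> 1/2" by (simp only: pos_divide_le_eq)
  qed (use p in auto)
  finally have le: "\<bar>3 * (p + k) * x ^ 3 / (real (m+3) * real (m+2) * real (m+1))\<bar> \<le> 1/2" by simp
  have gen: "norm T' \<le> 1/2 * norm T" if "T' = T * q" "\<bar>q\<bar> \<le> 1/2" for T T' q :: real
    using mult_left_mono[OF that(2) abs_ge_zero[of T]] by (simp add: that(1) abs_mult)
  show "norm (?t (Suc k)) \<le> 1/2 * norm (?t k)" by (rule gen[OF e le])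
qed simp

text \<open>The relation \<open>3 * p = 1 + real s\<close> lets one argument serve both series:
  \<open>p = 1/3\<close>, \<open>s = 0\<close> is \<open>airy_f\<close>, and \<open>p = 2/3\<close>,
  \<open>s = 1\<close> is \<open>airy_g\<close>. Padding with zero coefficients off the residue
  class \<open>s\<close> modulo 3 turns the sparse series into an ordinary power series.\<close>

lemma airy_series_ode:
  fixes p :: real and s :: nat
  assumes p: "0 < p" "p \<le> 1" and s: "s < 2" "3 * p = 1 + real s"
  defines "f \<equiv> \<lambda>x::real. \<Sum>k. 3 ^ k * pochhammer p k * x ^ (3*k+s) / fact (3*k+s)"
  obtains f' where "\<And>x. (f has_real_derivative f' x) (at x)"
    and "\<And>x. (f' has_real_derivative x * f x) (at x)"
    and "f 0 = of_bool (s = 0)" and "f' 0 = of_bool (s = 1)"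
proof -
  define c where "c n = (if n mod 3 = s then 3 ^ (n div 3) * pochhammer p (n div 3) / fact n else 0)" for n
  have mono: "strict_mono (\<lambda>k. 3 * k + s)" by (auto simp: strict_mono_def)
  have rng: "c n * x ^ n = 0" if "n \<notin> range (\<lambda>k. 3 * k + s)" for n x
  proof -
    have "n mod 3 \<noteq> s"
    proof
      assume "n mod 3 = s"
      then have "n = 3 * (n div 3) + s" using div_mult_mod_eq[of n 3] by simp
      then show False using that by blast
    qed
    then show ?thesis by (simp add: c_def)
  qed
  have ck: "c (3 * k + s) = 3 ^ k * pochhammer p k / fact (3 * k + s)" for k
    using s by (simp add: c_def)
  have sums: "(\<lambda>n. c n * x ^ n) sums f x" for x
  proof -
    have "(\<lambda>k. c (3*k+s) * x ^ (3*k+s)) sums f x"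
      unfolding f_def ck using summable_sums[OF airy_coeff_summable[OF p, of x s]] by simp
    then show ?thesis using sums_mono_reindex[OF mono, of "\<lambda>n. c n * x ^ n" "f x"] rng by simp
  qed
  have feq: "f = (\<lambda>x. \<Sum>n. c n * x ^ n)" using sums by (auto simp: sums_iff)
  have c2: "c 2 = 0" using s by (simp add: c_def)
  have rec: "real (n + 3) * real (n + 2) * c (n + 3) = c n" for n
  proof (cases "n mod 3 = s")
    case True
    define k where "k = n div 3"
    have n: "n = 3 * k + s" using True div_mult_mod_eq[of n 3] by (simp add: k_def)
    have n3: "n + 3 = 3 * Suc k + s" using n by simp
    have "c (n + 3) = 3 ^ Suc k * pochhammer p (Suc k) / fact (n + 3)" unfolding n3 ck ..
    also have "\<dots> = 3 ^ k * pochhammer p k * (3 * p + 3 * real k) / fact (n + 3)"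
      by (simp add: pochhammer_Suc algebra_simps)
    \<comment> \<open>Here the relation between \<open>p\<close> and \<open>s\<close> enters: the
      new Pochhammer factor cancels the factor \<open>n + 1\<close> of
      \<open>fact (n + 3)\<close>.\<close>
    also have "3 * p + 3 * real k = real (n + 1)" using s n by simp
    also have "fact (n + 3) = real (n+3) * real (n+2) * real (n+1) * fact n"
      by (simp add: eval_nat_numeral algebra_simps)
    finally have "c (n + 3) = c n / (real (n+3) * real (n+2))"
      unfolding ck[of k, folded n] by simp
    then show ?thesis by simp
  next
    case False then show ?thesis by (simp add: c_def)
  qed
  have summ: "summable (\<lambda>n. c n * x ^ n)" for x using sums by (auto simp: sums_iff)
  define f' where "f' x = (\<Sum>n. diffs c n * x ^ n)" for x
  have ode: "(f has_real_derivative f' x) (at x)" "(f' has_real_derivative x * f x) (at x)"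
    "f 0 = c 0" "f' 0 = c 1" for x
    unfolding f'_def feq by (rule powser_airy_ode[OF summ c2 rec])+
  have "c 0 = of_bool (s = 0)" "c 1 = of_bool (s = 1)" using s by (auto simp: c_def)
  then show thesis by (intro that[of f'] ode) (simp_all add: ode)
qed

text \<open>The equation without couplings, on the whole line. The derivative is a separate argument
  so that Wronskians are plain expressions in four functions.\<close>

definition airy_sol :: "real \<Rightarrow> real \<Rightarrow> (real \<Rightarrow> real) \<Rightarrow> (real \<Rightarrow> real) \<Rightarrow> bool" where
  "airy_sol F E u u' \<longleftrightarrow> (\<forall>x. (u has_real_derivative u' x) (at x) \<and>
     (u' has_real_derivative - (F * x + E) * u x) (at x))"

lemma airy_sol_lincomb:
  assumes "airy_sol F E u u'" "airy_sol F E v v'"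
  shows "airy_sol F E (\<lambda>x. a * u x + b * v x) (\<lambda>x. a * u' x + b * v' x)"
  using assms unfolding airy_sol_def
  by (auto intro!: derivative_eq_intros simp: algebra_simps)

lemma DERIV_zero_imp_const:
  fixes f :: "real \<Rightarrow> real"
  assumes "\<And>x. (f has_real_derivative 0) (at x)"
  shows "f x = f y"
  using DERIV_const_ratio_const2[of x y f 0] assms by (metis DERIV_isconst_all)

lemma wronskian_const:
  assumes "airy_sol F E u u'" "airy_sol F E v v'"
  shows "u x * v' x - u' x * v x = u y * v' y - u' y * v y"
proof (rule DERIV_zero_imp_const[where f = "\<lambda>x. u x * v' x - u' x * v x"])
  fix x
  show "((\<lambda>x. u x * v' x - u' x * v x) has_real_derivative 0) (at x)"
    using assms unfolding airy_sol_def
    by (auto intro!: derivative_eq_intros simp: algebra_simps)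
qed

text \<open>For \<open>y = - r * (x + E / F)\<close> with \<open>r\<close> the cube root of
  \<open>F\<close>, the chain rule turns the Airy potential \<open>y\<close> into
  \<open>r * r * y = - (F * x + E)\<close>.\<close>

lemma airy_sol_rescale:
  fixes F E :: real
  assumes F: "F > 0"
    and f: "\<And>x. (f has_real_derivative f' x) (at x)"
    and f': "\<And>x. (f' has_real_derivative x * f x) (at x)"
  defines "r \<equiv> F powr (1/3)"
  shows "airy_sol F E (\<lambda>x. f (- r * (x + E / F))) (\<lambda>x. - r * f' (- r * (x + E / F)))"
proof -
  have r3: "r * r * r = F"
    unfolding r_def powr_add[symmetric] using F by simp
  have arg: "((\<lambda>x. - r * (x + E / F)) has_real_derivative - r) (at x)" for x
    by (auto intro!: derivative_eq_intros)
  have d1: "((\<lambda>x. f (- r * (x + E / F))) has_real_derivative - r * f' (- r * (x + E / F))) (at x)" for x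
    using DERIV_chain2[OF f arg] by (simp add: mult.commute)
  have "((\<lambda>x. - r * f' (- r * (x + E / F))) has_real_derivative
      - r * ((- r * (x + E / F)) * f (- r * (x + E / F)) * - r)) (at x)" for x
    by (rule DERIV_cmult[OF DERIV_chain2[OF f' arg]])
  moreover have "- r * ((- r * (x + E / F)) * f (- r * (x + E / F)) * - r)
      = - (F * x + E) * f (- r * (x + E / F))" for x
  proof -
    have "- r * ((- r * (x + E / F)) * f (- r * (x + E / F)) * - r) = - (r*r*r*(x + E / F)) * f (- r * (x + E / F))"
      by (simp add: algebra_simps)
    also have "r*r*r*(x + E / F) = F * x + E" unfolding r3 using F by (simp add: field_simps)
    finally show ?thesis .
  qed
  ultimately show ?thesis unfolding airy_sol_def using d1 by metis
qed

text \<open>The Wronskian is constant, so it may be evaluated at the turning point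
  \<open>x = - E / F\<close>, where the two series have data (1, 0) and (0, 1); the value
  \<open>- 2 * sqrt 3 * airy_c1 * airy_c2 * r\<close> is nonzero.\<close>

lemma Ai_Bi_sols:
  assumes F: "F > (0::real)"
  obtains A A' B B' where "airy_sol F E A A'" "airy_sol F E B B'"
    and "\<And>x. A x * B' x - A' x * B x \<noteq> 0"
    and "\<And>x. A x = Ai (- (F powr (1/3)) * (x + E / F))"
    and "\<And>x. B x = Bi (- (F powr (1/3)) * (x + E / F))"
proof -
  obtain f' where f: "\<And>x. (airy_f has_real_derivative f' x) (at x)"
    "\<And>x. (f' has_real_derivative x * airy_f x) (at x)" "airy_f 0 = 1" "f' 0 = 0"
    using airy_series_ode[of "1/3" 0] unfolding airy_f_def by (auto simp: fun_eq_iff)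
  obtain g' where g: "\<And>x. (airy_g has_real_derivative g' x) (at x)"
    "\<And>x. (g' has_real_derivative x * airy_g x) (at x)" "airy_g 0 = 0" "g' 0 = 1"
    using airy_series_ode[of "2/3" 1] unfolding airy_g_def by (auto simp: fun_eq_iff)
  define r where "r = F powr (1/3)"
  have r: "r > 0" using F by (simp add: r_def)
  define y where "y x = - r * (x + E / F)" for x
  note solf = airy_sol_rescale[OF F f(1,2), of E, folded r_def y_def]
  note solg = airy_sol_rescale[OF F g(1,2), of E, folded r_def y_def]
  let ?s = "sqrt 3"
  have c: "airy_c1 > 0" "airy_c2 > 0" by (simp_all add: airy_c1_def airy_c2_def Gamma_real_pos)
  note solA = airy_sol_lincomb[OF solf solg, of airy_c1 "- airy_c2"]
  note solB = airy_sol_lincomb[OF solf solg, of "?s * airy_c1" "?s * airy_c2"]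
  have y0: "y (- (E / F)) = 0" by (simp add: y_def)
  show thesis
  proof (rule that[OF solA solB])
    fix x
    show "airy_c1 * airy_f (y x) + - airy_c2 * airy_g (y x) = Ai (- (F powr (1/3)) * (x + E / F))"
      by (simp add: Ai_def y_def r_def)
    show "?s * airy_c1 * airy_f (y x) + ?s * airy_c2 * airy_g (y x) = Bi (- (F powr (1/3)) * (x + E / F))"
      by (simp add: Bi_def y_def r_def algebra_simps)
    show "(airy_c1 * airy_f (y x) + - airy_c2 * airy_g (y x)) *
         (?s * airy_c1 * (- r * f' (y x)) + ?s * airy_c2 * (- r * g' (y x))) -
         (airy_c1 * (- r * f' (y x)) + - airy_c2 * (- r * g' (y x))) *
         (?s * airy_c1 * airy_f (y x) + ?s * airy_c2 * airy_g (y x)) \<noteq> 0"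
      using wronskian_const[OF solA solB, of x "- (E / F)"] r c by (simp add: y0 f g)
  qed
qed

section \<open>WKB asymptotics\<close>

text \<open>The primitive of \<open>sqrt (F * x + E)\<close> that vanishes at the turning
  point.\<close>

definition wkb_phase :: "real \<Rightarrow> real \<Rightarrow> real \<Rightarrow> real" where
  "wkb_phase F E x = 2 / (3 * F) * (F * x + E) powr (3/2)"

lemma affine_at_top:
  assumes "F > (0::real)"
  shows "filterlim (\<lambda>n. F * real n + E) at_top sequentially"
proof -
  have "filterlim (\<lambda>n. F * real n) at_top sequentially"
    by (rule filterlim_tendsto_pos_mult_at_top[OF tendsto_const assms filterlim_real_sequentially])
  then have "filterlim (\<lambda>n. E + F * real n) at_top sequentially"
    by (rule filterlim_tendsto_add_at_top[OF tendsto_const])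
  then show ?thesis by (simp add: add.commute)
qed

lemma powr_affine_deriv:
  assumes "F * x + E > (0::real)"
  shows "((\<lambda>x. (F * x + E) powr p) has_real_derivative p * F * (F * x + E) powr (p - 1)) (at x)"
proof -
  have "((\<lambda>x. F * x + E) has_real_derivative F) (at x)" by (auto intro!: derivative_eq_intros)
  from DERIV_fun_powr[OF this assms, of p] show ?thesis by (simp add: mult_ac)
qed

lemma wkb_phase_deriv:
  assumes "F > 0" "F * x + E > 0"
  shows "(wkb_phase F E has_real_derivative (F * x + E) powr (1/2)) (at x)"
proof -
  have "(wkb_phase F E has_real_derivative 2 / (3 * F) * (3/2 * F * (F * x + E) powr (3/2 - 1))) (at x)"
    unfolding wkb_phase_def by (rule DERIV_cmult[OF powr_affine_deriv[OF assms(2)]])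
  then show ?thesis using assms(1) by simp
qed

text \<open>The phase shift \<open>s\<close> covers the cosine (\<open>s = 0\<close>) and the sine (\<open>s = - pi / 2\<close>) in one go.\<close>

definition wkb :: "real \<Rightarrow> real \<Rightarrow> real \<Rightarrow> real \<Rightarrow> real" where
  "wkb F E s x = (F * x + E) powr (-1/4) * cos (wkb_phase F E x + s)"

definition wkb' :: "real \<Rightarrow> real \<Rightarrow> real \<Rightarrow> real \<Rightarrow> real" where
  "wkb' F E s x = - F / 4 * (F * x + E) powr (-5/4) * cos (wkb_phase F E x + s)
     - (F * x + E) powr (1/4) * sin (wkb_phase F E x + s)"

text \<open>The amplitude exponent -1/4 is the one for which the sine terms of the second derivative
  cancel. The defect \<open>5 * F\<^sup>2 / 16 / (F * x + E)\<^sup>2\<close> comes from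
  differentiating the amplitude twice: 5/16 is the product of -1/4 and -5/4.\<close>

lemma wkb_deriv:
  assumes F: "F > 0" and y: "F * x + E > 0"
  shows "(wkb F E s has_real_derivative wkb' F E s x) (at x)"
    and "(wkb' F E s has_real_derivative
           (5 * F\<^sup>2 / 16 / (F * x + E)\<^sup>2 - (F * x + E)) * wkb F E s x) (at x)"
proof -
  define y where "y = F * x + E"
  have y0: "y > 0" using assms by (simp add: y_def)
  have split: "y powr a * y powr b = y powr (a + b)" for a b by (simp add: powr_add)
  note ph = wkb_phase_deriv[OF assms, folded y_def]
  have c: "((\<lambda>x. cos (wkb_phase F E x + s)) has_real_derivative - sin (wkb_phase F E x + s) * y powr (1/2)) (at x)"
    using ph by (auto intro!: derivative_eq_intros)
  have sn: "((\<lambda>x. sin (wkb_phase F E x + s)) has_real_derivative cos (wkb_phase F E x + s) * y powr (1/2)) (at x)"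
    using ph by (auto intro!: derivative_eq_intros)
  note p = powr_affine_deriv[OF y, folded y_def]
  define co si where "co = cos (wkb_phase F E x + s)" and "si = sin (wkb_phase F E x + s)"
  have "(wkb F E s has_real_derivative ((-1/4) * F * y powr (-1/4 - 1)) * co + (- si * y powr (1/2)) * y powr (-1/4)) (at x)"
    unfolding wkb_def co_def si_def using DERIV_mult[OF p[of "-1/4"] c] by (simp add: y_def)
  also have "((-1/4) * F * y powr (-1/4 - 1)) * co + (- si * y powr (1/2)) * y powr (-1/4) = wkb' F E s x"
  proof -
    have "y powr (1/2) * y powr (-1/4) = y powr (1/4)" by (simp add: split)
    then show ?thesis by (simp add: wkb'_def co_def si_def y_def[symmetric] mult.assoc)
  qed
  finally show "(wkb F E s has_real_derivative wkb' F E s x) (at x)" .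
  have "(wkb' F E s has_real_derivative
      (- F / 4 * ((-5/4) * F * y powr (-5/4 - 1))) * co + (- si * y powr (1/2)) * (- F / 4 * y powr (-5/4))
      - ((1/4 * F * y powr (1/4 - 1)) * si + (co * y powr (1/2)) * y powr (1/4))) (at x)"
    unfolding wkb'_def co_def si_def
    using DERIV_diff[OF DERIV_mult[OF DERIV_cmult[OF p[of "-5/4"], of "- F / 4"] c] DERIV_mult[OF p[of "1/4"] sn]] by (simp add: y_def)
  also have "(- F / 4 * ((-5/4) * F * y powr (-5/4 - 1))) * co + (- si * y powr (1/2)) * (- F / 4 * y powr (-5/4))
      - ((1/4 * F * y powr (1/4 - 1)) * si + (co * y powr (1/2)) * y powr (1/4))
      = (5 * F\<^sup>2 / 16 / y\<^sup>2 - y) * wkb F E s x"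
  proof -
    have 1: "y powr (-5/4 - 1) = y powr (-1/4) / y\<^sup>2"
      using y0 split[of "-1/4" "-2"] by (simp add: powr_minus_divide)
    have 2: "y powr (1/2) * y powr (-5/4) = y powr (1/4 - 1)" by (simp add: split)
    have 3: "y powr (1/2) * y powr (1/4) = y * y powr (-1/4)" 
      using y0 split[of 1 "-1/4"] by (simp add: split)
    have "(- F / 4 * ((-5/4) * F * y powr (-5/4 - 1))) * co + (- si * y powr (1/2)) * (- F / 4 * y powr (-5/4))
      - ((1/4 * F * y powr (1/4 - 1)) * si + (co * y powr (1/2)) * y powr (1/4))
      = 5 * F\<^sup>2 / 16 * y powr (-5/4 - 1) * co + F / 4 * si * (y powr (1/2) * y powr (-5/4))
      - (F / 4 * si * y powr (1/4 - 1) + co * (y powr (1/2) * y powr (1/4)))"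
      by (simp add: power2_eq_square algebra_simps)
    also have "\<dots> = (5 * F\<^sup>2 / 16 / y\<^sup>2 - y) * (y powr (-1/4) * co)"
      unfolding 1 2 3 by (simp add: algebra_simps)
    finally show ?thesis by (simp add: wkb_def co_def y_def)
  qed
  finally show "(wkb' F E s has_real_derivative
           (5 * F\<^sup>2 / 16 / (F * x + E)\<^sup>2 - (F * x + E)) * wkb F E s x) (at x)" by (simp add: y_def)
qed

lemma wkb_wronskian:
  assumes "F * x + E > 0"
  shows "wkb F E 0 x * wkb' F E (- pi / 2) x - wkb' F E 0 x * wkb F E (- pi / 2) x = 1"
proof -
  define y where "y = F * x + E"
  have "y powr (-1/4) * y powr (1/4) = 1"
    using assms by (simp add: powr_add[symmetric] y_def)
  moreover define t where "t = wkb_phase F E x"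
  have "cos (t - pi / 2) = sin t" "sin (t - pi / 2) = - cos t" by (simp_all add: cos_diff sin_diff)
  ultimately show ?thesis
    unfolding wkb_def wkb'_def y_def[symmetric] t_def[symmetric]
    using sin_cos_squared_add3[of t] by (simp add: algebra_simps)
qed

text \<open>Variation of constants: \<open>s = - pi / 2\<close> gives the coefficient of the cosine,
  \<open>s = 0\<close> minus that of the sine.\<close>

definition wkb_coeff :: "real \<Rightarrow> real \<Rightarrow> real \<Rightarrow> (real \<Rightarrow> real) \<Rightarrow> (real \<Rightarrow> real) \<Rightarrow> real \<Rightarrow> real" where
  "wkb_coeff F E s u u' x = u x * wkb' F E s x - u' x * wkb F E s x"

text \<open>The coefficient is a Wronskian, so in its derivative the common potential
  \<open>- (F * x + E)\<close> cancels and only the defect of the WKB function survives.\<close>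

lemma wkb_coeff_deriv:
  assumes "F > 0" "F * x + E > 0" "airy_sol F E u u'"
  shows "(wkb_coeff F E s u u' has_real_derivative
     5 * F\<^sup>2 / 16 / (F * x + E)\<^sup>2 * u x * wkb F E s x) (at x)"
proof -
  have u: "(u has_real_derivative u' x) (at x)" "(u' has_real_derivative - (F * x + E) * u x) (at x)"
    using assms(3) by (auto simp: airy_sol_def)
  show ?thesis unfolding wkb_coeff_def
    using DERIV_diff[OF DERIV_mult[OF u(1) wkb_deriv(2)[OF assms(1,2)]] DERIV_mult[OF u(2) wkb_deriv(1)[OF assms(1,2)]]]
    by (rule DERIV_cong) (simp add: algebra_simps)
qed

context
  fixes F E :: real and u u' :: "real \<Rightarrow> real"
  assumes F: "F > 0" and sol: "airy_sol F E u u'"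
begin

private abbreviation "a \<equiv> wkb_coeff F E (- pi / 2) u u'"
private abbreviation "b \<equiv> \<lambda>x. - wkb_coeff F E 0 u u' x"

lemma wkb_expansion:
  assumes "F * x + E > 0"
  shows "u x = a x * wkb F E 0 x + b x * wkb F E (- pi / 2) x"
proof -
  have "a x * wkb F E 0 x + b x * wkb F E (- pi / 2) x = u x *
    (wkb F E 0 x * wkb' F E (- pi / 2) x - wkb' F E 0 x * wkb F E (- pi / 2) x)"
    by (simp add: wkb_coeff_def algebra_simps)
  then show ?thesis using wkb_wronskian[OF assms] by simp
qed

lemma wkb_abs_le: "\<bar>wkb F E s x\<bar> \<le> (F * x + E) powr (-1/4)"
  unfolding wkb_def by (simp add: abs_mult mult_left_le)

text \<open>The exponent -5/2 collects -2 from the defect and -1/4 from each of the two oscillating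
  factors; it is integrable at infinity, which is what makes the coefficients converge.\<close>

lemma wkb_coeff_deriv_bound:
  assumes "F * x + E > 0"
  shows "\<bar>5 * F\<^sup>2 / 16 / (F * x + E)\<^sup>2 * u x * wkb F E s x\<bar>
    \<le> 5 * F\<^sup>2 / 16 * (F * x + E) powr (-5/2) * (\<bar>a x\<bar> + \<bar>b x\<bar>)"
proof -
  define y where "y = F * x + E"
  have y: "y > 0" using assms by (simp add: y_def)
  let ?w = "y powr (-1/4)"
  have "\<bar>u x\<bar> \<le> \<bar>a x\<bar> * ?w + \<bar>b x\<bar> * ?w"
    unfolding wkb_expansion[OF assms] y_def
    by (intro order_trans[OF abs_triangle_ineq] add_mono) (auto simp: abs_mult intro!: mult_left_mono wkb_abs_le[simplified])
  then have "\<bar>u x\<bar> * \<bar>wkb F E s x\<bar> \<le> ((\<bar>a x\<bar> + \<bar>b x\<bar>) * ?w) * ?w"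
    by (intro mult_mono) (auto simp: distrib_right y_def wkb_abs_le[simplified])
  then have "5 * F\<^sup>2 / 16 / y\<^sup>2 * (\<bar>u x\<bar> * \<bar>wkb F E s x\<bar>) \<le> 5 * F\<^sup>2 / 16 / y\<^sup>2 * (((\<bar>a x\<bar> + \<bar>b x\<bar>) * ?w) * ?w)"
    by (intro mult_left_mono) auto
  also have "\<dots> = 5 * F\<^sup>2 / 16 * (?w * ?w / y\<^sup>2) * (\<bar>a x\<bar> + \<bar>b x\<bar>)" by simp
  also have "?w * ?w / y\<^sup>2 = y powr (-1/4 + -1/4 + -2)"
    using y by (simp only: powr_add) (simp add: powr_minus_divide)
  finally show ?thesis unfolding y_def[symmetric] by (simp add: abs_mult mult.assoc)
qed

text \<open>A primitive of four times the rate in \<open>wkb_coeff_deriv_bound\<close>. Being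
  nonpositive and vanishing at infinity, it serves first as a Gronwall exponent and then as a
  monotone correction.\<close>

private abbreviation "Q \<equiv> \<lambda>x. - 5 * F / 6 * (F * x + E) powr (-3/2)"

lemma wkb_majorant_deriv:
  assumes "F * x + E > 0"
  shows "(Q has_real_derivative 5 * F\<^sup>2 / 4 * (F * x + E) powr (-5/2)) (at x)"
proof -
  have "(Q has_real_derivative - 5 * F / 6 * ((-3/2) * F * (F * x + E) powr (-3/2 - 1))) (at x)"
    by (rule DERIV_cmult[OF powr_affine_deriv[OF assms]])
  then show ?thesis by (rule DERIV_cong) (simp add: power2_eq_square)
qed

text \<open>Gronwall's argument: with \<open>q\<close> the rate of the derivative bound, the
  derivative of \<open>(a x)\<^sup>2 + (b x)\<^sup>2\<close> is at most
  \<open>2 * q * (\<bar>a x\<bar> + \<bar>b x\<bar>)\<^sup>2\<close>, hence at most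
  \<open>4 * q\<close> times the function itself, and \<open>4 * q\<close> is the derivative of
  \<open>Q\<close>.\<close>

lemma wkb_coeff_bounded:
  assumes x0: "F * x0 + E > 0"
  obtains K where "\<And>x. x0 \<le> x \<Longrightarrow> \<bar>a x\<bar> + \<bar>b x\<bar> \<le> K"
proof -
  let ?e = "\<lambda>x. ((a x)\<^sup>2 + (b x)\<^sup>2) * exp (- Q x)"
  have mono: "?e x \<le> ?e x0" if x: "x0 \<le> x" for x
  proof (rule DERIV_nonpos_imp_nonincreasing[OF x])
    fix z assume z: "x0 \<le> z" "z \<le> x"
    have y: "F * z + E > 0" using x0 z F by (smt (verit) mult_left_mono)
    define a' b' q where "a' = 5 * F\<^sup>2 / 16 / (F * z + E)\<^sup>2 * u z * wkb F E (- pi / 2) z"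
      and "b' = 5 * F\<^sup>2 / 16 / (F * z + E)\<^sup>2 * u z * wkb F E 0 z"
      and "q = 5 * F\<^sup>2 / 16 * (F * z + E) powr (-5/2)"
    have da: "(a has_real_derivative a') (at z)" and db: "(b has_real_derivative - b') (at z)"
      unfolding a'_def b'_def by (intro wkb_coeff_deriv DERIV_minus F y sol)+
    have dQ: "(Q has_real_derivative 4 * q) (at z)"
      using wkb_majorant_deriv[OF y] by (rule DERIV_cong) (simp add: q_def)
    have "(?e has_real_derivative (2 * (a z * a' - b z * b') - ((a z)\<^sup>2 + (b z)\<^sup>2) * (4 * q)) * exp (- Q z)) (at z)"
      by (rule derivative_eq_intros da db dQ refl)+ (simp add: algebra_simps)
    moreover have "2 * (a z * a' - b z * b') - ((a z)\<^sup>2 + (b z)\<^sup>2) * (4 * q) \<le> 0"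
    proof -
      let ?s = "\<bar>a z\<bar> + \<bar>b z\<bar>"
      have q: "q \<ge> 0" by (simp add: q_def)
      have "\<bar>a'\<bar> \<le> q * ?s" "\<bar>b'\<bar> \<le> q * ?s"
        using wkb_coeff_deriv_bound[OF y] by (simp_all add: a'_def b'_def q_def)
      then have "\<bar>a z\<bar> * \<bar>a'\<bar> + \<bar>b z\<bar> * \<bar>b'\<bar> \<le> \<bar>a z\<bar> * (q * ?s) + \<bar>b z\<bar> * (q * ?s)"
        by (intro add_mono mult_left_mono) auto
      also have "\<dots> = q * ?s\<^sup>2" by (simp add: power2_eq_square algebra_simps)
      also have "\<dots> \<le> q * (2 * ((a z)\<^sup>2 + (b z)\<^sup>2))"
      proof (rule mult_left_mono[OF _ q])
        have "0 \<le> (\<bar>a z\<bar> - \<bar>b z\<bar>)\<^sup>2" by simp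
        then show "?s\<^sup>2 \<le> 2 * ((a z)\<^sup>2 + (b z)\<^sup>2)" by (simp add: power2_eq_square algebra_simps)
      qed
      finally have "\<bar>a z\<bar> * \<bar>a'\<bar> + \<bar>b z\<bar> * \<bar>b'\<bar> \<le> q * (2 * ((a z)\<^sup>2 + (b z)\<^sup>2))" .
      moreover have "a z * a' - b z * b' \<le> \<bar>a z\<bar> * \<bar>a'\<bar> + \<bar>b z\<bar> * \<bar>b'\<bar>"
        unfolding abs_mult[symmetric] by linarith
      ultimately show ?thesis by (simp add: algebra_simps)
    qed
    ultimately show "\<exists>l. (?e has_real_derivative l) (at z) \<and> l \<le> 0"
      by (meson exp_ge_zero mult_nonpos_nonneg)
  qed
  have "\<bar>a x\<bar> + \<bar>b x\<bar> \<le> 1 + 2 * ?e x0" if "x0 \<le> x" for x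
  proof -
    have "0 \<le> - Q x" using F by simp
    then have "1 \<le> exp (- Q x)" by (simp only: one_le_exp_iff)
    then have "((a x)\<^sup>2 + (b x)\<^sup>2) * 1 \<le> ?e x" by (intro mult_left_mono) auto
    also note mono[OF that]
    finally have 1: "(a x)\<^sup>2 + (b x)\<^sup>2 \<le> ?e x0" by simp
    have "0 \<le> (\<bar>a x\<bar> - 1/2)\<^sup>2" "0 \<le> (\<bar>b x\<bar> - 1/2)\<^sup>2" by simp_all
    then have "\<bar>a x\<bar> \<le> (a x)\<^sup>2 + 1/4" "\<bar>b x\<bar> \<le> (b x)\<^sup>2 + 1/4" by (simp_all add: power2_eq_square algebra_simps)
    moreover have "0 \<le> ?e x0" by simp
    ultimately show ?thesis using 1 by linarith
  qed
  then show thesis by (rule that)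
qed

text \<open>With \<open>K\<close> bounding the coefficients, the derivative of
  \<open>K / 4 * Q\<close> equals the bound on the derivative of the coefficient. Adding this term
  makes the coefficient nondecreasing and bounded above; since \<open>Q\<close> tends to 0, removing
  it again keeps the limit.\<close>

lemma wkb_coeff_convergent:
  assumes "s = 0 \<or> s = - pi / 2"
  shows "convergent (\<lambda>n. wkb_coeff F E s u u' (real n))"
proof -
  obtain N :: nat where "- E / F < real N" using reals_Archimedean2 by blast
  then have x0: "F * real N + E > 0" using F by (simp add: field_simps)
  then obtain K where K: "\<And>x. real N \<le> x \<Longrightarrow> \<bar>a x\<bar> + \<bar>b x\<bar> \<le> K"
    using wkb_coeff_bounded by blast
  have K0: "K \<ge> 0" using K[of "real N"] by simp
  let ?c = "wkb_coeff F E s u u'"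
  have cK: "\<bar>?c x\<bar> \<le> K" if "real N \<le> x" for x using K[OF that] assms by auto
  define h where "h x = ?c x + K / 4 * Q x" for x
  have mono: "h x \<le> h x'" if x: "real N \<le> x" "x \<le> x'" for x x'
  proof (rule DERIV_nonneg_imp_nondecreasing[OF x(2)])
    fix z assume z: "x \<le> z" "z \<le> x'"
    then have zN: "real N \<le> z" using x by simp
    then have y: "F * z + E > 0" using x0 F by (smt (verit) mult_left_mono)
    have dh: "(h has_real_derivative 5 * F\<^sup>2 / 16 / (F * z + E)\<^sup>2 * u z * wkb F E s z + K / 4 * (5 * F\<^sup>2 / 4 * (F * z + E) powr (-5/2))) (at z)"
      unfolding h_def by (intro DERIV_add DERIV_cmult wkb_coeff_deriv wkb_majorant_deriv F y sol)
    have "5 * F\<^sup>2 / 16 * (F * z + E) powr (-5/2) * (\<bar>a z\<bar> + \<bar>b z\<bar>) \<le> 5 * F\<^sup>2 / 16 * (F * z + E) powr (-5/2) * K"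
      by (intro mult_left_mono K zN) auto
    then have "- (5 * F\<^sup>2 / 16 / (F * z + E)\<^sup>2 * u z * wkb F E s z) \<le> 5 * F\<^sup>2 / 16 * (F * z + E) powr (-5/2) * K"
      by (rule abs_le_D2[OF order_trans[OF wkb_coeff_deriv_bound[OF y]]])
    moreover have "K / 4 * (5 * F\<^sup>2 / 4 * (F * z + E) powr (-5/2)) = 5 * F\<^sup>2 / 16 * (F * z + E) powr (-5/2) * K" by simp
    ultimately have "0 \<le> 5 * F\<^sup>2 / 16 / (F * z + E)\<^sup>2 * u z * wkb F E s z + K / 4 * (5 * F\<^sup>2 / 4 * (F * z + E) powr (-5/2))"
      by linarith
    then show "\<exists>l. (h has_real_derivative l) (at z) \<and> 0 \<le> l" using dh by blast
  qed
  have "incseq (\<lambda>n. h (real (n + N)))" by (intro incseq_SucI mono) auto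
  moreover have "h (real (n + N)) \<le> K" for n
  proof -
    have "K / 4 * Q (real (n + N)) \<le> 0" using K0 F by simp
    moreover have "\<bar>?c (real (n + N))\<bar> \<le> K" by (rule cK) simp
    ultimately show ?thesis unfolding h_def by linarith
  qed
  ultimately obtain L where "(\<lambda>n. h (real (n + N))) \<longlonglongrightarrow> L"
    using incseq_convergent by blast
  then have "(\<lambda>n. h (real n)) \<longlonglongrightarrow> L" by (rule LIMSEQ_offset)
  moreover have "(\<lambda>n. Q (real n)) \<longlonglongrightarrow> 0"
    by (intro tendsto_mult_right_zero tendsto_neg_powr affine_at_top F) simp
  then have "(\<lambda>n. K / 4 * Q (real n)) \<longlonglongrightarrow> 0" by (rule tendsto_mult_right_zero)
  ultimately have "(\<lambda>n. h (real n) - K / 4 * Q (real n)) \<longlonglongrightarrow> L - 0" by (rule tendsto_diff)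
  then show ?thesis unfolding convergent_def by (auto simp: h_def)
qed

end

lemma wkb_asymptotics:
  assumes F: "F > 0" and sol: "airy_sol F E u u'"
    and a: "(\<lambda>n. wkb_coeff F E (- pi / 2) u u' (real n)) \<longlonglongrightarrow> a"
    and b: "(\<lambda>n. wkb_coeff F E 0 u u' (real n)) \<longlonglongrightarrow> - b"
  shows "(\<lambda>n. (F * real n + E) powr (1/4) * u (real n)
     - (a * cos (wkb_phase F E (real n)) + b * sin (wkb_phase F E (real n)))) \<longlonglongrightarrow> 0"
proof (rule Lim_transform_eventually)
  let ?a = "\<lambda>n. wkb_coeff F E (- pi / 2) u u' (real n)" and ?b = "\<lambda>n. - wkb_coeff F E 0 u u' (real n)"
  let ?t = "\<lambda>n. wkb_phase F E (real n)"
  have da: "(\<lambda>n. ?a n - a) \<longlonglongrightarrow> 0" and db: "(\<lambda>n. ?b n - b) \<longlonglongrightarrow> 0"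
    using a tendsto_minus[OF b] by (simp_all add: LIM_zero_iff)
  have "(\<lambda>n. (?a n - a) * cos (?t n)) \<longlonglongrightarrow> 0"
    by (rule Lim_null_comparison[OF _ tendsto_norm_zero[OF da]]) (simp add: abs_mult mult_left_le)
  moreover have "(\<lambda>n. (?b n - b) * sin (?t n)) \<longlonglongrightarrow> 0"
    by (rule Lim_null_comparison[OF _ tendsto_norm_zero[OF db]]) (simp add: abs_mult mult_left_le)
  ultimately show "(\<lambda>n. (?a n - a) * cos (?t n) + (?b n - b) * sin (?t n)) \<longlonglongrightarrow> 0"
    by (rule tendsto_add_zero)
  have "eventually (\<lambda>n. F * real n + E > 0) sequentially"
    using affine_at_top[OF F] unfolding filterlim_at_top_dense by blast
  then show "eventually (\<lambda>n. (?a n - a) * cos (?t n) + (?b n - b) * sin (?t n)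
     = (F * real n + E) powr (1/4) * u (real n) - (a * cos (?t n) + b * sin (?t n))) sequentially"
  proof eventually_elim
    case (elim n)
    let ?y = "F * real n + E"
    have y: "?y powr (1/4) * ?y powr (-1/4) = 1" using elim by (simp add: powr_add[symmetric])
    have "?y powr (1/4) * u (real n) = ?y powr (1/4) * ?y powr (-1/4) * (?a n * cos (?t n) + ?b n * cos (?t n - pi / 2))"
      unfolding wkb_expansion[OF F sol elim] wkb_def by (simp add: algebra_simps)
    then show ?case unfolding y by (simp add: cos_diff algebra_simps)
  qed
qed

text \<open>The limiting WKB coefficients of \<open>A\<close> and \<open>B\<close> form an
  invertible matrix, because beyond the turning point the determinant at each \<open>n\<close> is
  the Wronskian of \<open>A\<close> and \<open>B\<close> times that of the two WKB functions, which
  is 1. Inverting the matrix gives solutions asymptotic to the pure cosine and the pure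
  sine.\<close>

lemma adapted_basis:
  assumes F: "F > 0" and A: "airy_sol F E A A'" and B: "airy_sol F E B B'"
    and W: "\<And>x. A x * B' x - A' x * B x \<noteq> 0"
  obtains u u' v v' k l m r where
    "airy_sol F E u u'" "airy_sol F E v v'" "\<And>x. u x * v' x - u' x * v x = 1"
    "\<And>x. u x = k * A x + l * B x" "\<And>x. v x = m * A x + r * B x" "k * r - l * m \<noteq> 0"
    "(\<lambda>n. (F * real n + E) powr (1/4) * u (real n) - cos (wkb_phase F E (real n))) \<longlonglongrightarrow> 0"
    "(\<lambda>n. (F * real n + E) powr (1/4) * v (real n) - sin (wkb_phase F E (real n))) \<longlonglongrightarrow> 0"
proof -
  define w where "w = A 0 * B' 0 - A' 0 * B 0"
  have w0: "w \<noteq> 0" using W by (simp add: w_def)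
  have w: "A x * B' x - A' x * B x = w" for x unfolding w_def by (rule wronskian_const[OF A B])
  let ?c = "\<lambda>s u u' n. wkb_coeff F E s u u' (real n)"
  have conv: "convergent (?c (- pi / 2) u u')" "convergent (?c 0 u u')" if "airy_sol F E u u'" for u u'
    using wkb_coeff_convergent[OF F that, of "- pi / 2"] wkb_coeff_convergent[OF F that, of 0] by auto
  obtain a1 where a1: "?c (- pi / 2) A A' \<longlonglongrightarrow> a1" using conv(1)[OF A] by (auto simp: convergent_def)
  obtain b1 where b1: "?c 0 A A' \<longlonglongrightarrow> b1" using conv(2)[OF A] by (auto simp: convergent_def)
  obtain a2 where a2: "?c (- pi / 2) B B' \<longlonglongrightarrow> a2" using conv(1)[OF B] by (auto simp: convergent_def)
  obtain b2 where b2: "?c 0 B B' \<longlonglongrightarrow> b2" using conv(2)[OF B] by (auto simp: convergent_def)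
  have "(\<lambda>n. ?c 0 A A' n * ?c (- pi / 2) B B' n - ?c (- pi / 2) A A' n * ?c 0 B B' n) \<longlonglongrightarrow> b1 * a2 - a1 * b2"
    by (intro tendsto_intros a1 a2 b1 b2)
  moreover have "eventually (\<lambda>n. ?c 0 A A' n * ?c (- pi / 2) B B' n - ?c (- pi / 2) A A' n * ?c 0 B B' n = w) sequentially"
  proof -
    have "eventually (\<lambda>n. F * real n + E > 0) sequentially"
      using affine_at_top[OF F] unfolding filterlim_at_top_dense by blast
    then show ?thesis
    proof eventually_elim
      case (elim n)
      have "?c 0 A A' n * ?c (- pi / 2) B B' n - ?c (- pi / 2) A A' n * ?c 0 B B' n
        = (A n * B' n - A' n * B n) * (wkb F E 0 n * wkb' F E (- pi / 2) n - wkb' F E 0 n * wkb F E (- pi / 2) n)"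
        by (simp add: wkb_coeff_def algebra_simps)
      then show ?case unfolding wkb_wronskian[OF elim] w by simp
    qed
  qed
  then have "(\<lambda>n. ?c 0 A A' n * ?c (- pi / 2) B B' n - ?c (- pi / 2) A A' n * ?c 0 B B' n) \<longlonglongrightarrow> w"
    by (rule tendsto_eventually)
  ultimately have det: "b1 * a2 - a1 * b2 = w" by (rule LIMSEQ_unique)
  \<comment> \<open>Cramer's rule for the limit matrix. \<open>b1\<close> and \<open>b2\<close> are
    minus the sine coefficients, which explains the value \<open>- 1\<close> in
    \<open>mb\<close>.\<close>
  define k l m r where "k = - b2 / w" and "l = b1 / w" and "m = - a2 / w" and "r = a1 / w"
  note defs = k_def l_def m_def r_def
  have ka: "k * a1 + l * a2 = 1" and kb: "k * b1 + l * b2 = 0" and ma: "m * a1 + r * a2 = 0" and mb: "m * b1 + r * b2 = - 1"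
    using det w0 by (simp_all add: defs divide_simps) (simp_all add: algebra_simps)
  have kr: "(k * r - l * m) * w = 1"
    using det w0 by (simp add: defs divide_simps) (simp add: algebra_simps)
  note solu = airy_sol_lincomb[OF A B, of k l] and solv = airy_sol_lincomb[OF A B, of m r]
  have cl: "?c s (\<lambda>x. p * A x + q * B x) (\<lambda>x. p * A' x + q * B' x) n = p * ?c s A A' n + q * ?c s B B' n" for s p q n
    by (simp add: wkb_coeff_def algebra_simps)
  have lim: "?c (- pi / 2) (\<lambda>x. p * A x + q * B x) (\<lambda>x. p * A' x + q * B' x) \<longlonglongrightarrow> p * a1 + q * a2"
    "?c 0 (\<lambda>x. p * A x + q * B x) (\<lambda>x. p * A' x + q * B' x) \<longlonglongrightarrow> p * b1 + q * b2" for p q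
    unfolding cl by (intro tendsto_intros a1 a2 b1 b2)+
  show thesis
  proof (rule that[OF solu solv])
    show "(k * A x + l * B x) * (m * A' x + r * B' x) - (k * A' x + l * B' x) * (m * A x + r * B x) = 1" for x
      unfolding kr[symmetric] w[of x, symmetric] by (simp add: algebra_simps)
    show "k * r - l * m \<noteq> 0" using kr by auto
    show "(\<lambda>n. (F * real n + E) powr (1/4) * (k * A (real n) + l * B (real n)) - cos (wkb_phase F E (real n))) \<longlonglongrightarrow> 0"
      using wkb_asymptotics[OF F solu, of 1 0] lim[of k l] ka kb by simp
    show "(\<lambda>n. (F * real n + E) powr (1/4) * (m * A (real n) + r * B (real n)) - sin (wkb_phase F E (real n))) \<longlonglongrightarrow> 0"
      using wkb_asymptotics[OF F solv, of 0 1] lim[of m r] ma mb by simp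
  qed auto
qed

section \<open>Generalized eigenfunctions\<close>

text \<open>On an interval without integers the Wronskians of \<open>\<psi>\<close> with
  \<open>v\<close> and with \<open>u\<close> are constant; as \<open>u\<close> and \<open>v\<close>
  have Wronskian 1, these constants are the coefficients of \<open>\<psi>\<close> and of its
  derivative.\<close>

lemma gen_solution_representation:
  assumes \<psi>: "is_gen_solution F E g \<theta>0 \<psi>"
    and u: "airy_sol F E u u'" and v: "airy_sol F E v v'"
    and W: "\<And>x. u x * v' x - u' x * v x = 1"
    and n: "n \<ge> 1"
  obtains p q where "\<And>x. real n - 1 < x \<Longrightarrow> x < real n \<Longrightarrow> \<psi> x = p * u x + q * v x"
    and "\<And>x. real n - 1 < x \<Longrightarrow> x < real n \<Longrightarrow> deriv \<psi> x = p * u' x + q * v' x"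
proof -
  let ?P = "\<lambda>x. \<psi> x * v' x - deriv \<psi> x * v x" and ?Q = "\<lambda>x. u x * deriv \<psi> x - u' x * \<psi> x"
  define m where "m = real n - 1/2"
  have du: "(u has_real_derivative u' x) (at x)" "(u' has_real_derivative - (F * x + E) * u x) (at x)" for x
    using u by (auto simp: airy_sol_def)
  have dv: "(v has_real_derivative v' x) (at x)" "(v' has_real_derivative - (F * x + E) * v x) (at x)" for x
    using v by (auto simp: airy_sol_def)
  have d: "(\<psi> has_real_derivative deriv \<psi> x) (at x)"
      "(deriv \<psi> has_real_derivative (- (F * x + E) * \<psi> x)) (at x)"
    if x: "real n - 1 < x" "x < real n" for x
  proof -
    have "x \<notin> \<int>"
    proof
      assume "x \<in> \<int>"
      then obtain k where "x = of_int k" by (auto elim: Ints_cases)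
      then have "real_of_int (int n - 1) < real_of_int k" "real_of_int k < real_of_int (int n)" using x by simp_all
      then show False unfolding of_int_less_iff by linarith
    qed
    moreover have "0 < x" using x n by linarith
    ultimately show "(\<psi> has_real_derivative deriv \<psi> x) (at x)"
      "(deriv \<psi> has_real_derivative (- (F * x + E) * \<psi> x)) (at x)"
      using \<psi> unfolding is_gen_solution_def by blast+
  qed
  have const: "?P x = ?P m" "?Q x = ?Q m" if x: "real n - 1 < x" "x < real n" for x
  proof -
    have "(?P has_real_derivative 0) (at z)" "(?Q has_real_derivative 0) (at z)"
      if "z \<in> {real n - 1<..<real n}" for z
      using that by (auto intro!: derivative_eq_intros d du dv simp: algebra_simps)
    then show "?P x = ?P m" "?Q x = ?Q m"
      using DERIV_isconst3[of "real n - 1" "real n" x m ?P] DERIV_isconst3[of "real n - 1" "real n" x m ?Q] x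
      by (auto simp: m_def)
  qed
  show thesis
  proof (rule that)
    fix x assume x: "real n - 1 < x" "x < real n"
    have "?P x * u x + ?Q x * v x = \<psi> x * (u x * v' x - u' x * v x)" by (simp add: algebra_simps)
    then show "\<psi> x = ?P m * u x + ?Q m * v x" unfolding const[OF x] W by simp
    have "?P x * u' x + ?Q x * v' x = deriv \<psi> x * (u x * v' x - u' x * v x)" by (simp add: algebra_simps)
    then show "deriv \<psi> x = ?P m * u' x + ?Q m * v' x" unfolding const[OF x] W by simp
  qed
qed

lemma tendsto_airy_sol_lincomb:
  assumes u: "airy_sol F E u u'" and v: "airy_sol F E v v'"
  shows "((\<lambda>x. p * u x + q * v x) \<longlongrightarrow> p * u a + q * v a) (at a within S)"
    and "((\<lambda>x. p * u' x + q * v' x) \<longlongrightarrow> p * u' a + q * v' a) (at a within S)"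
proof -
  have "isCont u a" "isCont v a" "isCont u' a" "isCont v' a"
    using u v unfolding airy_sol_def by (blast intro: DERIV_isCont)+
  then have "(u \<longlongrightarrow> u a) (at a within S)" "(v \<longlongrightarrow> v a) (at a within S)"
    "(u' \<longlongrightarrow> u' a) (at a within S)" "(v' \<longlongrightarrow> v' a) (at a within S)"
    unfolding isCont_def by (blast intro: tendsto_within_subset)+
  then show "((\<lambda>x. p * u x + q * v x) \<longlongrightarrow> p * u a + q * v a) (at a within S)"
    and "((\<lambda>x. p * u' x + q * v' x) \<longlongrightarrow> p * u' a + q * v' a) (at a within S)"
    by (intro tendsto_intros; simp)+
qed

text \<open>Continuity of \<open>\<psi>\<close> and the jump of its derivative at \<open>n\<close>
  are two linear equations for the increments of \<open>p\<close> and \<open>q\<close>, with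
  determinant the Wronskian 1. The initial data are inverted in the same way.\<close>

lemma gen_solution_coefficients:
  assumes \<psi>: "is_gen_solution F E g \<theta>0 \<psi>"
    and u: "airy_sol F E u u'" and v: "airy_sol F E v v'"
    and W: "\<And>x. u x * v' x - u' x * v x = 1"
  obtains p q where
    "\<And>n x. n \<ge> 1 \<Longrightarrow> real n - 1 < x \<Longrightarrow> x < real n \<Longrightarrow> \<psi> x = p n * u x + q n * v x"
    and "p 1 = sin \<theta>0 * v' 0 - cos \<theta>0 * v 0" and "q 1 = cos \<theta>0 * u 0 - sin \<theta>0 * u' 0"
    and "\<And>n. n \<ge> 1 \<Longrightarrow> p (Suc n) = p n - g n * (p n * u (real n) + q n * v (real n)) * v (real n)"
    and "\<And>n. n \<ge> 1 \<Longrightarrow> q (Suc n) = q n + g n * (p n * u (real n) + q n * v (real n)) * u (real n)"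
proof -
  have "\<exists>pq. \<forall>x. real n - 1 < x \<and> x < real n \<longrightarrow>
      \<psi> x = fst pq * u x + snd pq * v x \<and> deriv \<psi> x = fst pq * u' x + snd pq * v' x" if "n \<ge> 1" for n
    using gen_solution_representation[OF \<psi> u v W that] by (metis fst_conv snd_conv)
  then obtain pq where pq: "\<And>n x. n \<ge> 1 \<Longrightarrow> real n - 1 < x \<Longrightarrow> x < real n \<Longrightarrow>
      \<psi> x = fst (pq n) * u x + snd (pq n) * v x \<and> deriv \<psi> x = fst (pq n) * u' x + snd (pq n) * v' x"
    by metis
  define p q where "p n = fst (pq n)" and "q n = snd (pq n)" for n
  note rep = pq[folded p_def q_def, THEN conjunct1] and rep' = pq[folded p_def q_def, THEN conjunct2]
  note lim = tendsto_airy_sol_lincomb[OF u v]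
  have ev_right: "eventually (\<lambda>x. a < x \<and> x < a + 1) (at_right a)" for a :: real
    using eventually_at_right_real[of a "a + 1"] by (auto elim: eventually_mono)
  have ev_left: "eventually (\<lambda>x. a - 1 < x \<and> x < a) (at_left a)" for a :: real
    using eventually_at_left_real[of "a - 1" a] by (auto elim: eventually_mono)
  \<comment> \<open>Stated for \<open>n = 0\<close> too: there the right limits are the initial
    data, which determine \<open>p 1\<close> and \<open>q 1\<close>.\<close>
  have tr: "(\<psi> \<longlongrightarrow> p (Suc n) * u (real n) + q (Suc n) * v (real n)) (at_right (real n))"
    and tr': "(deriv \<psi> \<longlongrightarrow> p (Suc n) * u' (real n) + q (Suc n) * v' (real n)) (at_right (real n))" for n
  proof -
    have "eventually (\<lambda>x. p (Suc n) * u x + q (Suc n) * v x = \<psi> x) (at_right (real n))"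
      "eventually (\<lambda>x. p (Suc n) * u' x + q (Suc n) * v' x = deriv \<psi> x) (at_right (real n))"
      using ev_right[of "real n"] by (eventually_elim, use rep[of "Suc n"] rep'[of "Suc n"] in simp)+
    then show "(\<psi> \<longlongrightarrow> p (Suc n) * u (real n) + q (Suc n) * v (real n)) (at_right (real n))"
      "(deriv \<psi> \<longlongrightarrow> p (Suc n) * u' (real n) + q (Suc n) * v' (real n)) (at_right (real n))"
      using Lim_transform_eventually[OF lim(1)] Lim_transform_eventually[OF lim(2)] by blast+
  qed
  have tl: "(\<psi> \<longlongrightarrow> p n * u (real n) + q n * v (real n)) (at_left (real n))"
    and tl': "(deriv \<psi> \<longlongrightarrow> p n * u' (real n) + q n * v' (real n)) (at_left (real n))" if n: "n \<ge> 1" for n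
  proof -
    have "eventually (\<lambda>x. p n * u x + q n * v x = \<psi> x) (at_left (real n))"
      "eventually (\<lambda>x. p n * u' x + q n * v' x = deriv \<psi> x) (at_left (real n))"
      using ev_left[of "real n"] by (eventually_elim, use rep[OF n] rep'[OF n] in simp)+
    then show "(\<psi> \<longlongrightarrow> p n * u (real n) + q n * v (real n)) (at_left (real n))"
      "(deriv \<psi> \<longlongrightarrow> p n * u' (real n) + q n * v' (real n)) (at_left (real n))"
      using Lim_transform_eventually[OF lim(1)] Lim_transform_eventually[OF lim(2)] by blast+
  qed
  have i1: "p 1 * u 0 + q 1 * v 0 = sin \<theta>0" and i2: "p 1 * u' 0 + q 1 * v' 0 = cos \<theta>0"
    using tendsto_unique[OF _ tr[of 0], of "sin \<theta>0"] tendsto_unique[OF _ tr'[of 0], of "cos \<theta>0"] \<psi>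
    by (auto simp: is_gen_solution_def)
  have jump: "p (Suc n) * u n + q (Suc n) * v n = p n * u n + q n * v n \<and>
      (p (Suc n) * u' n + q (Suc n) * v' n) - (p n * u' n + q n * v' n) = g n * (p n * u n + q n * v n)"
    if n: "n \<ge> 1" for n
  proof -
    have "isCont \<psi> (real n)" using \<psi> n by (auto simp: is_gen_solution_def)
    then have c: "(\<psi> \<longlongrightarrow> \<psi> (real n)) (at_left (real n))" "(\<psi> \<longlongrightarrow> \<psi> (real n)) (at_right (real n))"
      unfolding isCont_def by (blast intro: tendsto_within_subset)+
    have e1: "\<psi> (real n) = p n * u n + q n * v n"
      by (rule tendsto_unique[OF _ c(1) tl[OF n]]) simp
    have e2: "\<psi> (real n) = p (Suc n) * u n + q (Suc n) * v n"
      by (rule tendsto_unique[OF _ c(2) tr]) simp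
    have r: "((\<lambda>\<epsilon>. deriv \<psi> (real n + \<epsilon>)) \<longlongrightarrow> p (Suc n) * u' n + q (Suc n) * v' n) (at_right 0)"
      using tr'[of n] filterlim_at_right_to_0[of "deriv \<psi>" _ "real n"] by (simp add: add.commute)
    have "filterlim (\<lambda>\<epsilon>. real n - \<epsilon>) (at_left (real n)) (at_right 0)"
      unfolding filterlim_at
      by (auto intro!: tendsto_eq_intros eventually_at_rightI[of 0 1])
    then have l: "((\<lambda>\<epsilon>. deriv \<psi> (real n - \<epsilon>)) \<longlongrightarrow> p n * u' n + q n * v' n) (at_right 0)"
      by (rule filterlim_compose[OF tl'[OF n]])
    have "((\<lambda>\<epsilon>. deriv \<psi> (real n + \<epsilon>) - deriv \<psi> (real n - \<epsilon>)) \<longlongrightarrow> g n * \<psi> (real n)) (at_right 0)"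
      using \<psi> n by (auto simp: is_gen_solution_def)
    from tendsto_unique[OF _ tendsto_diff[OF r l] this] show ?thesis using e1 e2 by simp
  qed
  show thesis
  proof (rule that)
    show "\<psi> x = p n * u x + q n * v x" if "n \<ge> 1" "real n - 1 < x" "x < real n" for n x
      using rep that by blast
    show "p 1 = sin \<theta>0 * v' 0 - cos \<theta>0 * v 0"
      unfolding i1[symmetric] i2[symmetric] using W[of 0] by algebra
    show "q 1 = cos \<theta>0 * u 0 - sin \<theta>0 * u' 0"
      unfolding i1[symmetric] i2[symmetric] using W[of 0] by algebra
    fix n :: nat assume n: "n \<ge> 1"
    show "p (Suc n) = p n - g n * (p n * u (real n) + q n * v (real n)) * v (real n)"
      using jump[OF n] W[of "real n"] by algebra
    show "q (Suc n) = q n + g n * (p n * u (real n) + q n * v (real n)) * u (real n)"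
      using jump[OF n] W[of "real n"] by algebra
  qed
qed

text \<open>\<open>\<alpha> * zeta + cnj \<alpha> * cnj zeta\<close> equals
  \<open>2 * c * (Re \<alpha> * B - Im \<alpha> * A)\<close>, so the choice of
  \<open>\<alpha>\<close> amounts to comparing coefficients of \<open>A\<close> and
  \<open>B\<close>. Uniqueness is their linear independence on one interval: value and derivative at
  the midpoint, together with the nonzero Wronskian, force both differences to vanish.\<close>

lemma prufer_R_eq:
  assumes F: "F > 0" and A: "airy_sol F E A A'" and B: "airy_sol F E B B'"
    and W: "\<And>x. A x * B' x - A' x * B x \<noteq> 0"
    and AiA: "\<And>x. A x = Ai (- (F powr (1/3)) * (x + E / F))"
    and BiB: "\<And>x. B x = Bi (- (F powr (1/3)) * (x + E / F))"
    and rep: "\<And>x. real n - 1 < x \<Longrightarrow> x < real n \<Longrightarrow> \<psi> x = P * A x + Q * B x"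
  shows "prufer_R F E \<psi> n = cmod (Complex P Q) / sqrt (pi / F powr (1/3))"
proof -
  define c where "c = sqrt (pi / F powr (1/3))"
  have c: "c > 0" using F by (simp add: c_def)
  have zeta: "zeta F E x = of_real c * Complex (B x) (A x)" for x
    unfolding zeta_def c_def AiA BiB by (simp add: complex_eq_iff)
  have expand: "\<alpha> * zeta F E x + cnj \<alpha> * cnj (zeta F E x) = of_real (2 * c * (Re \<alpha> * B x - Im \<alpha> * A x))" for \<alpha> x
    unfolding zeta by (simp add: complex_eq_iff algebra_simps)
  define \<alpha>0 where "\<alpha>0 = Complex (Q / (2 * c)) (- P / (2 * c))"
  let ?rep = "\<lambda>\<alpha>. \<forall>x\<in>{real n - 1<..<real n}. complex_of_real (\<psi> x) = \<alpha> * zeta F E x + cnj \<alpha> * cnj (zeta F E x)"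
  have "?rep \<alpha>0"
    unfolding expand using c by (auto simp: rep \<alpha>0_def distrib_left simp flip: of_real_add of_real_mult)
  moreover have "\<alpha> = \<alpha>0" if \<alpha>: "?rep \<alpha>" for \<alpha>
  proof -
    define s t where "s = 2 * c * Re \<alpha> - Q" and "t = - 2 * c * Im \<alpha> - P"
    have z: "s * B x + t * A x = 0" if x: "real n - 1 < x" "x < real n" for x
    proof -
      have "complex_of_real (\<psi> x) = of_real (2 * c * (Re \<alpha> * B x - Im \<alpha> * A x))"
        using \<alpha> x unfolding expand by simp
      then have "P * A x + Q * B x = 2 * c * (Re \<alpha> * B x - Im \<alpha> * A x)"
        unfolding of_real_eq_iff rep[OF x] .
      then show ?thesis by (simp add: s_def t_def algebra_simps)
    qed
    define m where "m = real n - 1/2"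
    have "((\<lambda>x. s * B x + t * A x) has_real_derivative s * B' m + t * A' m) (at m)"
      using A B unfolding airy_sol_def by (intro DERIV_add DERIV_cmult) auto
    moreover have "eventually (\<lambda>x. s * B x + t * A x = 0) (nhds m)"
      using eventually_nhds_in_open[of "{real n - 1<..<real n}" m] z
      by (auto simp: m_def elim!: eventually_mono)
    then have "((\<lambda>x. s * B x + t * A x) has_real_derivative 0) (at m)"
      by (subst DERIV_cong_ev[OF refl _ refl]) auto
    ultimately have "s * B' m + t * A' m = 0" by (rule DERIV_unique)
    moreover have "s * B m + t * A m = 0" by (rule z) (auto simp: m_def)
    ultimately have "s * (A m * B' m - A' m * B m) = 0" "t * (A m * B' m - A' m * B m) = 0" by algebra+
    then have "s = 0" "t = 0" using W[of m] by auto
    then show ?thesis using c by (simp add: s_def t_def \<alpha>0_def complex_eq_iff field_simps)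
  qed
  ultimately have "prufer_alpha F E \<psi> n = \<alpha>0"
    unfolding prufer_alpha_def by (intro the_equality)
  then have "prufer_R F E \<psi> n = 2 * cmod \<alpha>0" by (simp add: prufer_R_def norm_mult)
  also have "\<dots> = cmod (Complex P Q) / c"
    using c by (simp add: \<alpha>0_def cmod_def power_divide real_sqrt_divide add_divide_distrib[symmetric] add.commute power_mult_distrib real_sqrt_mult)
  finally show ?thesis by (simp add: c_def)
qed

text \<open>The recursion at the integers does nothing at \<open>0\<close>, so that \<open>prufer_path \<zeta> b h n\<close> is
  the coefficient on \<open>(n - 1, n)\<close> for every \<open>n \<ge> 1\<close>.\<close>

fun prufer_path :: "(nat \<Rightarrow> complex) \<Rightarrow> complex \<Rightarrow> (nat \<Rightarrow> real) \<Rightarrow> nat \<Rightarrow> complex" where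
  "prufer_path \<zeta> b h 0 = b"
| "prufer_path \<zeta> b h (Suc n) = prufer_path \<zeta> b h n -
     (if n = 0 then 0 else \<i> * of_real (h n * Re (prufer_path \<zeta> b h n * \<zeta> n)) * cnj (\<zeta> n))"

text \<open>The lower bound is the upper bound for the adjugate matrix, whose entries have the same
  absolute values and which undoes the map up to the determinant.\<close>

lemma linear_image_norm_bounds:
  fixes k l m r :: real
  assumes "k * r - l * m \<noteq> 0"
  obtains c1 c2 where "c1 > 0" "c2 > 0"
    "\<And>p q. c1 * cmod (Complex p q) \<le> cmod (Complex (p * k + q * m) (p * l + q * r))"
    "\<And>p q. cmod (Complex (p * k + q * m) (p * l + q * r)) \<le> c2 * cmod (Complex p q)"
proof -
  define s d where "s = \<bar>k\<bar> + \<bar>l\<bar> + \<bar>m\<bar> + \<bar>r\<bar>" and "d = \<bar>k * r - l * m\<bar>"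
  have d: "d > 0" using assms by (simp add: d_def)
  have s: "s > 0" using assms unfolding s_def by (cases "k = 0"; cases "l = 0") auto
  have up: "cmod (Complex (p * k + q * m) (p * l + q * r)) \<le> (\<bar>k\<bar> + \<bar>l\<bar> + \<bar>m\<bar> + \<bar>r\<bar>) * cmod (Complex p q)" for p q k l m r :: real
  proof -
    have pq: "\<bar>p\<bar> \<le> cmod (Complex p q)" "\<bar>q\<bar> \<le> cmod (Complex p q)"
      using abs_Re_le_cmod[of "Complex p q"] abs_Im_le_cmod[of "Complex p q"] by auto
    have "cmod (Complex (p * k + q * m) (p * l + q * r)) \<le> \<bar>p * k + q * m\<bar> + \<bar>p * l + q * r\<bar>"
      using cmod_le[of "Complex (p * k + q * m) (p * l + q * r)"] by simp
    also have "\<dots> \<le> \<bar>k\<bar> * \<bar>p\<bar> + \<bar>m\<bar> * \<bar>q\<bar> + (\<bar>l\<bar> * \<bar>p\<bar> + \<bar>r\<bar> * \<bar>q\<bar>)"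
      by (intro add_mono order_trans[OF abs_triangle_ineq]) (simp_all add: abs_mult mult.commute)
    also have "\<dots> \<le> \<bar>k\<bar> * cmod (Complex p q) + \<bar>m\<bar> * cmod (Complex p q) + (\<bar>l\<bar> * cmod (Complex p q) + \<bar>r\<bar> * cmod (Complex p q))"
      by (intro add_mono mult_left_mono pq) auto
    finally show ?thesis by (simp add: algebra_simps)
  qed
  show thesis
  proof (rule that[of "d / s" s])
    show "d / s > 0" "s > 0" using s d by auto
    fix p q :: real
    show "cmod (Complex (p * k + q * m) (p * l + q * r)) \<le> s * cmod (Complex p q)"
      using up[of p k q m l r] by (simp add: s_def)
    define P Q where "P = p * k + q * m" and "Q = p * l + q * r"
    have "Complex (P * r + Q * (- m)) (P * (- l) + Q * k) = of_real (k * r - l * m) * Complex p q"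
      by (simp add: P_def Q_def complex_eq_iff algebra_simps)
    then have "d * cmod (Complex p q) = cmod (Complex (P * r + Q * (- m)) (P * (- l) + Q * k))"
      by (simp only: norm_mult norm_of_real d_def)
    also have "\<dots> \<le> s * cmod (Complex P Q)" using up[of P r Q "- m" "- l" k] by (simp add: s_def add_ac)
    finally show "d / s * cmod (Complex p q) \<le> cmod (Complex (p * k + q * m) (p * l + q * r))"
      using s by (simp add: P_def Q_def field_simps)
  qed
qed

text \<open>\<open>\<zeta>\<close>, \<open>b\<close>, \<open>c1\<close> and \<open>c2\<close> are
  fixed before the couplings \<open>h\<close> and the solution \<open>\<psi>\<close>: all dependence
  on \<open>h\<close> sits in \<open>prufer_path\<close>. The constants absorb the passage from the
  adapted basis to \<open>zeta\<close>.\<close>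

lemma prufer_reduction:
  assumes F: "F > (0::real)"
  obtains \<zeta> :: "nat \<Rightarrow> complex" and b c1 c2 where
    "(\<lambda>n. of_real ((F * real n + E) powr (1/4)) * \<zeta> n - cis (wkb_phase F E (real n))) \<longlonglongrightarrow> 0"
    and "b \<noteq> 0" and "c1 > 0" and "c2 > 0"
    and "\<And>h \<psi> n. is_gen_solution F E h \<theta>0 \<psi> \<Longrightarrow> n \<ge> 1 \<Longrightarrow>
      c1 * cmod (prufer_path \<zeta> b h n) \<le> prufer_R F E \<psi> n \<and> prufer_R F E \<psi> n \<le> c2 * cmod (prufer_path \<zeta> b h n)"
proof -
  obtain A A' B B' where A: "airy_sol F E A A'" and B: "airy_sol F E B B'"
    and WAB: "\<And>x. A x * B' x - A' x * B x \<noteq> 0"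
    and AiA: "\<And>x. A x = Ai (- (F powr (1/3)) * (x + E / F))"
    and BiB: "\<And>x. B x = Bi (- (F powr (1/3)) * (x + E / F))"
    using Ai_Bi_sols[OF F] by blast
  obtain u u' v v' k l m r where u: "airy_sol F E u u'" and v: "airy_sol F E v v'"
    and W: "\<And>x. u x * v' x - u' x * v x = 1"
    and uAB: "\<And>x. u x = k * A x + l * B x" and vAB: "\<And>x. v x = m * A x + r * B x"
    and det: "k * r - l * m \<noteq> 0"
    and asu: "(\<lambda>n. (F * real n + E) powr (1/4) * u (real n) - cos (wkb_phase F E (real n))) \<longlonglongrightarrow> 0"
    and asv: "(\<lambda>n. (F * real n + E) powr (1/4) * v (real n) - sin (wkb_phase F E (real n))) \<longlonglongrightarrow> 0"
    using adapted_basis[OF F A B WAB] by blast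
  obtain d1 d2 where d: "d1 > 0" "d2 > 0"
    "\<And>p q. d1 * cmod (Complex p q) \<le> cmod (Complex (p * k + q * m) (p * l + q * r))"
    "\<And>p q. cmod (Complex (p * k + q * m) (p * l + q * r)) \<le> d2 * cmod (Complex p q)"
    using linear_image_norm_bounds[OF det] by blast
  define \<zeta> where "\<zeta> n = Complex (u (real n)) (v (real n))" for n
  define b where "b = Complex (sin \<theta>0 * v' 0 - cos \<theta>0 * v 0) (- (cos \<theta>0 * u 0 - sin \<theta>0 * u' 0))"
  define c where "c = sqrt (pi / F powr (1/3))"
  have c: "c > 0" using F by (simp add: c_def)
  show thesis
  proof (rule that[of \<zeta> b "d1 / c" "d2 / c"])
    have "(\<lambda>n. Complex ((F * real n + E) powr (1/4) * u (real n) - cos (wkb_phase F E (real n)))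
      ((F * real n + E) powr (1/4) * v (real n) - sin (wkb_phase F E (real n)))) \<longlonglongrightarrow> Complex 0 0"
      by (intro tendsto_Complex asu asv)
    moreover have "of_real ((F * real n + E) powr (1/4)) * \<zeta> n - cis (wkb_phase F E (real n))
      = Complex ((F * real n + E) powr (1/4) * u (real n) - cos (wkb_phase F E (real n)))
      ((F * real n + E) powr (1/4) * v (real n) - sin (wkb_phase F E (real n)))" for n
      by (simp add: \<zeta>_def complex_eq_iff)
    ultimately show "(\<lambda>n. of_real ((F * real n + E) powr (1/4)) * \<zeta> n - cis (wkb_phase F E (real n))) \<longlonglongrightarrow> 0"
      by (simp only: zero_complex.code)
    show "b \<noteq> 0"
    proof
      assume "b = 0"
      then have "sin \<theta>0 * v' 0 - cos \<theta>0 * v 0 = 0" "cos \<theta>0 * u 0 - sin \<theta>0 * u' 0 = 0"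
        by (simp_all add: b_def complex_eq_iff)
      then have "sin \<theta>0 = 0" "cos \<theta>0 = 0" using W[of 0] by algebra+
      then show False using sin_cos_squared_add[of \<theta>0] by simp
    qed
    show "d1 / c > 0" "d2 / c > 0" using c d by auto
    fix h \<psi> and n :: nat assume \<psi>: "is_gen_solution F E h \<theta>0 \<psi>" and n: "n \<ge> 1"
    obtain p q where rep: "\<And>n x. n \<ge> 1 \<Longrightarrow> real n - 1 < x \<Longrightarrow> x < real n \<Longrightarrow> \<psi> x = p n * u x + q n * v x"
      and p1: "p 1 = sin \<theta>0 * v' 0 - cos \<theta>0 * v 0" and q1: "q 1 = cos \<theta>0 * u 0 - sin \<theta>0 * u' 0"
      and pS: "\<And>n. n \<ge> 1 \<Longrightarrow> p (Suc n) = p n - h n * (p n * u (real n) + q n * v (real n)) * v (real n)"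
      and qS: "\<And>n. n \<ge> 1 \<Longrightarrow> q (Suc n) = q n + h n * (p n * u (real n) + q n * v (real n)) * u (real n)"
      using gen_solution_coefficients[OF \<psi> u v W] by blast
    \<comment> \<open>With \<open>\<zeta> n = u + \<i> * v\<close> and state
      \<open>p - \<i> * q\<close>, the real part of state times \<open>\<zeta> n\<close> is
      \<open>p * u + q * v\<close>, the value of \<open>\<psi>\<close> at \<open>n\<close>, and the
      two real recursions become one complex recursion.\<close>
    have "prufer_path \<zeta> b h n = Complex (p n) (- q n)"
      using n
    proof (induction n rule: dec_induct)
      case base then show ?case using p1 q1 by (simp add: b_def)
    next
      case (step n)
      then show ?case
        by (simp add: complex_eq_iff \<zeta>_def pS qS algebra_simps)
    qed
    then have norm: "cmod (prufer_path \<zeta> b h n) = cmod (Complex (p n) (q n))" by (simp add: cmod_def)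
    have R: "prufer_R F E \<psi> n = cmod (Complex (p n * k + q n * m) (p n * l + q n * r)) / c"
      unfolding c_def
    proof (rule prufer_R_eq[OF F A B WAB AiA BiB])
      fix x assume "real n - 1 < x" "x < real n"
      then show "\<psi> x = (p n * k + q n * m) * A x + (p n * l + q n * r) * B x"
        using rep[OF n] by (simp add: uAB vAB algebra_simps)
    qed
    show "d1 / c * cmod (prufer_path \<zeta> b h n) \<le> prufer_R F E \<psi> n \<and> prufer_R F E \<psi> n \<le> d2 / c * cmod (prufer_path \<zeta> b h n)"
      unfolding norm R using c d(3,4)[of "p n" "q n"] by (simp add: divide_right_mono)
  qed
qed

section \<open>Logarithmic means of slowly rotating sequences\<close>

lemma harmonic_sum_over_ln_tendsto_1: "(\<lambda>n. (\<Sum>j=1..n. 1 / real j) / ln (real n)) \<longlonglongrightarrow> 1"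
proof -
  have "(\<lambda>n. harm n - ln (real n) :: real) \<longlonglongrightarrow> euler_mascheroni"
    by (rule euler_mascheroni_LIMSEQ)
  moreover have "(\<lambda>n. 1 / ln (real n)) \<longlonglongrightarrow> 0" by real_asymp
  ultimately have "(\<lambda>n. 1 + (harm n - ln (real n)) * (1 / ln (real n)) :: real) \<longlonglongrightarrow> 1 + euler_mascheroni * 0"
    by (intro tendsto_intros)
  moreover have "eventually (\<lambda>n. 1 + (harm n - ln (real n)) * (1 / ln (real n)) = (\<Sum>j=1..n. 1 / real j) / ln (real n)) sequentially"
    using eventually_gt_at_top[of 1]
    by eventually_elim (simp add: harm_def field_simps)
  ultimately show ?thesis by (auto dest: Lim_transform_eventually)
qed

text \<open>Toeplitz's argument: finitely many terms cost a constant, negligible against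
  \<open>b n\<close>, and the remaining ones cost at most \<open>\<epsilon>\<close> times the total
  weight, which is eventually at most \<open>K * b n\<close>.\<close>

lemma weighted_null_sum:
  fixes p :: "nat \<Rightarrow> real" and e :: "nat \<Rightarrow> 'b::real_normed_vector"
  assumes p: "\<And>j. p j \<ge> 0" and e: "e \<longlonglongrightarrow> 0" and b: "filterlim b at_top sequentially"
    and K: "eventually (\<lambda>n. (\<Sum>j=1..n. p j) / b n \<le> K) sequentially"
  shows "(\<lambda>n. (\<Sum>j=1..n. p j *\<^sub>R e j) /\<^sub>R b n) \<longlonglongrightarrow> 0"
proof (rule LIMSEQ_I)
  fix r :: real assume r: "r > 0"
  define \<epsilon> where "\<epsilon> = r / (2 * (\<bar>K\<bar> + 1))"
  have eps: "\<epsilon> > 0" using r by (simp add: \<epsilon>_def)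
  have epsK: "\<epsilon> * K < r / 2"
  proof -
    have "\<epsilon> * K \<le> \<epsilon> * \<bar>K\<bar>" using eps by (intro mult_left_mono) auto
    also have "\<dots> < \<epsilon> * (\<bar>K\<bar> + 1)" using eps by (intro mult_strict_left_mono) auto
    also have "\<dots> = r / 2" by (simp add: \<epsilon>_def field_simps)
    finally show ?thesis .
  qed
  obtain N where N: "\<And>j. j \<ge> N \<Longrightarrow> norm (e j) < \<epsilon>" using LIMSEQ_D[OF e eps] by auto
  define C where "C = (\<Sum>j=1..N. p j * norm (e j))"
  have C: "norm (\<Sum>j=1..n. p j *\<^sub>R e j) \<le> C + \<epsilon> * (\<Sum>j=1..n. p j)" for n
  proof -
    have "norm (\<Sum>j=1..n. p j *\<^sub>R e j) \<le> (\<Sum>j=1..n. p j * norm (e j))"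
      by (rule sum_norm_le) (use p in simp)
    also have "\<dots> \<le> (\<Sum>j=1..n. (if j \<le> N then p j * norm (e j) else 0) + \<epsilon> * p j)"
    proof (intro sum_mono)
      fix j
      have "p j * norm (e j) \<le> p j * \<epsilon>" if "\<not> j \<le> N"
        using that N[of j] p by (intro mult_left_mono) auto
      then show "p j * norm (e j) \<le> (if j \<le> N then p j * norm (e j) else 0) + \<epsilon> * p j"
        using p[of j] eps by (simp add: mult.commute[of \<epsilon>])
    qed
    also have "\<dots> = (\<Sum>j\<in>{1..n} \<inter> {..N}. p j * norm (e j)) + \<epsilon> * (\<Sum>j=1..n. p j)"
      by (subst sum.inter_restrict) (simp_all add: sum.distrib sum_distrib_left)
    also have "(\<Sum>j\<in>{1..n} \<inter> {..N}. p j * norm (e j)) \<le> C"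
      unfolding C_def using p by (intro sum_mono2) auto
    finally show ?thesis by simp
  qed
  have "((\<lambda>n. C / b n) \<longlongrightarrow> 0) sequentially"
    using b by (rule real_tendsto_divide_at_top[OF tendsto_const])
  then have ev: "eventually (\<lambda>n. C / b n < r / 2) sequentially"
    using r by (intro order_tendstoD) auto
  have "eventually (\<lambda>n. norm ((\<Sum>j=1..n. p j *\<^sub>R e j) /\<^sub>R b n) < r) sequentially"
    using ev K filterlim_at_top_dense[THEN iffD1, OF b, rule_format, of 0]
  proof eventually_elim
    case (elim n)
    have "norm ((\<Sum>j=1..n. p j *\<^sub>R e j) /\<^sub>R b n) = norm (\<Sum>j=1..n. p j *\<^sub>R e j) / b n"
      using elim by (simp add: field_simps)
    also have "\<dots> \<le> (C + \<epsilon> * (\<Sum>j=1..n. p j)) / b n"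
      using elim C[of n] by (intro divide_right_mono) auto
    also have "\<dots> = C / b n + \<epsilon> * ((\<Sum>j=1..n. p j) / b n)" by (simp add: add_divide_distrib)
    also have "\<dots> \<le> C / b n + \<epsilon> * K" using elim eps by (intro add_left_mono mult_left_mono) auto
    also have "\<dots> < r" using elim epsK by linarith
    finally show ?case .
  qed
  then show "\<exists>no. \<forall>n\<ge>no. norm ((\<Sum>j=1..n. p j *\<^sub>R e j) /\<^sub>R b n - 0) < r"
    by (simp add: eventually_sequentially)
qed

lemma ln_at_top_seq: "filterlim (\<lambda>n. ln (real n)) at_top sequentially"
  by real_asymp

text \<open>Vanishing logarithmic mean. The weights \<open>1 / j\<close> are those of the
  second-order terms in the growth of the radius, since |Z(j)|^4 decays like a multiple of
  them.\<close>

definition log_null :: "(nat \<Rightarrow> complex) \<Rightarrow> bool" where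
  "log_null x \<longleftrightarrow> (\<lambda>n. (\<Sum>j=1..n. x j / real j) / ln (real n)) \<longlonglongrightarrow> 0"

lemma log_null_add: "log_null x \<Longrightarrow> log_null y \<Longrightarrow> log_null (\<lambda>j. x j + y j)"
  unfolding log_null_def
  by (drule (1) tendsto_add) (simp add: sum.distrib add_divide_distrib)

lemma log_null_cmult: "log_null x \<Longrightarrow> log_null (\<lambda>j. c * x j)"
  unfolding log_null_def
  by (drule tendsto_mult_left[where c = c]) (simp add: sum_distrib_left)

lemma log_null_sum: "(\<And>i. i \<in> I \<Longrightarrow> log_null (x i)) \<Longrightarrow> log_null (\<lambda>j. \<Sum>i\<in>I. x i j)"
proof (induction I rule: infinite_finite_induct)
  case (insert i I)
  then show ?case using log_null_add[of "x i" "\<lambda>j. \<Sum>i\<in>I. x i j"] by simp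
qed (simp_all add: log_null_def)

lemma log_null_diff: "log_null x \<Longrightarrow> log_null y \<Longrightarrow> log_null (\<lambda>j. x j - y j)"
  using log_null_add[of x "\<lambda>j. -1 * y j"] log_null_cmult[of y "-1"] by simp

lemma log_null_tendsto_0:
  assumes "x \<longlonglongrightarrow> 0" shows "log_null x"
proof -
  have "(\<lambda>n. (\<Sum>j=1..n. (1 / real j) *\<^sub>R x j) /\<^sub>R ln (real n)) \<longlonglongrightarrow> 0"
  proof (rule weighted_null_sum[OF _ assms ln_at_top_seq])
    show "eventually (\<lambda>n. (\<Sum>j=1..n. 1 / real j) / ln (real n) \<le> 2) sequentially"
      using order_tendstoD(2)[OF harmonic_sum_over_ln_tendsto_1, of 2] by (auto elim: eventually_mono)
  qed simp
  then show ?thesis by (simp add: log_null_def scaleR_conv_of_real divide_inverse mult.commute)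
qed

lemma log_null_close:
  assumes "log_null x" and "(\<lambda>j. x j - y j) \<longlonglongrightarrow> 0" shows "log_null y"
  using log_null_diff[OF assms(1) log_null_tendsto_0[OF assms(2)]] by simp

lemma log_null_bounded_sum:
  fixes x :: "nat \<Rightarrow> complex"
  assumes "\<And>n. norm (\<Sum>j=1..n. x j / real j) \<le> B"
  shows "log_null x"
  unfolding log_null_def
proof (rule Lim_null_comparison)
  show "eventually (\<lambda>n. norm ((\<Sum>j=1..n. x j / real j) / ln (real n)) \<le> B / ln (real n)) sequentially"
    using eventually_gt_at_top[of 1]
  proof eventually_elim
    case (elim n)
    then show ?case using divide_right_mono[OF assms[of n], of "ln (real n)"] by (simp add: norm_divide)
  qed
  show "(\<lambda>n. B / ln (real n)) \<longlonglongrightarrow> 0"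
    by (rule real_tendsto_divide_at_top[OF tendsto_const ln_at_top_seq])
qed

text \<open>With weights \<open>1 / j\<close> the sum does not telescope exactly. Replacing the
  difference by \<open>j * (t (Suc j) / Suc j - t j / j)\<close> makes it telescope, at the price of
  the null term \<open>- t (Suc j) / Suc j\<close>.\<close>

lemma log_null_telescope:
  assumes B: "\<And>j. norm (t j) \<le> B"
  shows "log_null (\<lambda>j. t (Suc j) - t j)"
proof (rule log_null_close)
  have s: "(\<Sum>j=1..n. of_nat j * (t (Suc j) / of_nat (Suc j) - t j / of_nat j) / of_nat j)
      = t (Suc n) / of_nat (Suc n) - t 1" for n
  proof -
    have "(\<Sum>j=1..n. of_nat j * (t (Suc j) / of_nat (Suc j) - t j / of_nat j) / of_nat j)
      = (\<Sum>j=1..n. t (Suc j) / of_nat (Suc j) - t j / of_nat j)"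
      by (intro sum.cong) auto
    also have "\<dots> = t (Suc n) / of_nat (Suc n) - t 1" by (subst sum_Suc_diff) auto
    finally show ?thesis .
  qed
  show "log_null (\<lambda>j. of_nat j * (t (Suc j) / of_nat (Suc j) - t j / of_nat j))"
  proof (rule log_null_bounded_sum[where B = "B + B"])
    fix n
    have "norm (t (Suc n) / of_nat (Suc n)) \<le> B / 1"
      unfolding norm_divide using B[of "Suc n"] order_trans[OF norm_ge_zero B]
      by (intro frac_le) (auto simp del: of_nat_Suc)
    then show "norm (\<Sum>j=1..n. of_nat j * (t (Suc j) / of_nat (Suc j) - t j / of_nat j) / complex_of_real (real j)) \<le> B + B"
      using s[of n] B[of 1] norm_triangle_ineq4[of "t (Suc n) / of_nat (Suc n)" "t 1"] by simp
  qed
  show "(\<lambda>j. of_nat j * (t (Suc j) / of_nat (Suc j) - t j / of_nat j) - (t (Suc j) - t j)) \<longlonglongrightarrow> 0"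
  proof (rule Lim_null_comparison)
    show "eventually (\<lambda>j. norm (of_nat j * (t (Suc j) / of_nat (Suc j) - t j / of_nat j) - (t (Suc j) - t j)) \<le> B / real (Suc j)) sequentially"
      using eventually_gt_at_top[of 0]
    proof eventually_elim
      case (elim j)
      have "of_nat j * (t (Suc j) / of_nat (Suc j) - t j / of_nat j) - (t (Suc j) - t j) = - t (Suc j) / of_nat (Suc j)"
        using elim of_nat_neq_0[where 'a=complex, of j] by (simp add: field_simps del: of_nat_Suc) (simp add: algebra_simps)
      then show ?case using B[of "Suc j"] by (simp add: norm_divide divide_right_mono del: of_nat_Suc)
    qed
    show "(\<lambda>j. B / real (Suc j)) \<longlonglongrightarrow> 0" by real_asymp
  qed
qed

lemma log_null_shift_diff:
  assumes B: "\<And>j. norm (t j) \<le> B"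
  shows "log_null (\<lambda>j. t (j + m) - t j)"
proof (induction m)
  case 0 then show ?case by (simp add: log_null_def)
next
  case (Suc m)
  have "log_null (\<lambda>j. t (Suc j + m) - t (j + m))"
    using log_null_telescope[of "\<lambda>j. t (j + m)" B] B by simp
  from log_null_add[OF this Suc] show ?case by simp
qed

section \<open>Cancellation for phases that advance by a multiple of sqrt j\<close>

lemma sqrt_Suc_diff_null: "(\<lambda>j. sqrt (real (Suc j)) - sqrt (real j)) \<longlonglongrightarrow> 0"
  by real_asymp

text \<open>The relative error of an approximate antidifference once the common phase is factored
  out: \<open>d\<close> is the phase increment, \<open>s\<close> and \<open>t\<close> are the square
  roots at the two ends. Split into parts, it becomes a matter of real limits.\<close>

lemma cis_quotient_expand:
  fixes c d s t :: real assumes "c \<noteq> 0" "s \<noteq> 0" "t \<noteq> 0"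
  shows "of_nat j * (cis d * (2 / (\<i> * c * t)) - 2 / (\<i> * c * s)) - 1
         = Complex ((2 / c) * (real j * (sin d / t)) - 1)
       (- (2 / c) * (real j * (cos d / t - 1 / s)))"
proof -
  have k: "2 / (\<i> * complex_of_real c * complex_of_real s) = Complex 0 (- (2 / c / s))" if "s \<noteq> 0" for s
    using assms that by (simp add: complex_eq_iff Re_divide Im_divide power2_eq_square)
  show ?thesis unfolding k[OF assms(2)] k[OF assms(3)]
    by (simp add: complex_eq_iff right_diff_distrib mult_ac)
qed

lemma tendsto_cis_mult_0:
  assumes "x \<longlonglongrightarrow> 0"
  shows "(\<lambda>j. cis (a j) * x j) \<longlonglongrightarrow> 0"
  by (rule tendsto_norm_zero_cancel) (use tendsto_norm_zero[OF assms] in \<open>simp add: norm_mult\<close>)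

text \<open>The derivative of \<open>cis (c * sqrt x) * 2 / (\<i> * c * sqrt x)\<close> is
  \<open>cis (c * sqrt x) / x\<close> up to lower order. So \<open>G\<close> is a bounded
  approximate antidifference of the summands: its differences telescope, and times \<open>j\<close>
  they differ from \<open>cis (c * sqrt j)\<close> by a null sequence.\<close>

lemma log_null_cis_sqrt:
  assumes c: "c \<noteq> 0"
  shows "log_null (\<lambda>j. cis (c * sqrt j))"
proof (rule log_null_close)
  define G where "G j = cis (c * sqrt (real j)) * (2 / (\<i> * c * sqrt (real j)))" for j
  have tele: "(\<Sum>j=1..n. of_nat j * (G (Suc j) - G j) / of_nat j) = G (Suc n) - G 1" for n
  proof -
    have "(\<Sum>j=1..n. of_nat j * (G (Suc j) - G j) / of_nat j) = (\<Sum>j=1..n. G (Suc j) - G j)"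
      by (intro sum.cong) auto
    then show ?thesis by (simp add: sum_Suc_diff)
  qed
  have nG: "norm (G (Suc j)) \<le> 2 / \<bar>c\<bar>" for j
    using c by (simp add: G_def norm_mult norm_divide divide_simps)
  show "log_null (\<lambda>j. of_nat j * (G (Suc j) - G j))"
  proof (rule log_null_bounded_sum[where B = "2 / \<bar>c\<bar> + 2 / \<bar>c\<bar>"])
    fix n
    show "norm (\<Sum>j=1..n. of_nat j * (G (Suc j) - G j) / complex_of_real (real j)) \<le> 2 / \<bar>c\<bar> + 2 / \<bar>c\<bar>"
      using tele[of n] norm_triangle_ineq4[of "G (Suc n)" "G 1"] nG[of n] nG[of 0] by simp
  qed
  define \<delta> where "\<delta> j = c * (sqrt (real (Suc j)) - sqrt (real j))" for j :: nat
  have \<delta>0: "\<delta> \<longlonglongrightarrow> 0"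
    unfolding \<delta>_def by (rule tendsto_mult_right_zero[OF sqrt_Suc_diff_null])
  have \<delta>nz: "\<delta> j \<noteq> 0" for j using c by (simp add: \<delta>_def)
  have "((\<lambda>x::real. sin x / x) \<longlongrightarrow> 1) (at 0)" by real_asymp
  moreover have "filterlim \<delta> (at 0) sequentially" using \<delta>0 \<delta>nz by (simp add: filterlim_at)
  ultimately have "(\<lambda>j. sin (\<delta> j) / \<delta> j) \<longlonglongrightarrow> 1" by (rule filterlim_compose)
  moreover have "(\<lambda>j. 2 * real j * (sqrt (real (Suc j)) - sqrt (real j)) / sqrt (real (Suc j))) \<longlonglongrightarrow> 1"
    by real_asymp
  ultimately have "(\<lambda>j. sin (\<delta> j) / \<delta> j * (2 * real j * (sqrt (real (Suc j)) - sqrt (real j)) / sqrt (real (Suc j))) - 1) \<longlonglongrightarrow> 1 * 1 - 1"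
    by (intro tendsto_intros)
  moreover have "sin (\<delta> j) / \<delta> j * (2 * real j * (sqrt (real (Suc j)) - sqrt (real j)) / sqrt (real (Suc j)))
      = (2 / c) * (real j * (sin (\<delta> j) / sqrt (Suc j)))" for j
    using \<delta>nz[of j] by (simp add: \<delta>_def divide_simps del: of_nat_Suc)
  ultimately have rr: "(\<lambda>j. (2 / c) * (real j * (sin (\<delta> j) / sqrt (Suc j))) - 1) \<longlonglongrightarrow> 0" by simp
  have "(\<lambda>j. real j * ((cos (\<delta> j) - 1) / sqrt (Suc j))) \<longlonglongrightarrow> 0"
  proof (rule Lim_null_comparison)
    show "eventually (\<lambda>j. norm (real j * ((cos (\<delta> j) - 1) / sqrt (Suc j)))
       \<le> c\<^sup>2 / 2 * (real j * (sqrt (real (Suc j)) - sqrt (real j))\<^sup>2 / sqrt (real (Suc j)))) sequentially"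
    proof (rule always_eventually, rule allI)
      fix j :: nat
      have "\<bar>cos (\<delta> j) - 1\<bar> \<le> (\<delta> j)\<^sup>2 / 2"
        using cos_double_sin[of "\<delta> j / 2"] power_mono[OF abs_sin_x_le_abs_x[of "\<delta> j / 2"], of 2]
        by (simp add: power_divide)
      then have "real j * (\<bar>cos (\<delta> j) - 1\<bar> / sqrt (Suc j)) \<le> real j * ((\<delta> j)\<^sup>2 / 2 / sqrt (Suc j))"
        by (intro mult_left_mono divide_right_mono) auto
      then show "norm (real j * ((cos (\<delta> j) - 1) / sqrt (Suc j)))
       \<le> c\<^sup>2 / 2 * (real j * (sqrt (real (Suc j)) - sqrt (real j))\<^sup>2 / sqrt (real (Suc j)))"
        by (simp add: abs_mult \<delta>_def power_mult_distrib mult_ac)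
    qed
    have "(\<lambda>j. real j * (sqrt (real (Suc j)) - sqrt (real j))\<^sup>2 / sqrt (real (Suc j))) \<longlonglongrightarrow> 0" by real_asymp
    then show "(\<lambda>j. c\<^sup>2 / 2 * (real j * (sqrt (real (Suc j)) - sqrt (real j))\<^sup>2 / sqrt (real (Suc j)))) \<longlonglongrightarrow> 0"
      by (rule tendsto_mult_right_zero)
  qed
  moreover have "(\<lambda>j. real j * (1 / sqrt (real (Suc j)) - 1 / sqrt (real j))) \<longlonglongrightarrow> 0" by real_asymp
  ultimately have "(\<lambda>j. - (2 / c) * (real j * ((cos (\<delta> j) - 1) / sqrt (Suc j)) + real j * (1 / sqrt (real (Suc j)) - 1 / sqrt (real j)))) \<longlonglongrightarrow> - (2 / c) * (0 + 0)"
    by (intro tendsto_intros)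
  moreover have "real j * ((cos (\<delta> j) - 1) / sqrt (Suc j)) + real j * (1 / sqrt (real (Suc j)) - 1 / sqrt (real j))
     = real j * (cos (\<delta> j) / sqrt (Suc j) - 1 / sqrt j)" for j
    by (simp add: diff_divide_distrib right_diff_distrib)
  ultimately have ii: "(\<lambda>j. - (2 / c) * (real j * (cos (\<delta> j) / sqrt (Suc j) - 1 / sqrt j))) \<longlonglongrightarrow> 0"
    by (simp only: add_0_right mult_zero_right)
  have "(\<lambda>j. Complex ((2 / c) * (real j * (sin (\<delta> j) / sqrt (Suc j))) - 1)
       (- (2 / c) * (real j * (cos (\<delta> j) / sqrt (Suc j) - 1 / sqrt j)))) \<longlonglongrightarrow> Complex 0 0"
    using rr ii by (rule tendsto_Complex)
  then have "(\<lambda>j. Complex ((2 / c) * (real j * (sin (\<delta> j) / sqrt (Suc j))) - 1)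
       (- (2 / c) * (real j * (cos (\<delta> j) / sqrt (Suc j) - 1 / sqrt j)))) \<longlonglongrightarrow> 0"
    unfolding zero_complex.code .
  then have lim: "(\<lambda>j. cis (c * sqrt j) * Complex ((2 / c) * (real j * (sin (\<delta> j) / sqrt (Suc j))) - 1)
       (- (2 / c) * (real j * (cos (\<delta> j) / sqrt (Suc j) - 1 / sqrt j)))) \<longlonglongrightarrow> 0"
    by (rule tendsto_cis_mult_0)
  show "(\<lambda>j. of_nat j * (G (Suc j) - G j) - cis (c * sqrt j)) \<longlonglongrightarrow> 0"
  proof (rule Lim_transform_eventually[OF lim])
    show "eventually (\<lambda>j. cis (c * sqrt j) * Complex ((2 / c) * (real j * (sin (\<delta> j) / sqrt (Suc j))) - 1)
       (- (2 / c) * (real j * (cos (\<delta> j) / sqrt (Suc j) - 1 / sqrt j)))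
       = of_nat j * (G (Suc j) - G j) - cis (c * sqrt j)) sequentially"
      using eventually_gt_at_top[of 0]
    proof eventually_elim
      case (elim j)
      have a: "cis (c * sqrt (Suc j)) = cis (c * sqrt j) * cis (\<delta> j)"
        by (simp add: cis_mult \<delta>_def algebra_simps)
      have b: "of_nat j * (G (Suc j) - G j) - cis (c * sqrt j) = cis (c * sqrt j) *
         (of_nat j * (cis (\<delta> j) * (2 / (\<i> * c * sqrt (Suc j))) - 2 / (\<i> * c * sqrt j)) - 1)"
        unfolding G_def a by (simp add: algebra_simps)
      have "of_nat j * (cis (\<delta> j) * (2 / (\<i> * c * sqrt (Suc j))) - 2 / (\<i> * c * sqrt j)) - 1
         = Complex ((2 / c) * (real j * (sin (\<delta> j) / sqrt (Suc j))) - 1)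
       (- (2 / c) * (real j * (cos (\<delta> j) / sqrt (Suc j) - 1 / sqrt j)))"
        using elim c by (intro cis_quotient_expand) auto
      then show ?case using b by simp
    qed
  qed
qed

lemma tendsto_cis_diff_0:
  fixes a b :: "nat \<Rightarrow> real"
  assumes "(\<lambda>j. a j - b j) \<longlonglongrightarrow> 0"
  shows "(\<lambda>j. cis (a j) - cis (b j)) \<longlonglongrightarrow> 0"
proof -
  have "(\<lambda>j. cis (a j - b j)) \<longlonglongrightarrow> cis 0"
    using assms by (rule tendsto_cis)
  then have "(\<lambda>j. cis (a j - b j) - 1) \<longlonglongrightarrow> 0" by (simp add: LIM_zero_iff)
  then have "(\<lambda>j. cis (b j) * (cis (a j - b j) - 1)) \<longlonglongrightarrow> 0"
    by (rule tendsto_cis_mult_0)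
  then show ?thesis by (simp add: algebra_simps cis_mult)
qed

lemma sqrt_shift_diff_null: "(\<lambda>j. c * sqrt (real (j + m)) - c * sqrt (real j)) \<longlonglongrightarrow> 0"
proof (induction m)
  case (Suc m)
  have "(\<lambda>j. c * (sqrt (real (Suc (j + m))) - sqrt (real (j + m)))) \<longlonglongrightarrow> 0"
    using LIMSEQ_ignore_initial_segment[OF sqrt_Suc_diff_null, of m] by (rule tendsto_mult_right_zero)
  from tendsto_add[OF this Suc] show ?case by (simp add: right_diff_distrib)
qed simp

text \<open>For fixed \<open>m\<close> the factors \<open>w j\<close>, ...,
  \<open>w (j + m - 1)\<close> agree up to o(1), so \<open>z (j + m)\<close> is close to
  \<open>z j * w j ^ m\<close>; and a bounded shift does not change a logarithmic mean.\<close>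

lemma log_null_rotation_average:
  assumes z: "\<And>j. norm (z j) \<le> 1"
    and rec: "(\<lambda>j. z (Suc j) - z j * w j) \<longlonglongrightarrow> 0"
    and w: "\<And>j. norm (w j) \<le> 1" "\<And>m. (\<lambda>j. w (j + m) - w j) \<longlonglongrightarrow> 0"
  shows "log_null (\<lambda>j. z j - z j * w j ^ m)"
proof -
  have "(\<lambda>j. z (j + m) - z j * w j ^ m) \<longlonglongrightarrow> 0"
  proof (induction m)
    case (Suc m)
    have 1: "(\<lambda>j. z (Suc (j + m)) - z (j + m) * w (j + m)) \<longlonglongrightarrow> 0"
      using LIMSEQ_ignore_initial_segment[OF rec, of m] by simp
    have 2: "(\<lambda>j. z (j + m) * (w (j + m) - w j)) \<longlonglongrightarrow> 0"
      by (rule Lim_null_comparison[OF _ tendsto_norm_zero[OF w(2)[of m]]])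
        (rule always_eventually, auto simp: norm_mult intro!: mult_left_le_one_le z)
    have 3: "(\<lambda>j. (z (j + m) - z j * w j ^ m) * w j) \<longlonglongrightarrow> 0"
      by (rule Lim_null_comparison[OF _ tendsto_norm_zero[OF Suc]])
        (rule always_eventually, auto simp: norm_mult intro!: mult_right_le_one_le w)
    show ?case using tendsto_add[OF tendsto_add[OF 1 2] 3] by (simp add: algebra_simps)
  qed simp
  then have "(\<lambda>j. (z (j + m) - z j) - (z j * w j ^ m - z j)) \<longlonglongrightarrow> 0" by simp
  from log_null_close[OF log_null_shift_diff[of z, OF z] this]
  have "log_null (\<lambda>j. z j * w j ^ m - z j)" .
  from log_null_cmult[OF this, of "-1"] show ?thesis by simp
qed

text \<open>A van der Corput argument: averaging \<open>M\<close> consecutive terms replaces \<open>z j\<close> by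
  \<open>z j\<close> times the mean of the first \<open>M\<close> powers of \<open>cis (c * sqrt j)\<close>, whose
  logarithmic mean square is \<open>1 / M\<close>.\<close>

lemma log_null_slow_rotation:
  assumes c: "c \<noteq> 0" and z: "\<And>j. norm (z j) \<le> 1"
    and rec: "(\<lambda>j. z (Suc j) - z j * cis (c * sqrt j)) \<longlonglongrightarrow> 0"
  shows "log_null z"
  unfolding log_null_def
proof (rule LIMSEQ_I)
  fix r :: real assume r: "r > 0"
  \<comment> \<open>The final bound is \<open>1 / K\<close>, below \<open>r\<close>. A block length
    that is the square of \<open>K\<close> makes the root mean square of \<open>D\<close> equal to
    \<open>1 / K\<close>.\<close>
  obtain K :: nat where K: "real K > 2 / r" using reals_Archimedean2 by blast
  have K0: "real K > 0" using r K by (meson divide_pos_pos less_trans zero_less_numeral)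
  define M where "M = K * K"
  define w where "w j = cis (c * sqrt (real j))" for j :: nat
  define D where "D j = (\<Sum>m<M. w j ^ m) / of_nat M" for j
  have M0: "M > 0" using K0 by (simp add: M_def)
  have w1: "norm (w j) \<le> 1" for j by (simp add: w_def)
  have w2: "(\<lambda>j. w (j + m) - w j) \<longlonglongrightarrow> 0" for m
    unfolding w_def by (rule tendsto_cis_diff_0[OF sqrt_shift_diff_null])
  have "log_null (\<lambda>j. (1 / of_nat M) * (\<Sum>m<M. z j - z j * w j ^ m))"
    using rec by (intro log_null_cmult log_null_sum log_null_rotation_average z w1 w2) (simp_all add: w_def)
  moreover have "(1 / of_nat M) * (\<Sum>m<M. z j - z j * w j ^ m) = z j - z j * D j" for j
    using M0 by (simp add: D_def sum_subtractf sum_distrib_left[symmetric] diff_divide_distrib)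
  ultimately have n1: "log_null (\<lambda>j. z j - z j * D j)" by simp
  \<comment> \<open>In the double sum for the squared modulus of \<open>D j\<close> the diagonal
    contributes \<open>1 / M\<close>; the off-diagonal terms are nontrivial rotations, which
    \<open>log_null_cis_sqrt\<close> removes.\<close>
  have DD: "D j * cnj (D j) - 1 / of_nat M
     = (1 / of_nat M ^ 2) * (\<Sum>m<M. \<Sum>l<M. cis ((real m - real l) * c * sqrt j) - of_bool (m = l))" for j
  proof -
    have "(\<Sum>m<M. \<Sum>l<M. (of_bool (m = l) :: complex)) = of_nat M"
      by simp
    moreover have "w j ^ m * cnj (w j) ^ l = cis ((real m - real l) * c * sqrt j)" for m l
      by (simp add: w_def cis_cnj Complex.DeMoivre cis_mult algebra_simps)
    then have "D j * cnj (D j) = (1 / of_nat M ^ 2) * (\<Sum>m<M. \<Sum>l<M. cis ((real m - real l) * c * sqrt j))"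
      by (simp add: D_def sum_product power2_eq_square)
    ultimately show ?thesis using M0
      by (simp add: sum_subtractf right_diff_distrib power2_eq_square del: sum_of_bool_eq)
  qed
  have "log_null (\<lambda>j. cis ((real m - real l) * c * sqrt j) - of_bool (m = l))" for m l
  proof (cases "m = l")
    case True then show ?thesis by (simp add: log_null_def)
  next
    case False then show ?thesis using log_null_cis_sqrt[of "(real m - real l) * c"] c by simp
  qed
  then have n2: "log_null (\<lambda>j. D j * cnj (D j) - 1 / of_nat M)"
    unfolding DD by (intro log_null_cmult log_null_sum)
  define H where "H n = (\<Sum>j=1..n. 1 / real j)" for n
  define P where "P n = (\<Sum>j=1..n. (z j - z j * D j) / real j)" for n
  define Q where "Q n = (\<Sum>j=1..n. (D j * cnj (D j) - 1 / of_nat M) / real j)" for n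
  have bound: "norm (\<Sum>j=1..n. z j / real j) \<le> norm (P n) + H n / K + K / 2 * norm (Q n)" for n
  proof -
    \<comment> \<open>Passes from \<open>D\<close>, whose mean is not accessible, to its square. As
      the square has logarithmic mean \<open>1 / M = 1 / (K * K)\<close>, the two terms contribute
      \<open>1 / (2 * K)\<close> each.\<close>
    have amgm: "norm (D j) \<le> 1 / (2 * K) + K / 2 * (norm (D j))\<^sup>2" for j
    proof -
      have "0 \<le> (1 - K * norm (D j))\<^sup>2" by simp
      then have "2 * K * norm (D j) \<le> 1 + K * K * (norm (D j))\<^sup>2" by (simp add: power2_eq_square algebra_simps)
      then show ?thesis using K0 by (simp add: field_simps)
    qed
    have sq: "(norm (D j))\<^sup>2 = 1 / M + Re (D j * cnj (D j) - 1 / of_nat M)" for j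
      by (simp add: complex_norm_square[symmetric] Re_divide_of_nat)
    have "(\<Sum>j=1..n. z j / real j) = P n + (\<Sum>j=1..n. z j * D j / real j)"
      by (simp add: P_def sum.distrib[symmetric] add_divide_distrib[symmetric])
    then have "norm (\<Sum>j=1..n. z j / real j) \<le> norm (P n) + norm (\<Sum>j=1..n. z j * D j / real j)"
      using norm_triangle_ineq by simp
    also have "norm (\<Sum>j=1..n. z j * D j / real j) \<le> (\<Sum>j=1..n. norm (D j) / real j)"
      by (rule sum_norm_le) (auto simp: norm_mult norm_divide intro!: divide_right_mono mult_left_le_one_le z)
    also have "\<dots> \<le> (\<Sum>j=1..n. (1 / (2 * K) + K / 2 * (norm (D j))\<^sup>2) / real j)"
      by (intro sum_mono divide_right_mono amgm) auto
    also have "\<dots> = (\<Sum>j=1..n. 1 / (2 * K) * (1 / real j) + K / 2 * (1 / M * (1 / real j)) + K / 2 * (Re (D j * cnj (D j) - 1 / of_nat M) / real j))"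
      unfolding sq by (intro sum.cong refl) (simp only: add_divide_distrib distrib_left times_divide_eq_right times_divide_eq_left mult_1_right mult_1_left add.assoc)
    also have "\<dots> = 1 / (2 * K) * H n + K / 2 * (1 / M * H n) + K / 2 * Re (Q n)"
      by (simp only: sum.distrib sum_distrib_left[symmetric] H_def Q_def Re_sum Re_divide_of_real)
    also have "1 / (2 * K) * H n + K / 2 * (1 / M * H n) = H n / K"
      using K0 by (simp add: M_def field_simps)
    also have "Re (Q n) \<le> norm (Q n)" by (rule complex_Re_le_cmod)
    finally show ?thesis using K0 by (simp add: mult_left_mono)
  qed
  have P: "(\<lambda>n. P n / ln (real n)) \<longlonglongrightarrow> 0" using n1 by (simp add: log_null_def P_def)
  have Q: "(\<lambda>n. Q n / ln (real n)) \<longlonglongrightarrow> 0" using n2 by (simp add: log_null_def Q_def)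
  have H: "(\<lambda>n. H n / ln (real n)) \<longlonglongrightarrow> 1" using harmonic_sum_over_ln_tendsto_1 by (simp add: H_def)
  have lim: "(\<lambda>n. norm (P n / ln (real n)) + H n / ln (real n) / K + K / 2 * norm (Q n / ln (real n))) \<longlonglongrightarrow> 0 + 1 / K + K / 2 * 0"
    using tendsto_norm_zero[OF P] tendsto_norm_zero[OF Q] H K0 by (intro tendsto_intros) auto
  have "0 + 1 / K + K / 2 * 0 < r" using K K0 r
    by (simp add: field_simps)
  with lim have "eventually (\<lambda>n. norm (P n / ln (real n)) + H n / ln (real n) / K + K / 2 * norm (Q n / ln (real n)) < r) sequentially"
    by (rule order_tendstoD)
  then have "eventually (\<lambda>n. norm ((\<Sum>j=1..n. z j / real j) / ln (real n) - 0) < r) sequentially"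
    using eventually_gt_at_top[of 1]
  proof eventually_elim
    case (elim n)
    have "norm ((\<Sum>j=1..n. z j / real j) / ln (real n)) = norm (\<Sum>j=1..n. z j / real j) / ln (real n)"
      using elim by (simp add: norm_divide)
    also have "\<dots> \<le> (norm (P n) + H n / K + K / 2 * norm (Q n)) / ln (real n)"
      using elim by (intro divide_right_mono bound) auto
    also have "\<dots> = norm (P n / ln (real n)) + H n / ln (real n) / K + K / 2 * norm (Q n / ln (real n))"
      using elim by (simp add: norm_divide add_divide_distrib)
    finally show ?case using elim by simp
  qed
  then show "\<exists>no. \<forall>n\<ge>no. norm ((\<Sum>j=1..n. z j / real j) / ln (real n) - 0) < r"
    by (simp add: eventually_sequentially)
qed

section \<open>Transforms of independent variables by predictable weights\<close>

text \<open>The \<open>n\<close>-th past is generated by the variables with index below \<open>n\<close>, so a variable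
  measurable for it is predictable at time \<open>n\<close>.\<close>

definition past :: "'a measure \<Rightarrow> (nat \<Rightarrow> 'a \<Rightarrow> real) \<Rightarrow> nat \<Rightarrow> 'a measure" where
  "past M g n = sigma (space M) (\<Union>i\<in>{1..<n}. {g i -` A \<inter> space M | A. A \<in> sets borel})"

lemma space_past [simp]: "space (past M g n) = space M"
  unfolding past_def by (rule space_measure_of) auto

lemma sets_past: "sets (past M g n) = sigma_sets (space M) (\<Union>i\<in>{1..<n}. {g i -` A \<inter> space M | A. A \<in> sets borel})"
  unfolding past_def by (rule sets_measure_of) auto

lemma subalgebra_past_mono: "m \<le> n \<Longrightarrow> subalgebra (past M g n) (past M g m)"
  unfolding subalgebra_def sets_past by (intro conjI sigma_sets_mono' UN_mono) auto

lemma measurable_past_mono: "f \<in> measurable (past M g m) N \<Longrightarrow> m \<le> n \<Longrightarrow> f \<in> measurable (past M g n) N"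
  using measurable_from_subalg[OF subalgebra_past_mono] by blast

lemma measurable_past:
  assumes "1 \<le> i" "i < n" shows "g i \<in> borel_measurable (past M g n)"
proof (rule measurableI)
  fix A :: "real set" assume "A \<in> sets borel"
  then show "g i -` A \<inter> space (past M g n) \<in> sets (past M g n)"
    unfolding sets_past space_past using assms by (intro sigma_sets.Basic UN_I[of i]) auto
qed simp

lemma subalgebra_past:
  assumes "\<And>i. 1 \<le> i \<Longrightarrow> g i \<in> borel_measurable M"
  shows "subalgebra M (past M g n)"
  unfolding subalgebra_def sets_past
proof (intro conjI sets.sigma_sets_subset)
  show "(\<Union>i\<in>{1..<n}. {g i -` A \<inter> space M | A. A \<in> sets borel}) \<subseteq> sets M"
    using assms by (auto intro!: measurable_sets)
qed simp

text \<open>The index blocks \<open>{1..<n}\<close> and \<open>{n}\<close> are disjoint, so they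
  generate independent sigma-algebras, and \<open>H\<close> is measurable for the first.\<close>

lemma (in prob_space) indep_var_past:
  assumes indep: "indep_vars (\<lambda>_. borel) g {1..}" and n: "1 \<le> n"
    and H: "H \<in> borel_measurable (past M g n)"
  shows "indep_var borel H borel (g n)"
proof -
  let ?E = "\<lambda>i. {g i -` A \<inter> space M | A. A \<in> sets borel}"
  have g: "g i \<in> borel_measurable M" if "1 \<le> i" for i
    using indep that by (auto simp: indep_vars_def2)
  have "indep_sets ?E {1..}" using indep by (simp add: indep_vars_def2)
  then have "indep_sets ?E (\<Union>j\<in>UNIV. case_bool {1..<n} {n} j)"
    by (rule indep_sets_mono_index[rotated]) (use n in \<open>auto split: bool.splits\<close>)
  then have "indep_sets (\<lambda>j. sigma_sets (space M) (\<Union>i\<in>case_bool {1..<n} {n} j. ?E i)) UNIV"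
  proof (rule indep_sets_collect_sigma)
    show "Int_stable (?E i)" for i
    proof (rule Int_stableI)
      fix a b assume "a \<in> ?E i" "b \<in> ?E i"
      then obtain A B where "a = g i -` A \<inter> space M" "b = g i -` B \<inter> space M" "A \<in> sets borel" "B \<in> sets borel"
        by auto
      then show "a \<inter> b \<in> ?E i" by (auto intro!: exI[of _ "A \<inter> B"])
    qed
    show "disjoint_family_on (case_bool {1..<n} {n}) UNIV"
      by (auto simp: disjoint_family_on_def split: bool.splits)
  qed
  then have "indep_sets (case_bool (sets (past M g n)) (sigma_sets (space M) (?E n))) UNIV"
    by (rule indep_sets_mono_sets) (auto simp: sets_past split: bool.splits)
  then have 1: "indep_set (sets (past M g n)) (sigma_sets (space M) (?E n))"
    by (simp add: indep_set_def)
  have "sigma_sets (space M) {H -` A \<inter> space M | A. A \<in> sets borel} \<subseteq> sets (past M g n)"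
    using sets.sigma_sets_subset[of "{H -` A \<inter> space M | A. A \<in> sets borel}" "past M g n"] H
    by (auto simp: measurable_def)
  then have "indep_set (sigma_sets (space M) {H -` A \<inter> space M | A. A \<in> sets borel}) (sigma_sets (space M) (?E n))"
    using 1 unfolding indep_sets2_eq by blast
  moreover have "H \<in> borel_measurable M"
    using measurable_from_subalg[OF subalgebra_past[OF g] H] .
  ultimately show ?thesis unfolding indep_var_eq using g n by auto
qed

text \<open>Orthogonality of martingale increments without conditional expectations:
  \<open>S n\<close> times the next weight is measurable for the past, hence independent of the next
  centred variable, and the cross term in the square has mean 0.\<close>

lemma (in prob_space) predictable_transform_second_moment:
  fixes \<phi> :: "nat \<Rightarrow> real \<Rightarrow> real" and V :: "nat \<Rightarrow> 'a \<Rightarrow> real"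
  assumes indep: "indep_vars (\<lambda>_. borel) g {1..}"
    and \<phi>: "\<And>j. \<phi> j \<in> borel_measurable borel"
    and sq: "\<And>j. 1 \<le> j \<Longrightarrow> integrable M (\<lambda>\<omega>. (\<phi> j (g j \<omega>))\<^sup>2)"
    and mean: "\<And>j. 1 \<le> j \<Longrightarrow> expectation (\<lambda>\<omega>. \<phi> j (g j \<omega>)) = 0"
    and V: "\<And>j. 1 \<le> j \<Longrightarrow> V j \<in> borel_measurable (past M g j)" "\<And>j \<omega>. \<bar>V j \<omega>\<bar> \<le> 1"
  defines "S \<equiv> \<lambda>n \<omega>. \<Sum>j=1..n. V j \<omega> * \<phi> j (g j \<omega>)"
  shows "integrable M (\<lambda>\<omega>. (S n \<omega>)\<^sup>2)"
    and "expectation (\<lambda>\<omega>. (S n \<omega>)\<^sup>2) \<le> (\<Sum>j=1..n. expectation (\<lambda>\<omega>. (\<phi> j (g j \<omega>))\<^sup>2))"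
proof -
  have g: "g i \<in> borel_measurable M" if "1 \<le> i" for i
    using indep that by (auto simp: indep_vars_def2)
  note sub = subalgebra_past[OF g]
  have Y: "(\<lambda>\<omega>. \<phi> j (g j \<omega>)) \<in> borel_measurable M" if "1 \<le> j" for j
    using measurable_compose[OF g[OF that] \<phi>[of j]] .
  have Yint: "integrable M (\<lambda>\<omega>. \<phi> j (g j \<omega>))" if "1 \<le> j" for j
    by (rule square_integrable_imp_integrable) (use Y sq that in auto)
  have Vm: "V j \<in> borel_measurable M" if "1 \<le> j" for j
    by (rule measurable_from_subalg[OF sub V(1)[OF that]])
  have Sp: "S n \<in> borel_measurable (past M g (Suc n))" for n
    unfolding S_def
  proof (intro borel_measurable_sum borel_measurable_times)
    fix j assume j: "j \<in> {1..n}"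
    show "V j \<in> borel_measurable (past M g (Suc n))"
      using j by (intro measurable_past_mono[OF V(1)]) auto
    show "(\<lambda>\<omega>. \<phi> j (g j \<omega>)) \<in> borel_measurable (past M g (Suc n))"
      by (rule measurable_compose[OF measurable_past \<phi>]) (use j in auto)
  qed
  have Sm: "S n \<in> borel_measurable M" for n by (rule measurable_from_subalg[OF sub Sp])
  have step: "integrable M (\<lambda>\<omega>. (S (Suc n) \<omega>)\<^sup>2) \<and>
     expectation (\<lambda>\<omega>. (S (Suc n) \<omega>)\<^sup>2) \<le> expectation (\<lambda>\<omega>. (S n \<omega>)\<^sup>2) + expectation (\<lambda>\<omega>. (\<phi> (Suc n) (g (Suc n) \<omega>))\<^sup>2)"
    if int: "integrable M (\<lambda>\<omega>. (S n \<omega>)\<^sup>2)" for n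
  proof -
    let ?Y = "\<lambda>\<omega>. \<phi> (Suc n) (g (Suc n) \<omega>)" and ?V = "V (Suc n)"
    let ?H = "\<lambda>\<omega>. S n \<omega> * ?V \<omega>"
    have Hp: "?H \<in> borel_measurable (past M g (Suc n))"
      by (intro borel_measurable_times Sp V) simp
    have "indep_var borel (id \<circ> ?H) borel (\<phi> (Suc n) \<circ> g (Suc n))"
      by (rule indep_var_compose[OF indep_var_past[OF indep _ Hp]]) (use \<phi> in auto)
    then have ind: "indep_var borel ?H borel ?Y" by (simp add: o_def)
    have "integrable M (S n)" by (rule square_integrable_imp_integrable) (use Sm int in auto)
    then have Hint: "integrable M ?H"
    proof (rule Bochner_Integration.integrable_bound)
      show "AE \<omega> in M. norm (?H \<omega>) \<le> norm (S n \<omega>)"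
        using V(2) by (auto simp: abs_mult intro!: mult_right_le_one_le)
    qed (use Sm Vm in measurable)
    have Y1: "integrable M ?Y" by (rule Yint) simp
    have cross: "integrable M (\<lambda>\<omega>. ?H \<omega> * ?Y \<omega>)" "expectation (\<lambda>\<omega>. ?H \<omega> * ?Y \<omega>) = 0"
      using indep_var_integrable[OF ind Hint Y1] indep_var_lebesgue_integral[OF ind Hint Y1] mean[of "Suc n"]
      by auto
    have le: "(?V \<omega>)\<^sup>2 * (?Y \<omega>)\<^sup>2 \<le> (?Y \<omega>)\<^sup>2" for \<omega>
      using power_mono[OF V(2)[of "Suc n" \<omega>], of 2] by (intro mult_left_le_one_le) auto
    have last: "integrable M (\<lambda>\<omega>. (?V \<omega>)\<^sup>2 * (?Y \<omega>)\<^sup>2)"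
    proof (rule Bochner_Integration.integrable_bound[OF sq[of "Suc n"]])
      show "AE \<omega> in M. norm ((?V \<omega>)\<^sup>2 * (?Y \<omega>)\<^sup>2) \<le> norm ((?Y \<omega>)\<^sup>2)"
        using le by (auto simp: abs_mult)
    qed (use Vm[of "Suc n"] Y[of "Suc n"] in \<open>auto intro!: borel_measurable_times borel_measurable_power\<close>)
    have eq: "(S (Suc n) \<omega>)\<^sup>2 = (S n \<omega>)\<^sup>2 + 2 * (?H \<omega> * ?Y \<omega>) + (?V \<omega>)\<^sup>2 * (?Y \<omega>)\<^sup>2" for \<omega>
      unfolding S_def by (simp add: power2_eq_square algebra_simps)
    have "integrable M (\<lambda>\<omega>. (S (Suc n) \<omega>)\<^sup>2)"
      unfolding eq using int cross last by auto
    moreover have "expectation (\<lambda>\<omega>. (S (Suc n) \<omega>)\<^sup>2)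
      = expectation (\<lambda>\<omega>. (S n \<omega>)\<^sup>2) + expectation (\<lambda>\<omega>. (?V \<omega>)\<^sup>2 * (?Y \<omega>)\<^sup>2)"
      unfolding eq using int cross last by simp
    moreover have "expectation (\<lambda>\<omega>. (?V \<omega>)\<^sup>2 * (?Y \<omega>)\<^sup>2) \<le> expectation (\<lambda>\<omega>. (?Y \<omega>)\<^sup>2)"
      by (rule integral_mono[OF last sq le]) simp
    ultimately show ?thesis by simp
  qed
  have "integrable M (\<lambda>\<omega>. (S n \<omega>)\<^sup>2) \<and>
    expectation (\<lambda>\<omega>. (S n \<omega>)\<^sup>2) \<le> (\<Sum>j=1..n. expectation (\<lambda>\<omega>. (\<phi> j (g j \<omega>))\<^sup>2))"
  proof (induction n)
    case 0 show ?case by (simp add: S_def)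
  next
    case (Suc n)
    then show ?case using step[of n] by auto
  qed
  then show "integrable M (\<lambda>\<omega>. (S n \<omega>)\<^sup>2)"
    and "expectation (\<lambda>\<omega>. (S n \<omega>)\<^sup>2) \<le> (\<Sum>j=1..n. expectation (\<lambda>\<omega>. (\<phi> j (g j \<omega>))\<^sup>2))"
    by auto
qed

text \<open>Kolmogorov's inequality by stopping. Weights switched off once the sum has reached
  \<open>a\<close> are again predictable and bounded by 1, so the second moment bound applies to the
  stopped sum, and Chebyshev's inequality finishes.\<close>

lemma (in prob_space) predictable_transform_maximal_ineq:
  fixes \<phi> :: "nat \<Rightarrow> real \<Rightarrow> real" and V :: "nat \<Rightarrow> 'a \<Rightarrow> real"
  assumes indep: "indep_vars (\<lambda>_. borel) g {1..}"
    and \<phi>: "\<And>j. \<phi> j \<in> borel_measurable borel"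
    and sq: "\<And>j. 1 \<le> j \<Longrightarrow> integrable M (\<lambda>\<omega>. (\<phi> j (g j \<omega>))\<^sup>2)"
    and mean: "\<And>j. 1 \<le> j \<Longrightarrow> expectation (\<lambda>\<omega>. \<phi> j (g j \<omega>)) = 0"
    and V: "\<And>j. 1 \<le> j \<Longrightarrow> V j \<in> borel_measurable (past M g j)" "\<And>j \<omega>. \<bar>V j \<omega>\<bar> \<le> 1"
    and a: "a > 0"
  defines "S \<equiv> \<lambda>n \<omega>. \<Sum>j=1..n. V j \<omega> * \<phi> j (g j \<omega>)"
  shows "{\<omega>\<in>space M. \<exists>n\<le>N. a \<le> \<bar>S n \<omega>\<bar>} \<in> events" (is "?A \<in> _")
    and "prob {\<omega>\<in>space M. \<exists>n\<le>N. a \<le> \<bar>S n \<omega>\<bar>} \<le> (\<Sum>j=1..N. expectation (\<lambda>\<omega>. (\<phi> j (g j \<omega>))\<^sup>2)) / a\<^sup>2"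
proof -
  have g: "g i \<in> borel_measurable M" if "1 \<le> i" for i
    using indep that by (auto simp: indep_vars_def2)
  note sub = subalgebra_past[OF g]
  have Sp: "S n \<in> borel_measurable (past M g (Suc n))" for n
    unfolding S_def
  proof (intro borel_measurable_sum borel_measurable_times)
    fix j assume j: "j \<in> {1..n}"
    show "V j \<in> borel_measurable (past M g (Suc n))"
      using j by (intro measurable_past_mono[OF V(1)]) auto
    show "(\<lambda>\<omega>. \<phi> j (g j \<omega>)) \<in> borel_measurable (past M g (Suc n))"
      by (rule measurable_compose[OF measurable_past \<phi>]) (use j in auto)
  qed
  have Sm[measurable]: "S n \<in> borel_measurable M" for n by (rule measurable_from_subalg[OF sub Sp])
  show A: "?A \<in> events" by measurable
  \<comment> \<open>The product is 1 as long as no earlier sum has reached \<open>a\<close>, and 0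
    afterwards. Only indices \<open>k < j\<close> occur, which keeps \<open>W j\<close>
    predictable.\<close>
  define W where "W j \<omega> = V j \<omega> * (\<Prod>k<j. indicat_real {..<a} \<bar>S k \<omega>\<bar>)" for j \<omega>
  have Wm: "W j \<in> borel_measurable (past M g j)" if "1 \<le> j" for j
    unfolding W_def
  proof (intro borel_measurable_times V(1) that borel_measurable_prod)
    fix k assume "k \<in> {..<j}"
    then have [measurable]: "S k \<in> borel_measurable (past M g j)"
      by (intro measurable_past_mono[OF Sp]) auto
    show "(\<lambda>\<omega>. indicat_real {..<a} \<bar>S k \<omega>\<bar>) \<in> borel_measurable (past M g j)" by measurable
  qed
  have W1: "\<bar>W j \<omega>\<bar> \<le> 1" for j \<omega>
  proof -
    have "\<bar>\<Prod>k<j. indicat_real {..<a} \<bar>S k \<omega>\<bar>\<bar> \<le> 1"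
      unfolding abs_prod by (intro prod_le_1) (auto simp: indicator_def)
    then show ?thesis unfolding W_def abs_mult by (intro mult_le_one V) auto
  qed
  define T where "T n \<omega> = (\<Sum>j=1..n. W j \<omega> * \<phi> j (g j \<omega>))" for n \<omega>
  have WV: "W j \<omega> = (if \<forall>k<j. \<bar>S k \<omega>\<bar> < a then V j \<omega> else 0)" for j \<omega>
    by (auto simp: W_def indicator_def not_less)
  note moment = predictable_transform_second_moment[OF indep \<phi> sq mean Wm W1, folded T_def]
  have Tm: "T N \<in> borel_measurable M" unfolding T_def
    using measurable_from_subalg[OF sub Wm] measurable_compose[OF g \<phi>]
    by (intro borel_measurable_sum borel_measurable_times) auto
  \<comment> \<open>On this event the stopped sum at time \<open>N\<close> equals \<open>S\<close>
    at the first time \<open>m\<close> with \<open>a \<le> \<bar>S m \<omega>\<bar>\<close>.\<close>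
  have "?A \<subseteq> {\<omega>\<in>space M. a \<le> \<bar>T N \<omega>\<bar>}"
  proof safe
    fix \<omega> n assume n: "n \<le> N" "a \<le> \<bar>S n \<omega>\<bar>" and "\<omega> \<in> space M"
    define m where "m = (LEAST n. a \<le> \<bar>S n \<omega>\<bar>)"
    have m: "a \<le> \<bar>S m \<omega>\<bar>" "m \<le> n" unfolding m_def
      by (rule LeastI, rule n) (rule Least_le, rule n)
    have less: "\<bar>S k \<omega>\<bar> < a" if "k < m" for k
      using not_less_Least that unfolding m_def by fastforce
    have "T N \<omega> = (\<Sum>j\<in>{1..N}. if j \<le> m then V j \<omega> * \<phi> j (g j \<omega>) else 0)"
      unfolding T_def
    proof (intro sum.cong refl)
      fix j
      have "(\<forall>k<j. \<bar>S k \<omega>\<bar> < a) \<longleftrightarrow> j \<le> m"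
        using less m(1) by (meson leD leI less_le_trans)
      then show "W j \<omega> * \<phi> j (g j \<omega>) = (if j \<le> m then V j \<omega> * \<phi> j (g j \<omega>) else 0)"
        by (simp add: WV)
    qed
    also have "\<dots> = (\<Sum>j\<in>{1..N} \<inter> {..m}. V j \<omega> * \<phi> j (g j \<omega>))"
      by (subst sum.inter_restrict) auto
    also have "{1..N} \<inter> {..m} = {1..m}" using m n by auto
    finally show "a \<le> \<bar>T N \<omega>\<bar>" using m by (simp add: S_def)
  qed
  then have "prob ?A \<le> prob {\<omega>\<in>space M. a \<le> \<bar>T N \<omega>\<bar>}"
    using Tm by (intro finite_measure_mono) auto
  also have "\<dots> \<le> expectation (\<lambda>\<omega>. (T N \<omega>)\<^sup>2) / a\<^sup>2"
    by (rule second_moment_method[OF Tm moment(1) a])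
  also have "\<dots> \<le> (\<Sum>j=1..N. expectation (\<lambda>\<omega>. (\<phi> j (g j \<omega>))\<^sup>2)) / a\<^sup>2"
    by (intro divide_right_mono moment(2)) auto
  finally show "prob ?A \<le> (\<Sum>j=1..N. expectation (\<lambda>\<omega>. (\<phi> j (g j \<omega>))\<^sup>2)) / a\<^sup>2" .
qed

text \<open>Between \<open>2 ^ 2 ^ (k - 1)\<close> and \<open>2 ^ 2 ^ k\<close> the logarithm only
  doubles, so there \<open>2 ^ k\<close> is at most \<open>4 * ln n\<close>, using that
  \<open>ln 2\<close> is at least 1/2. A bound on the whole block in terms of its endpoint therefore
  suffices.\<close>

lemma over_ln_tendsto_0_of_blocks:
  fixes s :: "nat \<Rightarrow> real"
  assumes "\<And>m. eventually (\<lambda>k. \<forall>n\<le>2 ^ 2 ^ k. \<bar>s n\<bar> < 2 ^ k / real (Suc m)) sequentially"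
  shows "(\<lambda>n. s n / ln (real n)) \<longlonglongrightarrow> 0"
proof (rule LIMSEQ_I)
  fix r :: real assume r: "r > 0"
  obtain m :: nat where m: "real m > 4 / r" using reals_Archimedean2 by blast
  obtain k0 where k0: "\<And>k n. k \<ge> k0 \<Longrightarrow> n \<le> 2 ^ 2 ^ k \<Longrightarrow> \<bar>s n\<bar> < 2 ^ k / real (Suc m)"
    using assms[of m] by (auto simp: eventually_sequentially)
  show "\<exists>no. \<forall>n\<ge>no. norm (s n / ln (real n) - 0) < r"
  proof (intro exI allI impI)
    fix n :: nat assume n: "2 ^ 2 ^ k0 \<le> n"
    define k where "k = (LEAST k. n < 2 ^ 2 ^ k)"
    have "n < 2 ^ 2 ^ n" by (meson less_exp less_trans)
    then have k: "n < 2 ^ 2 ^ k" unfolding k_def by (rule LeastI)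
    have "(2::nat) ^ 2 ^ k0 < 2 ^ 2 ^ k" using n k by (rule le_less_trans)
    then have kk0: "k0 < k" by simp
    then obtain l where l: "k = Suc l" by (cases k) auto
    have "\<not> n < 2 ^ 2 ^ l" using not_less_Least[of l "\<lambda>k. n < 2 ^ 2 ^ k"] l by (simp add: k_def)
    then have "real (2 ^ 2 ^ l) \<le> real n" by (simp only: not_less of_nat_le_iff)
    then have "ln (real (2 ^ 2 ^ l)) \<le> ln (real n)" by (intro ln_mono) auto
    then have "2 ^ l * ln 2 \<le> ln (real n)" by (simp add: ln_realpow)
    moreover have "ln (2::real) \<ge> 1/2" using ln2_ge_two_thirds by simp
    then have "2 ^ l * (1/2) \<le> 2 ^ l * ln (2::real)" by (intro mult_left_mono) auto
    ultimately have "2 ^ l * (1/2) \<le> ln (real n)" by linarith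
    then have L: "2 ^ k \<le> 4 * ln (real n)" by (simp add: l)
    have Lpos: "ln (real n) > 0" using L zero_less_power[of "2::real" k] by linarith
    have "\<bar>s n\<bar> < 2 ^ k / real (Suc m)" using kk0 k by (intro k0) auto
    also have "\<dots> \<le> 4 * ln (real n) / real (Suc m)" using L by (intro divide_right_mono) auto
    also have "\<dots> \<le> r * ln (real n)"
    proof -
      have "4 < r * real m" using m r by (simp add: field_simps)
      also have "\<dots> \<le> r * real (Suc m)" using r by (intro mult_left_mono) auto
      finally have "4 * ln (real n) \<le> r * real (Suc m) * ln (real n)"
        using Lpos by (intro mult_right_mono) auto
      then show ?thesis by (simp add: divide_le_eq mult_ac del: of_nat_Suc)
    qed
    finally show "norm (s n / ln (real n) - 0) < r" using Lpos by (simp add: divide_less_eq)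
  qed
qed

text \<open>Up to time \<open>2 ^ 2 ^ k\<close> the variance is at most
  \<open>2 * \<bar>K\<bar> * 2 ^ k\<close>, while the squared threshold is
  \<open>(2 ^ k / Suc m)\<^sup>2\<close>. The exceptional probabilities decay like
  \<open>(1 / 2) ^ k\<close>, and Borel-Cantelli applies for each of the countably many
  \<open>m\<close>.\<close>

lemma (in prob_space) predictable_transform_over_ln_tendsto_0:
  fixes \<phi> :: "nat \<Rightarrow> real \<Rightarrow> real" and V :: "nat \<Rightarrow> 'a \<Rightarrow> real"
  assumes indep: "indep_vars (\<lambda>_. borel) g {1..}"
    and \<phi>: "\<And>j. \<phi> j \<in> borel_measurable borel"
    and sq: "\<And>j. 1 \<le> j \<Longrightarrow> integrable M (\<lambda>\<omega>. (\<phi> j (g j \<omega>))\<^sup>2)"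
    and mean: "\<And>j. 1 \<le> j \<Longrightarrow> expectation (\<lambda>\<omega>. \<phi> j (g j \<omega>)) = 0"
    and V: "\<And>j. 1 \<le> j \<Longrightarrow> V j \<in> borel_measurable (past M g j)" "\<And>j \<omega>. \<bar>V j \<omega>\<bar> \<le> 1"
    and K: "\<And>n. 1 \<le> n \<Longrightarrow> (\<Sum>j=1..n. expectation (\<lambda>\<omega>. (\<phi> j (g j \<omega>))\<^sup>2)) \<le> K * (1 + ln (real n))"
  shows "AE \<omega> in M. (\<lambda>n. (\<Sum>j=1..n. V j \<omega> * \<phi> j (g j \<omega>)) / ln (real n)) \<longlonglongrightarrow> 0"
proof -
  define S where "S n \<omega> = (\<Sum>j=1..n. V j \<omega> * \<phi> j (g j \<omega>))" for n \<omega>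
  note maxi = predictable_transform_maximal_ineq[OF indep \<phi> sq mean V, folded S_def]
  have "AE \<omega> in M. eventually (\<lambda>k. \<forall>n\<le>2 ^ 2 ^ k. \<bar>S n \<omega>\<bar> < 2 ^ k / real (Suc m)) sequentially" for m
  proof -
    define A where "A k = {\<omega>\<in>space M. \<exists>n\<le>2 ^ 2 ^ k. 2 ^ k / real (Suc m) \<le> \<bar>S n \<omega>\<bar>}" for k
    have A: "A k \<in> events" for k unfolding A_def by (rule maxi(1)) auto
    have bound: "prob (A k) \<le> 2 * \<bar>K\<bar> * (real (Suc m))\<^sup>2 * (1 / 2) ^ k" for k
    proof -
      have "prob (A k) \<le> (\<Sum>j=1..2 ^ 2 ^ k. expectation (\<lambda>\<omega>. (\<phi> j (g j \<omega>))\<^sup>2)) / (2 ^ k / real (Suc m))\<^sup>2"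
        unfolding A_def by (rule maxi(2)) auto
      also have "\<dots> \<le> K * (1 + ln (real (2 ^ 2 ^ k))) / (2 ^ k / real (Suc m))\<^sup>2"
        by (intro divide_right_mono K) auto
      also have "K * (1 + ln (real (2 ^ 2 ^ k))) \<le> \<bar>K\<bar> * (2 * 2 ^ k)"
      proof (rule mult_mono)
        have "ln (real (2 ^ 2 ^ k)) = 2 ^ k * ln 2" by (simp add: ln_realpow)
        also have "\<dots> \<le> 2 ^ k * 1" using ln_2_less_1 by (intro mult_left_mono) auto
        finally show "1 + ln (real (2 ^ 2 ^ k)) \<le> 2 * 2 ^ k"
          using one_le_power[of "2::real" k] by linarith
        show "0 \<le> 1 + ln (real (2 ^ 2 ^ k))" by simp
      qed auto
      finally have "prob (A k) \<le> \<bar>K\<bar> * (2 * 2 ^ k) / (2 ^ k / real (Suc m))\<^sup>2"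
        by (simp add: divide_right_mono)
      also have "\<dots> = 2 * \<bar>K\<bar> * (real (Suc m))\<^sup>2 * (1 / 2) ^ k"
        by (simp add: power2_eq_square field_simps power_one_over del: of_nat_Suc)
      finally show ?thesis .
    qed
    have "summable (\<lambda>k. prob (A k))"
    proof (rule summable_comparison_test')
      show "summable (\<lambda>k. 2 * \<bar>K\<bar> * (real (Suc m))\<^sup>2 * (1 / 2) ^ k)"
        by (intro summable_mult summable_geometric) simp
      show "norm (prob (A k)) \<le> 2 * \<bar>K\<bar> * (real (Suc m))\<^sup>2 * (1 / 2) ^ k" for k
        using bound[of k] by simp
    qed
    then have "AE \<omega> in M. eventually (\<lambda>k. \<omega> \<in> space M - A k) sequentially"
      by (intro borel_cantelli_AE1 A) (simp_all add: emeasure_eq_measure)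
    then show ?thesis
      by eventually_elim (auto elim!: eventually_mono simp: A_def not_le[symmetric])
  qed
  then have "AE \<omega> in M. \<forall>m. eventually (\<lambda>k. \<forall>n\<le>2 ^ 2 ^ k. \<bar>S n \<omega>\<bar> < 2 ^ k / real (Suc m)) sequentially"
    by (simp add: AE_all_countable)
  then show ?thesis
    by eventually_elim (rule over_ln_tendsto_0_of_blocks, simp add: S_def)
qed

section \<open>Growth of the radius\<close>

text \<open>By the mean value theorem the increment is \<open>sqrt (F * z + E)\<close> for some
  \<open>z\<close> between \<open>n\<close> and \<open>n + 1\<close>, and square roots of arguments
  a bounded distance apart merge at infinity.\<close>

lemma wkb_phase_increment:
  assumes F: "F > 0"
  shows "(\<lambda>n. wkb_phase F E (real (Suc n)) - wkb_phase F E (real n) - sqrt (F * real n)) \<longlonglongrightarrow> 0"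
proof (rule tendsto_sandwich)
  have ev: "eventually (\<lambda>n. F * real n + E > 0) sequentially"
    using affine_at_top[OF F] unfolding filterlim_at_top_dense by blast
  have mvt: "\<exists>z. real n < z \<and> z < real (Suc n) \<and>
      wkb_phase F E (real (Suc n)) - wkb_phase F E (real n) = sqrt (F * z + E)" if n: "F * real n + E > 0" for n
  proof -
    have pos: "F * x + E > 0" if "real n \<le> x" for x
      using n mult_left_mono[OF that, of F] F by linarith
    obtain z where z: "real n < z" "z < real (Suc n)"
      "wkb_phase F E (real (Suc n)) - wkb_phase F E (real n) = (real (Suc n) - real n) * (F * z + E) powr (1/2)"
      using MVT2[of "real n" "real (Suc n)" "wkb_phase F E" "\<lambda>x. (F * x + E) powr (1/2)"]
        wkb_phase_deriv[OF F pos] by auto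
    then show ?thesis using pos[of z] by (auto simp: powr_half_sqrt)
  qed
  show "eventually (\<lambda>n. sqrt (F * real n + E) - sqrt (F * real n) \<le>
     wkb_phase F E (real (Suc n)) - wkb_phase F E (real n) - sqrt (F * real n)) sequentially"
    using ev
  proof eventually_elim
    case (elim n)
    then obtain z where "real n < z" "wkb_phase F E (real (Suc n)) - wkb_phase F E (real n) = sqrt (F * z + E)"
      using mvt by blast
    then show ?case using F by simp
  qed
  show "eventually (\<lambda>n. wkb_phase F E (real (Suc n)) - wkb_phase F E (real n) - sqrt (F * real n)
      \<le> sqrt (F * real n + (F + E)) - sqrt (F * real n)) sequentially"
    using ev
  proof eventually_elim
    case (elim n)
    then obtain z where z: "z < real (Suc n)" "wkb_phase F E (real (Suc n)) - wkb_phase F E (real n) = sqrt (F * z + E)"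
      using mvt by blast
    have "F * z \<le> F * real (Suc n)" using z F by (intro mult_left_mono) auto
    then show ?case using z by (simp add: algebra_simps)
  qed
  have lim: "(\<lambda>n. sqrt (F * real n + D) - sqrt (F * real n)) \<longlonglongrightarrow> 0" for D
    using F by real_asymp
  show "(\<lambda>n. sqrt (F * real n + E) - sqrt (F * real n)) \<longlonglongrightarrow> 0"
    "(\<lambda>n. sqrt (F * real n + (F + E)) - sqrt (F * real n)) \<longlonglongrightarrow> 0" by (rule lim)+
qed

lemma tendsto_square_diff_0:
  fixes a b :: "nat \<Rightarrow> complex"
  assumes "(\<lambda>n. a n - b n) \<longlonglongrightarrow> 0" and "\<And>n. norm (a n) \<le> 1" "\<And>n. norm (b n) \<le> 1"
  shows "(\<lambda>n. (a n)\<^sup>2 - (b n)\<^sup>2) \<longlonglongrightarrow> 0"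
proof (rule Lim_null_comparison)
  have "norm ((a n)\<^sup>2 - (b n)\<^sup>2) \<le> norm (a n - b n) * 2" for n
  proof -
    have "(a n)\<^sup>2 - (b n)\<^sup>2 = (a n - b n) * (a n + b n)" by (simp add: power2_eq_square algebra_simps)
    moreover have "norm (a n + b n) \<le> 2"
      using norm_triangle_ineq[of "a n" "b n"] assms(2,3)[of n] by linarith
    ultimately show ?thesis by (simp add: norm_mult mult_left_mono)
  qed
  then show "eventually (\<lambda>n. norm ((a n)\<^sup>2 - (b n)\<^sup>2) \<le> norm (a n - b n) * 2) sequentially" by simp
  show "(\<lambda>n. norm (a n - b n) * 2) \<longlonglongrightarrow> 0"
    using tendsto_mult_left_zero[OF tendsto_norm_zero[OF assms(1)], of 2] by simp
qed

lemma norm_sgn_le_1: "norm (sgn (z :: complex)) \<le> 1"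
  by (simp add: norm_sgn)

text \<open>The constant is 1/4, from halving the squared modulus before squaring again, times the
  limit \<open>1 / F\<close> of \<open>n * cmod (\<zeta> n) ^ 4\<close>. Squaring the direction
  doubles the phase increment \<open>sqrt (F * n)\<close>.\<close>

lemma wkb_modulus_and_rotation:
  fixes \<zeta> :: "nat \<Rightarrow> complex"
  assumes F: "F > 0"
    and as: "(\<lambda>n. of_real ((F * real n + E) powr (1/4)) * \<zeta> n - cis (wkb_phase F E (real n))) \<longlonglongrightarrow> 0"
  shows "(\<lambda>n. real n * ((cmod (\<zeta> n))\<^sup>2 / 2)\<^sup>2) \<longlonglongrightarrow> 1 / (4 * F)"
    and "(\<lambda>n. (sgn (\<zeta> (Suc n)))\<^sup>2 - (sgn (\<zeta> n))\<^sup>2 * cis (2 * sqrt F * sqrt (real n))) \<longlonglongrightarrow> 0"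
proof -
  let ?r = "\<lambda>n. (F * real n + E) powr (1/4)" and ?t = "\<lambda>n. wkb_phase F E (real n)"
  have ev: "eventually (\<lambda>n. F * real n + E > 0) sequentially"
    using affine_at_top[OF F] unfolding filterlim_at_top_dense by blast
  have "(\<lambda>n. norm (of_real (?r n) * \<zeta> n) - 1) \<longlonglongrightarrow> 0"
  proof (rule Lim_null_comparison[OF _ tendsto_norm_zero[OF as]])
    show "eventually (\<lambda>n. norm (norm (of_real (?r n) * \<zeta> n) - 1) \<le> norm (of_real (?r n) * \<zeta> n - cis (?t n))) sequentially"
      using norm_triangle_ineq3[of "of_real (?r n) * \<zeta> n" "cis (?t n)" for n] by simp
  qed
  then have r1: "(\<lambda>n. ?r n * cmod (\<zeta> n)) \<longlonglongrightarrow> 1" by (simp add: norm_mult LIM_zero_iff)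
  have "(\<lambda>n. real n / (F * real n + E)) \<longlonglongrightarrow> inverse F" using F by real_asymp
  from tendsto_divide[OF tendsto_mult[OF this tendsto_power[OF r1, of 4]] tendsto_const[of 4]]
  have "(\<lambda>n. (real n / (F * real n + E)) * (?r n * cmod (\<zeta> n)) ^ 4 / 4) \<longlonglongrightarrow> inverse F * 1 ^ 4 / 4"
    by simp
  also have "inverse F * 1 ^ 4 / 4 = 1 / (4 * F)" using F by (simp add: field_simps)
  finally have "(\<lambda>n. (real n / (F * real n + E)) * (?r n * cmod (\<zeta> n)) ^ 4 / 4) \<longlonglongrightarrow> 1 / (4 * F)" .
  moreover have "eventually (\<lambda>n. (real n / (F * real n + E)) * (?r n * cmod (\<zeta> n)) ^ 4 / 4 = real n * ((cmod (\<zeta> n))\<^sup>2 / 2)\<^sup>2) sequentially"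
    using ev
  proof eventually_elim
    case (elim n)
    have "?r n ^ 4 = F * real n + E" using elim by (simp add: powr_power)
    then show ?case using elim by (simp add: power_mult_distrib power_divide flip: power_mult)
  qed
  ultimately show "(\<lambda>n. real n * ((cmod (\<zeta> n))\<^sup>2 / 2)\<^sup>2) \<longlonglongrightarrow> 1 / (4 * F)"
    by (rule Lim_transform_eventually)
  have "(\<lambda>n. of_real (?r n) * \<zeta> n - sgn (\<zeta> n)) \<longlonglongrightarrow> 0"
  proof (rule Lim_null_comparison)
    show "eventually (\<lambda>n. norm (of_real (?r n) * \<zeta> n - sgn (\<zeta> n)) \<le> \<bar>?r n * cmod (\<zeta> n) - 1\<bar>) sequentially"
    proof (rule always_eventually, rule allI)
      fix n
      have eq: "of_real (?r n) * \<zeta> n - sgn (\<zeta> n) = of_real (?r n * cmod (\<zeta> n) - 1) * sgn (\<zeta> n)"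
        by (simp add: sgn_eq algebra_simps)
      show "norm (of_real (?r n) * \<zeta> n - sgn (\<zeta> n)) \<le> \<bar>?r n * cmod (\<zeta> n) - 1\<bar>"
        unfolding eq norm_mult norm_of_real by (rule mult_left_le[OF norm_sgn_le_1 abs_ge_zero])
    qed
    show "(\<lambda>n. \<bar>?r n * cmod (\<zeta> n) - 1\<bar>) \<longlonglongrightarrow> 0"
      using tendsto_rabs[OF LIM_zero[OF r1]] by simp
  qed
  from tendsto_diff[OF as this] have "(\<lambda>n. sgn (\<zeta> n) - cis (?t n)) \<longlonglongrightarrow> 0" by simp
  from tendsto_square_diff_0[OF this norm_sgn_le_1] have sq: "(\<lambda>n. (sgn (\<zeta> n))\<^sup>2 - cis (2 * ?t n)) \<longlonglongrightarrow> 0"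
    by (simp add: Complex.DeMoivre)
  have "(\<lambda>n. 2 * (?t (Suc n) - ?t n - sqrt (F * real n))) \<longlonglongrightarrow> 0"
    by (rule tendsto_mult_right_zero[OF wkb_phase_increment[OF F]])
  then have "(\<lambda>n. 2 * ?t (Suc n) - (2 * ?t n + 2 * sqrt F * sqrt (real n))) \<longlonglongrightarrow> 0"
    by (simp add: real_sqrt_mult algebra_simps)
  then have 2: "(\<lambda>n. cis (2 * ?t (Suc n)) - cis (2 * ?t n + 2 * sqrt F * sqrt (real n))) \<longlonglongrightarrow> 0"
    by (rule tendsto_cis_diff_0)
  have 3: "(\<lambda>n. cis (2 * sqrt F * sqrt (real n)) * ((sgn (\<zeta> n))\<^sup>2 - cis (2 * ?t n))) \<longlonglongrightarrow> 0"
    by (rule tendsto_cis_mult_0[OF sq])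
  have "(\<lambda>n. ((sgn (\<zeta> (Suc n)))\<^sup>2 - cis (2 * ?t (Suc n))) + (cis (2 * ?t (Suc n)) - cis (2 * ?t n + 2 * sqrt F * sqrt (real n)))
      - cis (2 * sqrt F * sqrt (real n)) * ((sgn (\<zeta> n))\<^sup>2 - cis (2 * ?t n))) \<longlonglongrightarrow> 0 + 0 - 0"
    by (intro tendsto_diff tendsto_add 2 3 LIMSEQ_Suc[OF sq])
  moreover have "((sgn (\<zeta> (Suc n)))\<^sup>2 - cis (2 * ?t (Suc n))) + (cis (2 * ?t (Suc n)) - cis (2 * ?t n + 2 * sqrt F * sqrt (real n)))
      - cis (2 * sqrt F * sqrt (real n)) * ((sgn (\<zeta> n))\<^sup>2 - cis (2 * ?t n))
      = (sgn (\<zeta> (Suc n)))\<^sup>2 - (sgn (\<zeta> n))\<^sup>2 * cis (2 * sqrt F * sqrt (real n))" for n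
    by (simp add: right_diff_distrib cis_mult add.commute mult.commute)
  ultimately show "(\<lambda>n. (sgn (\<zeta> (Suc n)))\<^sup>2 - (sgn (\<zeta> n))\<^sup>2 * cis (2 * sqrt F * sqrt (real n))) \<longlonglongrightarrow> 0"
    by (simp only: add_0_right diff_zero)
qed

section \<open>Multiplicative form of the jump and the recursion for the phase\<close>

definition prufer_phase :: "(nat \<Rightarrow> complex) \<Rightarrow> complex \<Rightarrow> (nat \<Rightarrow> real) \<Rightarrow> nat \<Rightarrow> complex" where
  "prufer_phase \<zeta> b h n = (sgn (prufer_path \<zeta> b h n * \<zeta> n))\<^sup>2"

lemma norm_prufer_phase_le_1: "norm (prufer_phase \<zeta> b h n) \<le> 1"
  unfolding prufer_phase_def norm_power by (intro power_le_one norm_sgn_le_1) simp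

text \<open>\<open>Re w\<close> is half of \<open>w + cnj w\<close>; multiplied by
  \<open>cnj w\<close> this gives half of the squared modulus plus the square of
  \<open>cnj w\<close>, and the latter is the squared modulus times
  \<open>cnj ((sgn w)\<^sup>2)\<close>.\<close>

lemma complex_Re_eq_half_sgn:
  "of_real (Re w) * cnj w = of_real ((cmod w)\<^sup>2 / 2) * (1 + cnj ((sgn w)\<^sup>2))"
proof (cases "w = 0")
  case False
  define s where "s = sgn w"
  have w: "w = of_real (cmod w) * s" by (simp add: s_def sgn_eq False)
  have s: "s * cnj s = 1" using False by (simp add: s_def complex_norm_square[symmetric] norm_sgn)
  have "of_real (Re w) = (w + cnj w) / 2" by (simp add: complex_add_cnj)
  also have "\<dots> = of_real (cmod w) * (s + cnj s) / 2" by (subst (1 2) w) (simp add: algebra_simps)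
  finally have re: "of_real (Re w) = of_real (cmod w) * (s + cnj s) / 2" .
  have "of_real (Re w) * cnj w = of_real (cmod w) * (s + cnj s) / 2 * (of_real (cmod w) * cnj s)"
    unfolding re by (subst (2) w) simp
  also have "\<dots> = of_real ((cmod w)\<^sup>2 / 2) * (s * cnj s + (cnj s)\<^sup>2)"
    by (simp add: power2_eq_square algebra_simps)
  finally show ?thesis unfolding s by (simp add: s_def)
qed simp

text \<open>Apply \<open>complex_Re_eq_half_sgn\<close> to \<open>w = a * \<zeta> n\<close>, with
  \<open>a\<close> the current value of the path, and cancel \<open>cnj a\<close>: the additive jump
  becomes a factor that depends on \<open>a\<close> only through the phase \<open>z\<close>.\<close>

lemma prufer_path_factor:
  fixes \<zeta> :: "nat \<Rightarrow> complex" and h :: "nat \<Rightarrow> real" and b :: complex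
  assumes n: "n \<ge> 1"
  defines "U \<equiv> h n * (cmod (\<zeta> n))\<^sup>2 / 2" and "z \<equiv> prufer_phase \<zeta> b h n"
  shows "prufer_path \<zeta> b h (Suc n) = prufer_path \<zeta> b h n * (1 - \<i> * of_real U * (1 + cnj z))"
proof (cases "prufer_path \<zeta> b h n = 0")
  case True
  then show ?thesis by simp
next
  case False
  define a where "a = prufer_path \<zeta> b h n"
  have a: "a \<noteq> 0" using False by (simp add: a_def)
  have "of_real (Re (a * \<zeta> n)) * cnj (a * \<zeta> n) = of_real ((cmod a)\<^sup>2 * (cmod (\<zeta> n))\<^sup>2 / 2) * (1 + cnj z)"
    unfolding complex_Re_eq_half_sgn by (simp add: z_def prufer_phase_def a_def norm_mult power_mult_distrib)
  also have "of_real ((cmod a)\<^sup>2 * (cmod (\<zeta> n))\<^sup>2 / 2) = cnj a * (a * of_real ((cmod (\<zeta> n))\<^sup>2 / 2))"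
    by (simp add: complex_norm_square[symmetric] mult_ac flip: of_real_power)
  finally have "cnj a * (of_real (Re (a * \<zeta> n)) * cnj (\<zeta> n)) = cnj a * (a * of_real ((cmod (\<zeta> n))\<^sup>2 / 2) * (1 + cnj z))"
    by (simp add: mult_ac)
  then have "of_real (Re (a * \<zeta> n)) * cnj (\<zeta> n) = a * of_real ((cmod (\<zeta> n))\<^sup>2 / 2) * (1 + cnj z)"
    using mult_left_cancel[of "cnj a"] a by (metis complex_cnj_zero_iff)
  then have "\<i> * of_real (h n * Re (a * \<zeta> n)) * cnj (\<zeta> n) = a * (\<i> * of_real U * (1 + cnj z))"
    by (simp add: U_def mult_ac del: times_complex.sel)
  then show ?thesis using n by (simp add: a_def[symmetric] right_diff_distrib del: times_complex.sel)
qed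

text \<open>The factor has real part \<open>1 - U * Im z\<close> and imaginary part
  \<open>- U * (1 + Re z)\<close>; the square terms combine because \<open>z\<close> has modulus 1.
  A zero would force \<open>Re z = - 1\<close>, hence \<open>Im z = 0\<close>, against
  \<open>U * Im z = 1\<close>.\<close>

lemma norm_prufer_factor:
  assumes "z = 0 \<and> U = 0 \<or> norm z = 1"
  shows "(cmod (1 - \<i> * of_real U * (1 + cnj z)))\<^sup>2 = 1 + (- 2 * U * Im z + 2 * U\<^sup>2 * (1 + Re z))"
    and "1 - \<i> * of_real U * (1 + cnj z) \<noteq> 0"
proof -
  have "U\<^sup>2 * ((Re z)\<^sup>2 + (Im z)\<^sup>2) = U\<^sup>2" using assms by (auto simp: cmod_power2[symmetric])
  then show "(cmod (1 - \<i> * of_real U * (1 + cnj z)))\<^sup>2 = 1 + (- 2 * U * Im z + 2 * U\<^sup>2 * (1 + Re z))"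
    unfolding cmod_power2 by (simp add: power2_eq_square algebra_simps)
  show "1 - \<i> * of_real U * (1 + cnj z) \<noteq> 0"
  proof
    assume "1 - \<i> * of_real U * (1 + cnj z) = 0"
    then have 1: "U * Im z = 1" "U * (1 + Re z) = 0" by (auto simp: complex_eq_iff algebra_simps)
    then have "Re z = -1" by auto
    moreover have "norm z = 1" using 1 assms by auto
    then have "(Re z)\<^sup>2 + (Im z)\<^sup>2 = 1" using cmod_power2[of z] by simp
    ultimately show False using 1 by simp
  qed
qed

text \<open>\<open>sgn 0 = 0\<close> makes the phase 0 wherever \<open>\<zeta> n = 0\<close>, but
  there the jump strength vanishes as well, so both cases obey the same identities.\<close>

lemma prufer_phase_cases:
  assumes "prufer_path \<zeta> b h n \<noteq> 0"
  shows "prufer_phase \<zeta> b h n = 0 \<and> h n * (cmod (\<zeta> n))\<^sup>2 / 2 = 0 \<or> norm (prufer_phase \<zeta> b h n) = 1"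
  using assms by (auto simp: prufer_phase_def norm_power norm_sgn)

lemma prufer_path_nonzero:
  assumes "b \<noteq> 0"
  shows "prufer_path \<zeta> b h n \<noteq> 0"
proof (induction n)
  case (Suc n)
  show ?case
  proof (cases "n = 0")
    case False
    then show ?thesis
      using Suc norm_prufer_factor(2)[OF prufer_phase_cases[OF Suc]] prufer_path_factor[of n \<zeta> b h] by simp
  qed (use assms in simp)
qed (use assms in simp)

text \<open>The phase changes by the rotation of \<open>\<zeta>\<close> and by the squared direction
  of the jump factor. The latter tends to 1 with the jump strength, so the random part of the change
  is o(1).\<close>

lemma prufer_phase_rotation:
  fixes \<zeta> :: "nat \<Rightarrow> complex" and h :: "nat \<Rightarrow> real" and b :: complex
  assumes rot: "(\<lambda>n. (sgn (\<zeta> (Suc n)))\<^sup>2 - (sgn (\<zeta> n))\<^sup>2 * w n) \<longlonglongrightarrow> 0"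
    and U: "(\<lambda>n. h n * (cmod (\<zeta> n))\<^sup>2 / 2) \<longlonglongrightarrow> 0"
  shows "(\<lambda>n. prufer_phase \<zeta> b h (Suc n) - prufer_phase \<zeta> b h n * w n) \<longlonglongrightarrow> 0"
proof -
  let ?z = "prufer_phase \<zeta> b h" and ?a = "prufer_path \<zeta> b h" and ?U = "\<lambda>n. h n * (cmod (\<zeta> n))\<^sup>2 / 2"
  let ?v = "\<lambda>n. 1 - \<i> * of_real (?U n) * (1 + cnj (?z n))"
  let ?S = "\<lambda>n. (sgn (\<zeta> n))\<^sup>2"
  have "(\<lambda>n. \<i> * of_real (?U n) * (1 + cnj (?z n))) \<longlonglongrightarrow> 0"
  proof (rule Lim_null_comparison)
    show "eventually (\<lambda>n. norm (\<i> * of_real (?U n) * (1 + cnj (?z n))) \<le> 2 * \<bar>?U n\<bar>) sequentially"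
    proof (rule always_eventually, rule allI)
      fix n
      have "norm (1 + cnj (?z n)) \<le> 2"
        using norm_triangle_ineq[of 1 "cnj (?z n)"] norm_prufer_phase_le_1[of \<zeta> b h n] by simp
      then have "\<bar>?U n\<bar> * norm (1 + cnj (?z n)) \<le> \<bar>?U n\<bar> * 2" by (intro mult_left_mono) auto
      then show "norm (\<i> * of_real (?U n) * (1 + cnj (?z n))) \<le> 2 * \<bar>?U n\<bar>"
        by (simp only: norm_mult norm_of_real norm_ii mult_1 mult.commute)
    qed
    show "(\<lambda>n. 2 * \<bar>?U n\<bar>) \<longlonglongrightarrow> 0"
      by (rule tendsto_mult_right_zero[OF tendsto_rabs_zero[OF U]])
  qed
  from tendsto_diff[OF tendsto_const[of 1] this] have "?v \<longlonglongrightarrow> 1" by (simp only: diff_zero)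
  from tendsto_sgn[OF this] have "(\<lambda>n. sgn (?v n)) \<longlonglongrightarrow> 1" by (simp only: sgn_one one_neq_zero simp_thms)
  from tendsto_diff[OF tendsto_power[OF this, of 2] tendsto_const[of 1]]
  have v: "(\<lambda>n. (sgn (?v n))\<^sup>2 - 1) \<longlonglongrightarrow> 0" by (simp only: power_one diff_self)
  show ?thesis
  proof (rule Lim_null_comparison)
    show "eventually (\<lambda>n. norm (?z (Suc n) - ?z n * w n) \<le> norm ((sgn (?v n))\<^sup>2 - 1) + norm (?S (Suc n) - ?S n * w n)) sequentially"
      using eventually_ge_at_top[of 1]
    proof eventually_elim
      case (elim n)
      let ?s = "(sgn (?a n))\<^sup>2" and ?t = "(sgn (?v n))\<^sup>2 - 1" and ?d = "?S (Suc n) - ?S n * w n"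
      have gen: "s * V * S' - s * S0 * w0 = s * ((V - 1) * S' + (S' - S0 * w0))" for s V S' S0 w0 :: complex
        by (simp add: algebra_simps)
      have z: "?z (Suc n) = ?s * (sgn (?v n))\<^sup>2 * ?S (Suc n)"
        unfolding prufer_phase_def[of _ _ _ "Suc n"] prufer_path_factor[OF elim]
        by (simp only: sgn_mult power_mult_distrib)
      have zn: "?z n = ?s * ?S n"
        unfolding prufer_phase_def by (simp only: sgn_mult power_mult_distrib)
      have "?z (Suc n) - ?z n * w n = ?s * (?t * ?S (Suc n) + ?d)"
        using gen[of ?s "(sgn (?v n))\<^sup>2" "?S (Suc n)" "?S n" "w n"] by (simp only: z zn)
      moreover have "norm (?s * y) \<le> norm y" for y
        unfolding norm_mult norm_power
        by (intro mult_left_le_one_le power_le_one norm_sgn_le_1 norm_ge_zero zero_le_power)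
      ultimately have "norm (?z (Suc n) - ?z n * w n) \<le> norm (?t * ?S (Suc n) + ?d)" by (simp only:)
      also have "\<dots> \<le> norm ?t * norm (?S (Suc n)) + norm ?d"
        using norm_triangle_ineq[of "?t * ?S (Suc n)" ?d] by (simp only: norm_mult)
      also have "norm ?t * norm (?S (Suc n)) \<le> norm ?t * 1"
        by (intro mult_left_mono) (auto simp: norm_power intro!: power_le_one norm_sgn_le_1)
      finally show ?case by simp
    qed
    show "(\<lambda>n. norm ((sgn (?v n))\<^sup>2 - 1) + norm (?S (Suc n) - ?S n * w n)) \<longlonglongrightarrow> 0"
      by (rule tendsto_add_zero[OF tendsto_norm_zero[OF v] tendsto_norm_zero[OF rot]])
  qed
qed

text \<open>Division by zero gives the quotient the value 0 at the origin, which is also its limit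
  there. It is thus continuous at 0, and terms with \<open>x n = 0\<close> do no harm.\<close>

lemma ln_second_order_remainder:
  fixes x :: "nat \<Rightarrow> real"
  assumes "x \<longlonglongrightarrow> 0"
  shows "(\<lambda>n. (ln (1 + x n) - x n + (x n)\<^sup>2 / 2) / (x n)\<^sup>2) \<longlonglongrightarrow> 0"
proof -
  let ?f = "\<lambda>x::real. (ln (1 + x) - x + x\<^sup>2 / 2) / x\<^sup>2"
  have "(?f \<longlongrightarrow> 0) (at 0)" by real_asymp
  then have "isCont ?f 0" by (simp add: isCont_def)
  from isCont_tendsto_compose[OF this assms] show ?thesis by simp
qed

text \<open>\<open>1 + x n\<close> is the squared modulus of the factor \<open>1 - \<i> * U n * (1 + cnj (z n))\<close>.\<close>

lemma log_growth_remainder: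
  fixes U :: "nat \<Rightarrow> real" and z :: "nat \<Rightarrow> complex"
  assumes U: "U \<longlonglongrightarrow> 0" and z: "\<And>n. z n = 0 \<and> U n = 0 \<or> norm (z n) = 1"
  defines "x \<equiv> \<lambda>n. - 2 * U n * Im (z n) + 2 * (U n)\<^sup>2 * (1 + Re (z n))"
  defines "e \<equiv> \<lambda>n. ln (1 + x n) - (- 2 * U n * Im (z n) + (U n)\<^sup>2 * (1 + 2 * Re (z n) + Re ((z n)\<^sup>2)))"
  shows "(\<lambda>n. e n / (U n)\<^sup>2) \<longlonglongrightarrow> 0" and "\<And>n. (U n)\<^sup>2 * (e n / (U n)\<^sup>2) = e n"
proof -
  \<comment> \<open>Guards the quotient by \<open>(U n)\<^sup>2\<close>: where \<open>U n\<close> is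
    0 the remainder is 0 too, so multiplying back recovers \<open>e n\<close>.\<close>
  have e0: "e n = 0" if "U n = 0" for n using that by (simp add: e_def x_def)
  then show "(U n)\<^sup>2 * (e n / (U n)\<^sup>2) = e n" for n by (cases "U n = 0") auto
  have z1: "\<bar>Re (z n)\<bar> \<le> 1" "\<bar>Im (z n)\<bar> \<le> 1" for n
    using z[of n] abs_Re_le_cmod[of "z n"] abs_Im_le_cmod[of "z n"] by auto
  define y where "y n = - 2 * Im (z n) + 2 * U n * (1 + Re (z n))" for n
  have xy: "x n = U n * y n" for n by (simp add: x_def y_def power2_eq_square algebra_simps)
  have ybound: "\<bar>y n\<bar> \<le> 2 + 4 * \<bar>U n\<bar>" for n
  proof -
    have "\<bar>U n\<bar> * \<bar>1 + Re (z n)\<bar> \<le> \<bar>U n\<bar> * 2" using z1(1)[of n] by (intro mult_left_mono) auto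
    then show ?thesis
      unfolding y_def using z1(2)[of n] abs_triangle_ineq[of "- 2 * Im (z n)" "2 * U n * (1 + Re (z n))"]
      by (simp add: abs_mult)
  qed
  have x0: "x \<longlonglongrightarrow> 0"
  proof (rule Lim_null_comparison)
    show "eventually (\<lambda>n. norm (x n) \<le> \<bar>U n\<bar> * (2 + 4 * \<bar>U n\<bar>)) sequentially"
      unfolding xy real_norm_def abs_mult by (intro always_eventually allI mult_left_mono ybound) auto
    show "(\<lambda>n. \<bar>U n\<bar> * (2 + 4 * \<bar>U n\<bar>)) \<longlonglongrightarrow> 0"
      using tendsto_mult[OF tendsto_rabs_zero[OF U] tendsto_add[OF tendsto_const[of 2] tendsto_mult[OF tendsto_const[of 4] tendsto_rabs_zero[OF U]]]]
      by simp
  qed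
  let ?\<theta> = "\<lambda>n. (ln (1 + x n) - x n + (x n)\<^sup>2 / 2) / (x n)\<^sup>2"
  note \<theta> = ln_second_order_remainder[OF x0]
  \<comment> \<open>Expansion of \<open>x - x\<^sup>2 / 2\<close> in powers of \<open>U\<close>. For
    \<open>z\<close> of modulus 1, \<open>2 * (Im z)\<^sup>2 = 1 - Re (z\<^sup>2)\<close>, which
    produces the claimed second-order coefficient; the rest is of third and fourth order in
    \<open>U\<close>.\<close>
  have main: "e n = (x n)\<^sup>2 * ?\<theta> n + (U n)\<^sup>2 * (U n * (4 * Im (z n) * (1 + Re (z n)) - 2 * U n * (1 + Re (z n))\<^sup>2))" for n
  proof -
    have "(U n)\<^sup>2 * ((Re (z n))\<^sup>2 + (Im (z n))\<^sup>2) = (U n)\<^sup>2" using z[of n] by (auto simp: cmod_power2[symmetric])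
    moreover have "Re ((z n)\<^sup>2) = (Re (z n))\<^sup>2 - (Im (z n))\<^sup>2" by (simp add: power2_eq_square)
    moreover have "(x n)\<^sup>2 * ?\<theta> n = ln (1 + x n) - x n + (x n)\<^sup>2 / 2" by (cases "x n = 0") auto
    ultimately show ?thesis unfolding e_def
      by (simp only: x_def) algebra
  qed
  show "(\<lambda>n. e n / (U n)\<^sup>2) \<longlonglongrightarrow> 0"
  proof (rule Lim_null_comparison)
    show "eventually (\<lambda>n. norm (e n / (U n)\<^sup>2) \<le> (2 + 4 * \<bar>U n\<bar>)\<^sup>2 * \<bar>?\<theta> n\<bar> + \<bar>U n\<bar> * (8 + 8 * \<bar>U n\<bar>)) sequentially"
    proof (rule always_eventually, rule allI)
      fix n
      let ?r = "4 * Im (z n) * (1 + Re (z n)) - 2 * U n * (1 + Re (z n))\<^sup>2"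
      have "\<bar>?r\<bar> \<le> 8 + 8 * \<bar>U n\<bar>"
      proof -
        have 1: "\<bar>1 + Re (z n)\<bar> \<le> 2" using z1(1)[of n] by linarith
        have "\<bar>Im (z n)\<bar> * \<bar>1 + Re (z n)\<bar> \<le> 1 * 2" by (intro mult_mono z1 1) auto
        moreover have "\<bar>U n\<bar> * (\<bar>1 + Re (z n)\<bar>)\<^sup>2 \<le> \<bar>U n\<bar> * 2\<^sup>2" by (intro mult_left_mono power_mono 1) auto
        moreover have "\<bar>?r\<bar> \<le> 4 * (\<bar>Im (z n)\<bar> * \<bar>1 + Re (z n)\<bar>) + 2 * (\<bar>U n\<bar> * (\<bar>1 + Re (z n)\<bar>)\<^sup>2)"
          using abs_triangle_ineq4[of "4 * Im (z n) * (1 + Re (z n))" "2 * U n * (1 + Re (z n))\<^sup>2"]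
          by (simp add: abs_mult)
        ultimately show ?thesis by simp
      qed
      then have "\<bar>U n * ?r\<bar> \<le> \<bar>U n\<bar> * (8 + 8 * \<bar>U n\<bar>)" unfolding abs_mult by (intro mult_left_mono) auto
      moreover have "\<bar>(y n)\<^sup>2 * ?\<theta> n\<bar> \<le> (2 + 4 * \<bar>U n\<bar>)\<^sup>2 * \<bar>?\<theta> n\<bar>"
        unfolding abs_mult abs_power2 using power_mono[OF ybound[of n], of 2] by (intro mult_right_mono) auto
      moreover have "\<bar>e n / (U n)\<^sup>2\<bar> \<le> \<bar>(y n)\<^sup>2 * ?\<theta> n + U n * ?r\<bar>"
      proof (cases "U n = 0")
        case False
        have "e n = (U n)\<^sup>2 * ((y n)\<^sup>2 * ?\<theta> n + U n * ?r)"
          unfolding main[of n] by (subst (1) xy) (simp only: power_mult_distrib distrib_left mult.assoc)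
        then show ?thesis using False by simp
      qed (simp add: e0)
      ultimately show "norm (e n / (U n)\<^sup>2) \<le> (2 + 4 * \<bar>U n\<bar>)\<^sup>2 * \<bar>?\<theta> n\<bar> + \<bar>U n\<bar> * (8 + 8 * \<bar>U n\<bar>)"
        using abs_triangle_ineq[of "(y n)\<^sup>2 * ?\<theta> n" "U n * ?r"] unfolding real_norm_def by linarith
    qed
    have "(\<lambda>n. (2 + 4 * \<bar>U n\<bar>)\<^sup>2 * \<bar>?\<theta> n\<bar> + \<bar>U n\<bar> * (8 + 8 * \<bar>U n\<bar>)) \<longlonglongrightarrow> (2 + 4 * 0)\<^sup>2 * 0 + 0 * (8 + 8 * 0)"
      by (intro tendsto_add tendsto_mult tendsto_power tendsto_const tendsto_rabs_zero \<theta> U)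
    then show "(\<lambda>n. (2 + 4 * \<bar>U n\<bar>)\<^sup>2 * \<bar>?\<theta> n\<bar> + \<bar>U n\<bar> * (8 + 8 * \<bar>U n\<bar>)) \<longlonglongrightarrow> 0"
      by (simp only: mult_zero_right mult_zero_left add_0_right)
  qed
qed


text \<open>The pathwise half of the argument: randomness appears only through the hypotheses
  \<open>U0\<close> and \<open>m1\<close> to \<open>m4\<close>, to be verified almost surely.
  \<open>L\<close> stands for the variance of the couplings; the factor 1/2 arises because the
  expansion concerns the squared modulus.\<close>

lemma prufer_path_growth:
  fixes \<zeta> :: "nat \<Rightarrow> complex" and h :: "nat \<Rightarrow> real" and b :: complex
  defines "z \<equiv> prufer_phase \<zeta> b h" and "c \<equiv> \<lambda>n. (cmod (\<zeta> n))\<^sup>2 / 2"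
  assumes b: "b \<noteq> 0" and s: "s \<noteq> 0"
    and modulus: "(\<lambda>n. real n * (c n)\<^sup>2) \<longlonglongrightarrow> \<kappa>"
    and rot: "(\<lambda>n. (sgn (\<zeta> (Suc n)))\<^sup>2 - (sgn (\<zeta> n))\<^sup>2 * cis (s * sqrt (real n))) \<longlonglongrightarrow> 0"
    and U0: "(\<lambda>n. c n * h n) \<longlonglongrightarrow> 0"
    and m1: "(\<lambda>n. (\<Sum>j=1..n. Im (z j) * (c j * h j)) / ln (real n)) \<longlonglongrightarrow> 0"
    and m2: "(\<lambda>n. (\<Sum>j=1..n. (c j)\<^sup>2 * ((h j)\<^sup>2 - L)) / ln (real n)) \<longlonglongrightarrow> 0"
    and m3: "(\<lambda>n. (\<Sum>j=1..n. Re (z j) * ((c j)\<^sup>2 * ((h j)\<^sup>2 - L))) / ln (real n)) \<longlonglongrightarrow> 0"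
    and m4: "(\<lambda>n. (\<Sum>j=1..n. Re ((z j)\<^sup>2) * ((c j)\<^sup>2 * ((h j)\<^sup>2 - L))) / ln (real n)) \<longlonglongrightarrow> 0"
  shows "(\<lambda>n. ln (cmod (prufer_path \<zeta> b h n)) / ln (real n)) \<longlonglongrightarrow> L * \<kappa> / 2"
proof -
  define U where "U n = h n * (cmod (\<zeta> n))\<^sup>2 / 2" for n
  have Uc: "c n * h n = U n" for n by (simp add: U_def c_def)
  have U: "U \<longlonglongrightarrow> 0" using U0 by (simp only: Uc)
  have z1: "norm (z n) \<le> 1" for n unfolding z_def by (rule norm_prufer_phase_le_1)
  have nz: "prufer_path \<zeta> b h n \<noteq> 0" for n by (rule prufer_path_nonzero[OF b])
  have cases: "z n = 0 \<and> U n = 0 \<or> norm (z n) = 1" for n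
    unfolding z_def U_def by (rule prufer_phase_cases[OF nz])
  have zrot: "(\<lambda>n. z (Suc n) - z n * cis (s * sqrt (real n))) \<longlonglongrightarrow> 0"
    unfolding z_def by (rule prufer_phase_rotation[OF rot]) (rule U[unfolded U_def[abs_def]])
  have lz: "log_null z" by (rule log_null_slow_rotation[OF s z1 zrot])
  \<comment> \<open>Squaring keeps the recursion and doubles the speed, so the same averaging lemma
    applies with \<open>2 * s\<close>.\<close>
  have lz2: "log_null (\<lambda>n. (z n)\<^sup>2)"
  proof (rule log_null_slow_rotation)
    show "2 * s \<noteq> 0" using s by simp
    show "norm ((z j)\<^sup>2) \<le> 1" for j unfolding norm_power by (intro power_le_one z1) simp
    have "norm (z n * cis (s * sqrt (real n))) \<le> 1" for n using z1 by (simp add: norm_mult)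
    from tendsto_square_diff_0[OF zrot z1 this]
    show "(\<lambda>n. (z (Suc n))\<^sup>2 - (z n)\<^sup>2 * cis (2 * s * sqrt (real n))) \<longlonglongrightarrow> 0"
      by (simp add: power_mult_distrib Complex.DeMoivre mult.assoc)
  qed
  \<comment> \<open>The weight \<open>(c j)\<^sup>2\<close> is \<open>\<kappa> / j\<close> up to o(1
    / j), so a vanishing logarithmic mean carries over to it.\<close>
  have osc: "(\<lambda>n. (\<Sum>j=1..n. (c j)\<^sup>2 * Re (y j)) / ln (real n)) \<longlonglongrightarrow> 0"
    if y: "log_null y" "\<And>n. norm (y n) \<le> 1" for y
  proof -
    have "(\<lambda>n. of_real \<kappa> * y n - of_real (real n * (c n)\<^sup>2) * y n) \<longlonglongrightarrow> 0"
    proof (rule Lim_null_comparison)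
      show "eventually (\<lambda>n. norm (of_real \<kappa> * y n - of_real (real n * (c n)\<^sup>2) * y n) \<le> \<bar>real n * (c n)\<^sup>2 - \<kappa>\<bar>) sequentially"
      proof (rule always_eventually, rule allI)
        fix n
        have eq: "of_real \<kappa> * y n - of_real (real n * (c n)\<^sup>2) * y n = of_real (\<kappa> - real n * (c n)\<^sup>2) * y n"
          by (simp add: algebra_simps)
        show "norm (of_real \<kappa> * y n - of_real (real n * (c n)\<^sup>2) * y n) \<le> \<bar>real n * (c n)\<^sup>2 - \<kappa>\<bar>"
          unfolding eq norm_mult norm_of_real abs_minus_commute[of \<kappa>] by (rule mult_left_le[OF y(2) abs_ge_zero])
      qed
      show "(\<lambda>n. \<bar>real n * (c n)\<^sup>2 - \<kappa>\<bar>) \<longlonglongrightarrow> 0" by (rule tendsto_rabs_zero[OF LIM_zero[OF modulus]])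
    qed
    from log_null_close[OF log_null_cmult[OF y(1)] this]
    have "(\<lambda>n. (\<Sum>j=1..n. of_real (real j * (c j)\<^sup>2) * y j / of_real (real j)) / of_real (ln (real n))) \<longlonglongrightarrow> 0"
      by (simp add: log_null_def)
    from tendsto_Re[OF this]
    have "(\<lambda>n. (\<Sum>j=1..n. Re (of_real (real j * (c j)\<^sup>2) * y j / of_real (real j))) / ln (real n)) \<longlonglongrightarrow> 0"
      by (simp only: Re_divide_of_real Re_sum zero_complex.sel)
    moreover have "(\<Sum>j=1..n. Re (of_real (real j * (c j)\<^sup>2) * y j / of_real (real j))) = (\<Sum>j=1..n. (c j)\<^sup>2 * Re (y j))" for n
      by (rule sum.cong) auto
    ultimately show ?thesis by (simp only:)
  qed
  have csum: "(\<lambda>n. (\<Sum>j=1..n. (c j)\<^sup>2) / ln (real n)) \<longlonglongrightarrow> \<kappa>"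
  proof -
    have "(\<lambda>n. of_real (real n * (c n)\<^sup>2 - \<kappa>) :: complex) \<longlonglongrightarrow> of_real 0"
      by (intro tendsto_of_real LIM_zero modulus)
    then have "log_null (\<lambda>n. of_real (real n * (c n)\<^sup>2 - \<kappa>))" by (intro log_null_tendsto_0) simp
    from tendsto_Re[OF this[unfolded log_null_def]]
    have "(\<lambda>n. (\<Sum>j=1..n. (real j * (c j)\<^sup>2 - \<kappa>) / real j) / ln (real n)) \<longlonglongrightarrow> 0"
      by (simp only: Re_divide_of_real Re_sum zero_complex.sel Re_complex_of_real)
    from tendsto_add[OF this tendsto_mult[OF tendsto_const[of \<kappa>] harmonic_sum_over_ln_tendsto_1]]
    have "(\<lambda>n. (\<Sum>j=1..n. (real j * (c j)\<^sup>2 - \<kappa>) / real j) / ln (real n) + \<kappa> * ((\<Sum>j=1..n. 1 / real j) / ln (real n))) \<longlonglongrightarrow> \<kappa>"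
      by simp
    moreover have "(\<Sum>j=1..n. (real j * (c j)\<^sup>2 - \<kappa>) / real j) / ln (real n) + \<kappa> * ((\<Sum>j=1..n. 1 / real j) / ln (real n))
      = (\<Sum>j=1..n. (c j)\<^sup>2) / ln (real n)" for n
    proof -
      have "(\<Sum>j=1..n. (c j)\<^sup>2) = (\<Sum>j=1..n. (real j * (c j)\<^sup>2 - \<kappa>) / real j + \<kappa> * (1 / real j))"
        by (rule sum.cong) (auto simp: field_simps)
      then show ?thesis by (simp only: sum.distrib sum_distrib_left add_divide_distrib times_divide_eq_right)
    qed
    ultimately show ?thesis by (simp only:)
  qed
  define e where "e n = ln (1 + (- 2 * U n * Im (z n) + 2 * (U n)\<^sup>2 * (1 + Re (z n))))
     - (- 2 * U n * Im (z n) + (U n)\<^sup>2 * (1 + 2 * Re (z n) + Re ((z n)\<^sup>2)))" for n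
  note rem = log_growth_remainder[of U z, OF U cases, folded e_def]
  \<comment> \<open>Splits the square into a centred part, covered by \<open>m2\<close> to
    \<open>m4\<close>, and its mean \<open>L * (c j)\<^sup>2\<close>, which multiplies deterministic
    weights.\<close>
  have U2: "(U j)\<^sup>2 = (c j)\<^sup>2 * ((h j)\<^sup>2 - L) + L * (c j)\<^sup>2" for j
    unfolding Uc[symmetric] by (simp add: power_mult_distrib algebra_simps)
  have Usum: "(\<lambda>n. (\<Sum>j=1..n. (U j)\<^sup>2) / ln (real n)) \<longlonglongrightarrow> L * \<kappa>"
  proof -
    have "(\<lambda>n. (\<Sum>j=1..n. (c j)\<^sup>2 * ((h j)\<^sup>2 - L)) / ln (real n) + L * ((\<Sum>j=1..n. (c j)\<^sup>2) / ln (real n))) \<longlonglongrightarrow> 0 + L * \<kappa>"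
      by (intro tendsto_add tendsto_mult tendsto_const m2 csum)
    then show ?thesis
      unfolding U2 by (simp only: sum.distrib sum_distrib_left add_divide_distrib times_divide_eq_right add_0_left)
  qed
  have esum: "(\<lambda>n. (\<Sum>j=1..n. e j) / ln (real n)) \<longlonglongrightarrow> 0"
  proof -
    have "(\<lambda>n. (\<Sum>j=1..n. (U j)\<^sup>2 *\<^sub>R (e j / (U j)\<^sup>2)) /\<^sub>R ln (real n)) \<longlonglongrightarrow> 0"
    proof (rule weighted_null_sum[OF _ rem(1) ln_at_top_seq])
      show "eventually (\<lambda>n. (\<Sum>j=1..n. (U j)\<^sup>2) / ln (real n) \<le> L * \<kappa> + 1) sequentially"
        using order_tendstoD(2)[OF Usum, of "L * \<kappa> + 1"] by (auto elim: eventually_mono)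
    qed simp
    then show ?thesis unfolding real_scaleR_def rem(2) by (simp only: divide_inverse mult.commute)
  qed
  define r where "r n = 2 * ln (cmod (prufer_path \<zeta> b h n))" for n
  \<comment> \<open>Each summand has a known mean: \<open>esum\<close> for \<open>e\<close>,
    \<open>m1\<close>, \<open>m3\<close> and \<open>m4\<close> for the centred terms,
    \<open>osc\<close> for those with a factor \<open>L\<close>. Only the term
    \<open>(U n)\<^sup>2\<close> contributes to the limit.\<close>
  have step: "r (Suc n) = r n + (e n - 2 * (Im (z n) * (c n * h n)) + (U n)\<^sup>2
      + 2 * (Re (z n) * ((c n)\<^sup>2 * ((h n)\<^sup>2 - L))) + 2 * L * ((c n)\<^sup>2 * Re (z n))
      + Re ((z n)\<^sup>2) * ((c n)\<^sup>2 * ((h n)\<^sup>2 - L)) + L * ((c n)\<^sup>2 * Re ((z n)\<^sup>2)))" if n: "n \<ge> 1" for n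
  proof -
    let ?v = "1 - \<i> * of_real (U n) * (1 + cnj (z n))"
    have "prufer_path \<zeta> b h (Suc n) = prufer_path \<zeta> b h n * ?v"
      using prufer_path_factor[OF n, of \<zeta> b h] unfolding U_def z_def .
    then have "r (Suc n) = r n + 2 * ln (cmod ?v)"
      using nz[of n] norm_prufer_factor(2)[OF cases] by (simp add: r_def norm_mult ln_mult)
    also have "2 * ln (cmod ?v) = ln ((cmod ?v)\<^sup>2)"
      using norm_prufer_factor(2)[OF cases] by (simp add: ln_realpow)
    also have "\<dots> = e n + (- 2 * U n * Im (z n) + (U n)\<^sup>2 * (1 + 2 * Re (z n) + Re ((z n)\<^sup>2)))"
      unfolding norm_prufer_factor(1)[OF cases] e_def by simp
    also have "\<dots> = e n - 2 * (Im (z n) * (c n * h n)) + (U n)\<^sup>2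
      + 2 * (Re (z n) * (U n)\<^sup>2) + Re ((z n)\<^sup>2) * (U n)\<^sup>2"
      unfolding Uc by (simp add: algebra_simps)
    also have "2 * (Re (z n) * (U n)\<^sup>2) = 2 * (Re (z n) * ((c n)\<^sup>2 * ((h n)\<^sup>2 - L))) + 2 * L * ((c n)\<^sup>2 * Re (z n))"
      unfolding U2 by (simp add: algebra_simps)
    also have "Re ((z n)\<^sup>2) * (U n)\<^sup>2 = Re ((z n)\<^sup>2) * ((c n)\<^sup>2 * ((h n)\<^sup>2 - L)) + L * ((c n)\<^sup>2 * Re ((z n)\<^sup>2))"
      unfolding U2 by (simp add: algebra_simps)
    finally show ?thesis by (simp only: add.assoc)
  qed
  have rsum: "r (Suc n) = r 1 + ((\<Sum>j=1..n. e j) - 2 * (\<Sum>j=1..n. Im (z j) * (c j * h j)) + (\<Sum>j=1..n. (U j)\<^sup>2)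
      + 2 * (\<Sum>j=1..n. Re (z j) * ((c j)\<^sup>2 * ((h j)\<^sup>2 - L))) + 2 * L * (\<Sum>j=1..n. (c j)\<^sup>2 * Re (z j))
      + (\<Sum>j=1..n. Re ((z j)\<^sup>2) * ((c j)\<^sup>2 * ((h j)\<^sup>2 - L))) + L * (\<Sum>j=1..n. (c j)\<^sup>2 * Re ((z j)\<^sup>2)))" for n
  proof (induction n)
    case (Suc n)
    show ?case unfolding step[of "Suc n", simplified] Suc by (simp add: distrib_left)
  qed simp
  have lz2': "norm ((z n)\<^sup>2) \<le> 1" for n unfolding norm_power by (intro power_le_one z1) simp
  have "(\<lambda>n. r 1 / ln (real n) + ((\<Sum>j=1..n. e j) / ln (real n) - 2 * ((\<Sum>j=1..n. Im (z j) * (c j * h j)) / ln (real n)) + (\<Sum>j=1..n. (U j)\<^sup>2) / ln (real n)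
      + 2 * ((\<Sum>j=1..n. Re (z j) * ((c j)\<^sup>2 * ((h j)\<^sup>2 - L))) / ln (real n)) + 2 * L * ((\<Sum>j=1..n. (c j)\<^sup>2 * Re (z j)) / ln (real n))
      + (\<Sum>j=1..n. Re ((z j)\<^sup>2) * ((c j)\<^sup>2 * ((h j)\<^sup>2 - L))) / ln (real n) + L * ((\<Sum>j=1..n. (c j)\<^sup>2 * Re ((z j)\<^sup>2)) / ln (real n))))
    \<longlonglongrightarrow> 0 + (0 - 2 * 0 + L * \<kappa> + 2 * 0 + 2 * L * 0 + 0 + L * 0)"
    by (intro tendsto_add tendsto_diff tendsto_mult[OF tendsto_const] esum m1 Usum m3 m4 osc lz lz2 z1 lz2'
      real_tendsto_divide_at_top[OF tendsto_const ln_at_top_seq])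
  then have lim: "(\<lambda>n. r (Suc n) / ln (real n)) \<longlonglongrightarrow> L * \<kappa>"
    unfolding rsum by (simp add: add_divide_distrib diff_divide_distrib)
  \<comment> \<open>Sums up to \<open>n\<close> describe the radius at \<open>n + 1\<close>; the
    shift does not affect the logarithm asymptotically.\<close>
  have "(\<lambda>n. ln (real n) / ln (real (Suc n))) \<longlonglongrightarrow> 1" by real_asymp
  from tendsto_mult[OF lim this]
  have "(\<lambda>n. r (Suc n) / ln (real n) * (ln (real n) / ln (real (Suc n)))) \<longlonglongrightarrow> L * \<kappa>" by simp
  moreover have "eventually (\<lambda>n. r (Suc n) / ln (real n) * (ln (real n) / ln (real (Suc n))) = r (Suc n) / ln (real (Suc n))) sequentially"
    using eventually_gt_at_top[of 1] by eventually_elim simp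
  ultimately have "(\<lambda>n. r (Suc n) / ln (real (Suc n))) \<longlonglongrightarrow> L * \<kappa>" by (rule Lim_transform_eventually)
  then have "(\<lambda>n. r n / ln (real n)) \<longlonglongrightarrow> L * \<kappa>" by (rule LIMSEQ_imp_Suc)
  from tendsto_divide[OF this tendsto_const[of 2]] show ?thesis by (simp add: r_def)
qed

section \<open>Predictability, moment bounds and the almost sure limit\<close>

lemma sum_inverse_le_ln:
  assumes "1 \<le> n"
  shows "(\<Sum>j=1..n. 1 / real j) \<le> 1 + ln (real n)"
  using assms
proof (induction n rule: dec_induct)
  case (step n)
  have "ln (real n / real (Suc n)) \<le> real n / real (Suc n) - 1"
    using step by (intro ln_le_minus_one) auto
  then have "1 / real (Suc n) \<le> ln (real (Suc n)) - ln (real n)"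
    using step by (simp add: ln_div field_simps)
  then show ?case using step by simp
qed simp

text \<open>The value at \<open>n\<close> uses the couplings 1 to \<open>n - 1\<close> only, since
  the recursion ignores index 0; this is the generating family of \<open>past M g n\<close>.\<close>

lemma prufer_path_predictable:
  "(\<lambda>\<omega>. prufer_path \<zeta> b (\<lambda>n. g n \<omega>) n) \<in> borel_measurable (past M g n)"
proof (induction n)
  case (Suc n)
  have [measurable]: "(\<lambda>\<omega>. prufer_path \<zeta> b (\<lambda>n. g n \<omega>) n) \<in> borel_measurable (past M g (Suc n))"
    by (rule measurable_past_mono[OF Suc]) simp
  show ?case
  proof (cases "n = 0")
    case False
    then have [measurable]: "g n \<in> borel_measurable (past M g (Suc n))" by (intro measurable_past) auto
    have [measurable]: "Re \<in> borel_measurable borel" by (intro borel_measurable_continuous_onI continuous_intros)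
    show ?thesis using False by simp
  qed simp
qed simp

lemma prufer_phase_predictable:
  assumes "continuous_on UNIV f"
  shows "(\<lambda>\<omega>. f (prufer_phase \<zeta> b (\<lambda>n. g n \<omega>) n)) \<in> borel_measurable (past M g n)"
proof -
  have [measurable]: "f \<in> borel_measurable borel" using assms by (rule borel_measurable_continuous_onI)
  note [measurable] = prufer_path_predictable
  show ?thesis unfolding prufer_phase_def sgn_eq by measurable
qed

text \<open>Finiteness of the extended real series forces every fourth moment to be finite, so the
  series becomes one of real expectations with bounded partial sums.\<close>

lemma (in prob_space) weighted_fourth_moment_sum_bounded:
  fixes g :: "nat \<Rightarrow> 'a \<Rightarrow> real"
  assumes g: "\<And>n. 1 \<le> n \<Longrightarrow> g n \<in> borel_measurable M"
    and fin: "(\<Sum>n. (\<integral>\<^sup>+\<omega>. ennreal ((g (Suc n) \<omega>) ^ 4) \<partial>M) / ennreal ((real (Suc n)) ^ 2)) < \<infinity>"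
  obtains S where "S \<ge> 0" and "\<And>n. 1 \<le> n \<Longrightarrow> integrable M (\<lambda>\<omega>. (g n \<omega>) ^ 4)"
    and "\<And>n. (\<Sum>j=1..n. expectation (\<lambda>\<omega>. (g j \<omega>) ^ 4) / (real j)\<^sup>2) \<le> S"
proof -
  let ?t = "\<lambda>n. (\<integral>\<^sup>+\<omega>. ennreal ((g (Suc n) \<omega>) ^ 4) \<partial>M) / ennreal ((real (Suc n)) ^ 2)"
  have int: "integrable M (\<lambda>\<omega>. (g (Suc n) \<omega>) ^ 4)" for n
  proof (rule integrableI_nonneg)
    show "(\<lambda>\<omega>. (g (Suc n) \<omega>) ^ 4) \<in> borel_measurable M" using g[of "Suc n"] by simp
    have "?t n \<le> (\<Sum>n. ?t n)" using sum_le_suminf[of ?t "{n}"] by simp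
    then have "?t n < \<infinity>" using fin by (rule le_less_trans)
    then show "(\<integral>\<^sup>+\<omega>. ennreal ((g (Suc n) \<omega>) ^ 4) \<partial>M) < \<infinity>"
      by (auto simp: ennreal_divide_eq_top_iff less_top[symmetric])
  qed simp
  have t: "?t n = ennreal (expectation (\<lambda>\<omega>. (g (Suc n) \<omega>) ^ 4) / (real (Suc n))\<^sup>2)" for n
    by (subst nn_integral_eq_integral[OF int]) (auto simp: divide_ennreal simp del: of_nat_Suc)
  define S where "S = enn2real (\<Sum>n. ?t n)"
  have S: "ennreal S = (\<Sum>n. ?t n)" using fin by (simp add: S_def)
  show thesis
  proof (rule that[of S])
    show "S \<ge> 0" by (simp add: S_def)
    show "integrable M (\<lambda>\<omega>. (g n \<omega>) ^ 4)" if "1 \<le> n" for n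
      using int[of "n - 1"] that by simp
    show "(\<Sum>j=1..n. expectation (\<lambda>\<omega>. (g j \<omega>) ^ 4) / (real j)\<^sup>2) \<le> S" for n
    proof -
      let ?s = "\<Sum>j<n. expectation (\<lambda>\<omega>. (g (Suc j) \<omega>) ^ 4) / (real (Suc j))\<^sup>2"
      have "ennreal ?s = (\<Sum>j<n. ?t j)" unfolding t by (intro sum_ennreal[symmetric]) simp
      also have "\<dots> \<le> ennreal S" unfolding S by (intro sum_le_suminf) auto
      finally have "?s \<le> S" by (simp add: S_def)
      moreover have "(\<Sum>j=1..n. expectation (\<lambda>\<omega>. (g j \<omega>) ^ 4) / (real j)\<^sup>2) = ?s"
        by (simp only: One_nat_def sum.atLeast1_atMost_eq)
      ultimately show ?thesis by simp
    qed
  qed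
qed

theorem theorem4p4:
  fixes M :: "'a measure" and g :: "nat \<Rightarrow> 'a \<Rightarrow> real"
    and lam F E \<theta>0 :: real
  assumes "prob_space M"
    and "lam \<noteq> 0"
    and "\<And>n. n \<ge> 1 \<Longrightarrow> g n \<in> borel_measurable M"
    and "prob_space.indep_vars M (\<lambda>_. borel) g {1..}"
    and "\<And>n. n \<ge> 1 \<Longrightarrow> integrable M (\<lambda>\<omega>. (g n \<omega>) ^ 2)"
    and "\<And>n. n \<ge> 1 \<Longrightarrow> integrable M (g n)"
    and "\<And>n. n \<ge> 1 \<Longrightarrow> (\<integral>\<omega>. g n \<omega> \<partial>M) = 0"
    and "\<And>n. n \<ge> 1 \<Longrightarrow> (\<integral>\<omega>. (g n \<omega>) ^ 2 \<partial>M) = lam ^ 2"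
    and "(\<Sum>n. (\<integral>\<^sup>+\<omega>. ennreal ((g (Suc n) \<omega>) ^ 4) \<partial>M) / ennreal ((real (Suc n)) ^ 2)) < \<infinity>"
    and "AE \<omega> in M. ((\<lambda>n. g n \<omega> / real n powr (1/4)) \<longlonglongrightarrow> 0)"
    and "F > 0"
    and "0 \<le> \<theta>0" and "\<theta>0 < pi"
  shows "AE \<omega> in M. \<forall>\<psi>. is_gen_solution F E (\<lambda>n. g n \<omega>) \<theta>0 \<psi> \<longrightarrow>
           ((\<lambda>n. ln (prufer_R F E \<psi> n) / ln (real n)) \<longlonglongrightarrow> lam ^ 2 / (8 * F))"
proof -
  interpret prob_space M by fact
  note meas = assms(3) and indep = assms(4) and sq = assms(5)
    and mean = assms(7) and var = assms(8) and F = \<open>F > 0\<close>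
  \<comment> \<open>Chosen before any \<open>\<omega>\<close>, so the exceptional null sets below
    depend neither on \<open>\<psi>\<close> nor on its existence.\<close>
  obtain \<zeta> :: "nat \<Rightarrow> complex" and b c1 c2 where
    as: "(\<lambda>n. of_real ((F * real n + E) powr (1/4)) * \<zeta> n - cis (wkb_phase F E (real n))) \<longlonglongrightarrow> 0"
    and b: "b \<noteq> 0" and c12: "c1 > 0" "c2 > 0"
    and R: "\<And>h \<psi> n. is_gen_solution F E h \<theta>0 \<psi> \<Longrightarrow> n \<ge> 1 \<Longrightarrow>
      c1 * cmod (prufer_path \<zeta> b h n) \<le> prufer_R F E \<psi> n \<and> prufer_R F E \<psi> n \<le> c2 * cmod (prufer_path \<zeta> b h n)"
    using prufer_reduction[OF F] by blast
  define c where "c n = (cmod (\<zeta> n))\<^sup>2 / 2" for n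
  have modulus: "(\<lambda>n. real n * (c n)\<^sup>2) \<longlonglongrightarrow> 1 / (4 * F)"
    unfolding c_def by (rule wkb_modulus_and_rotation(1)[OF F as])
  obtain B where "B > 0" and B': "\<And>n. norm (real n * (c n)\<^sup>2) \<le> B"
    using convergent_imp_Bseq[OF convergentI[OF modulus]] by (auto simp: Bseq_def)
  then have B: "B \<ge> 0" by simp
  have cB: "(c n)\<^sup>2 \<le> B / real n" if "1 \<le> n" for n
    using B'[of n] that by (simp add: field_simps)
  obtain S where S: "S \<ge> 0" and int4: "\<And>n. 1 \<le> n \<Longrightarrow> integrable M (\<lambda>\<omega>. (g n \<omega>) ^ 4)"
    and Ssum: "\<And>n. (\<Sum>j=1..n. expectation (\<lambda>\<omega>. (g j \<omega>) ^ 4) / (real j)\<^sup>2) \<le> S"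
    using weighted_fourth_moment_sum_bounded[OF meas assms(9)] by blast
  define z where "z n \<omega> = prufer_phase \<zeta> b (\<lambda>n. g n \<omega>) n" for n \<omega>
  have z1: "norm (z n \<omega>) \<le> 1" for n \<omega> unfolding z_def by (rule norm_prufer_phase_le_1)
  have z2: "norm ((z n \<omega>)\<^sup>2) \<le> 1" for n \<omega> unfolding norm_power by (intro power_le_one z1) simp
  \<comment> \<open>The variance of a term is \<open>(c j)\<^sup>2 * lam\<^sup>2\<close>, at most
    \<open>B * lam\<^sup>2 / j\<close>, so the harmonic sum supplies the logarithm.\<close>
  have m1: "AE \<omega> in M. (\<lambda>n. (\<Sum>j=1..n. Im (z j \<omega>) * (c j * g j \<omega>)) / ln (real n)) \<longlonglongrightarrow> 0"
  proof (rule predictable_transform_over_ln_tendsto_0[OF indep, where \<phi> = "\<lambda>j x. c j * x" and K = "B * lam\<^sup>2"])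
    show "(\<lambda>x. c j * x) \<in> borel_measurable borel" for j by simp
    show "integrable M (\<lambda>\<omega>. (c j * g j \<omega>)\<^sup>2)" if "1 \<le> j" for j
      using sq[OF that] by (simp add: power_mult_distrib)
    show "expectation (\<lambda>\<omega>. c j * g j \<omega>) = 0" if "1 \<le> j" for j using mean[OF that] by simp
    show "(\<lambda>\<omega>. Im (z j \<omega>)) \<in> borel_measurable (past M g j)" for j
      unfolding z_def by (intro prufer_phase_predictable continuous_intros)
    show "\<bar>Im (z j \<omega>)\<bar> \<le> 1" for j \<omega> by (rule order_trans[OF abs_Im_le_cmod z1])
    fix n :: nat assume n: "1 \<le> n"
    have "(\<Sum>j=1..n. expectation (\<lambda>\<omega>. (c j * g j \<omega>)\<^sup>2)) = (\<Sum>j=1..n. (c j)\<^sup>2 * lam\<^sup>2)"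
      by (intro sum.cong refl) (simp add: power_mult_distrib var)
    also have "\<dots> \<le> (\<Sum>j=1..n. B / real j * lam\<^sup>2)" by (intro sum_mono mult_right_mono cB) auto
    also have "\<dots> = B * lam\<^sup>2 * (\<Sum>j=1..n. 1 / real j)" by (simp add: sum_distrib_left mult.commute)
    also have "\<dots> \<le> B * lam\<^sup>2 * (1 + ln (real n))"
      by (intro mult_left_mono sum_inverse_le_ln n) (use B in auto)
    finally show "(\<Sum>j=1..n. expectation (\<lambda>\<omega>. (c j * g j \<omega>)\<^sup>2)) \<le> B * lam\<^sup>2 * (1 + ln (real n))" .
  qed
  \<comment> \<open>Kept general in the weight, which will be 1, the real part of \<open>z\<close>
    and that of its square. The variances are at most \<open>B\<^sup>2\<close> times the fourth
    moment over \<open>j\<^sup>2\<close>, so by the fourth moment condition their sum stays below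
    the constant \<open>B\<^sup>2 * S\<close>.\<close>
  have m2: "AE \<omega> in M. (\<lambda>n. (\<Sum>j=1..n. V j \<omega> * ((c j)\<^sup>2 * ((g j \<omega>)\<^sup>2 - lam\<^sup>2))) / ln (real n)) \<longlonglongrightarrow> 0"
    if V: "\<And>j. 1 \<le> j \<Longrightarrow> V j \<in> borel_measurable (past M g j)" "\<And>j \<omega>. \<bar>V j \<omega>\<bar> \<le> 1" for V
  proof (rule predictable_transform_over_ln_tendsto_0[OF indep, where \<phi> = "\<lambda>j x. (c j)\<^sup>2 * (x\<^sup>2 - lam\<^sup>2)" and K = "B\<^sup>2 * S"])
    have expand: "((c j)\<^sup>2 * ((g j \<omega>)\<^sup>2 - lam\<^sup>2))\<^sup>2 = (c j) ^ 4 * ((g j \<omega>) ^ 4 - 2 * lam\<^sup>2 * (g j \<omega>)\<^sup>2 + lam ^ 4)" for j \<omega>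
      by (simp add: power_mult_distrib power2_diff algebra_simps flip: power_mult)
    show "(\<lambda>x. (c j)\<^sup>2 * (x\<^sup>2 - lam\<^sup>2)) \<in> borel_measurable borel" for j by measurable
    show "integrable M (\<lambda>\<omega>. ((c j)\<^sup>2 * ((g j \<omega>)\<^sup>2 - lam\<^sup>2))\<^sup>2)" if "1 \<le> j" for j
      unfolding expand using sq[OF that] int4[OF that] by auto
    show "expectation (\<lambda>\<omega>. (c j)\<^sup>2 * ((g j \<omega>)\<^sup>2 - lam\<^sup>2)) = 0" if "1 \<le> j" for j
      using var[OF that] sq[OF that] by (simp add: prob_space)
    show "V j \<in> borel_measurable (past M g j)" if "1 \<le> j" for j by (rule V(1)[OF that])
    show "\<bar>V j \<omega>\<bar> \<le> 1" for j \<omega> by (rule V(2))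
    fix n :: nat assume n: "1 \<le> n"
    have "expectation (\<lambda>\<omega>. ((c j)\<^sup>2 * ((g j \<omega>)\<^sup>2 - lam\<^sup>2))\<^sup>2) \<le> B\<^sup>2 * (expectation (\<lambda>\<omega>. (g j \<omega>) ^ 4) / (real j)\<^sup>2)"
      if j: "1 \<le> j" for j
    proof -
      have nonneg: "0 \<le> expectation (\<lambda>\<omega>. (g j \<omega>) ^ 4)" by (rule integral_nonneg_AE) simp
      have "expectation (\<lambda>\<omega>. ((c j)\<^sup>2 * ((g j \<omega>)\<^sup>2 - lam\<^sup>2))\<^sup>2)
        = (c j) ^ 4 * (expectation (\<lambda>\<omega>. (g j \<omega>) ^ 4) - 2 * lam\<^sup>2 * lam\<^sup>2 + lam ^ 4)"
        unfolding expand using sq[OF j] int4[OF j] var[OF j] by (simp add: prob_space)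
      also have "\<dots> = (c j) ^ 4 * (expectation (\<lambda>\<omega>. (g j \<omega>) ^ 4) - lam ^ 4)"
        by (simp add: mult.assoc flip: power_add)
      also have "\<dots> \<le> ((c j)\<^sup>2)\<^sup>2 * expectation (\<lambda>\<omega>. (g j \<omega>) ^ 4)"
        by (simp add: mult_left_mono flip: power_mult)
      also have "\<dots> \<le> (B / real j)\<^sup>2 * expectation (\<lambda>\<omega>. (g j \<omega>) ^ 4)"
        by (intro mult_right_mono power_mono cB j nonneg) auto
      finally show ?thesis by (simp add: power_divide)
    qed
    then have "(\<Sum>j=1..n. expectation (\<lambda>\<omega>. ((c j)\<^sup>2 * ((g j \<omega>)\<^sup>2 - lam\<^sup>2))\<^sup>2))
       \<le> (\<Sum>j=1..n. B\<^sup>2 * (expectation (\<lambda>\<omega>. (g j \<omega>) ^ 4) / (real j)\<^sup>2))"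
      by (intro sum_mono) auto
    also have "\<dots> \<le> B\<^sup>2 * S * 1" unfolding sum_distrib_left[symmetric] using Ssum[of n] by (simp add: mult_left_mono)
    also have "\<dots> \<le> B\<^sup>2 * S * (1 + ln (real n))" using S n by (intro mult_left_mono) auto
    finally show "(\<Sum>j=1..n. expectation (\<lambda>\<omega>. ((c j)\<^sup>2 * ((g j \<omega>)\<^sup>2 - lam\<^sup>2))\<^sup>2)) \<le> B\<^sup>2 * S * (1 + ln (real n))" .
  qed
  have m3: "AE \<omega> in M. (\<lambda>n. (\<Sum>j=1..n. 1 * ((c j)\<^sup>2 * ((g j \<omega>)\<^sup>2 - lam\<^sup>2))) / ln (real n)) \<longlonglongrightarrow> 0"
    by (rule m2) auto
  have m4: "AE \<omega> in M. (\<lambda>n. (\<Sum>j=1..n. Re (z j \<omega>) * ((c j)\<^sup>2 * ((g j \<omega>)\<^sup>2 - lam\<^sup>2))) / ln (real n)) \<longlonglongrightarrow> 0"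
  proof (rule m2)
    show "(\<lambda>\<omega>. Re (z j \<omega>)) \<in> borel_measurable (past M g j)" for j
      unfolding z_def by (intro prufer_phase_predictable continuous_intros)
    show "\<bar>Re (z j \<omega>)\<bar> \<le> 1" for j \<omega> by (rule order_trans[OF abs_Re_le_cmod z1])
  qed
  have m5: "AE \<omega> in M. (\<lambda>n. (\<Sum>j=1..n. Re ((z j \<omega>)\<^sup>2) * ((c j)\<^sup>2 * ((g j \<omega>)\<^sup>2 - lam\<^sup>2))) / ln (real n)) \<longlonglongrightarrow> 0"
  proof (rule m2)
    show "(\<lambda>\<omega>. Re ((z j \<omega>)\<^sup>2)) \<in> borel_measurable (past M g j)" for j
      unfolding z_def by (rule prufer_phase_predictable[of "\<lambda>z. Re (z\<^sup>2)"]) (intro continuous_intros)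
    show "\<bar>Re ((z j \<omega>)\<^sup>2)\<bar> \<le> 1" for j \<omega> by (rule order_trans[OF abs_Re_le_cmod z2])
  qed
  show ?thesis
    using m1 m3 m4 m5 assms(10)
  proof eventually_elim
    case (elim \<omega>)
    \<comment> \<open>Since \<open>n * (c n)\<^sup>2\<close> is at most \<open>B\<close>,
      \<open>c n * n powr (1/4)\<close> is at most \<open>sqrt B\<close>; the almost sure decay of
      \<open>g n / n powr (1/4)\<close> does the rest.\<close>
    have U0: "(\<lambda>n. c n * g n \<omega>) \<longlonglongrightarrow> 0"
    proof (rule Lim_null_comparison)
      show "eventually (\<lambda>n. norm (c n * g n \<omega>) \<le> sqrt B * \<bar>g n \<omega> / real n powr (1/4)\<bar>) sequentially"
        using eventually_ge_at_top[of 1]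
      proof eventually_elim
        case (elim n)
        let ?r = "real n powr (1/4)"
        have r: "?r > 0" using elim by simp
        have "(c n * ?r)\<^sup>2 = (c n)\<^sup>2 * real n powr (1/2)"
          by (simp add: power_mult_distrib power2_eq_square[of ?r] flip: powr_add)
        also have "\<dots> \<le> (c n)\<^sup>2 * real n powr 1" using elim by (intro mult_left_mono powr_mono) auto
        also have "\<dots> \<le> B" using B'[of n] by (simp add: mult.commute)
        finally have "\<bar>c n * ?r\<bar> \<le> sqrt B" using real_le_rsqrt real_sqrt_abs real_sqrt_le_iff by metis
        then have "\<bar>c n * ?r\<bar> * \<bar>g n \<omega> / ?r\<bar> \<le> sqrt B * \<bar>g n \<omega> / ?r\<bar>" by (intro mult_right_mono) auto
        then show ?case using r by (simp add: abs_mult)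
      qed
      show "(\<lambda>n. sqrt B * \<bar>g n \<omega> / real n powr (1/4)\<bar>) \<longlonglongrightarrow> 0"
        by (rule tendsto_mult_right_zero[OF tendsto_rabs_zero[OF elim(5)]])
    qed
    let ?a = "prufer_path \<zeta> b (\<lambda>n. g n \<omega>)"
    have growth: "(\<lambda>n. ln (cmod (?a n)) / ln (real n)) \<longlonglongrightarrow> lam\<^sup>2 * (1 / (4 * F)) / 2"
    proof (rule prufer_path_growth[OF b, where s = "2 * sqrt F"])
      show "2 * sqrt F \<noteq> 0" using F by simp
      show "(\<lambda>n. (sgn (\<zeta> (Suc n)))\<^sup>2 - (sgn (\<zeta> n))\<^sup>2 * cis (2 * sqrt F * sqrt (real n))) \<longlonglongrightarrow> 0"
        by (rule wkb_modulus_and_rotation(2)[OF F as])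
    qed (use modulus U0 elim in \<open>simp_all only: c_def z_def mult_1\<close>)
    show ?case
    proof (intro allI impI)
      fix \<psi> assume \<psi>: "is_gen_solution F E (\<lambda>n. g n \<omega>) \<theta>0 \<psi>"
      have a: "cmod (?a n) > 0" for n using prufer_path_nonzero[OF b] by simp
      \<comment> \<open>The comparison constants change \<open>ln R\<close> by a bounded amount
        only; applied with \<open>d = c1\<close> and \<open>d = c2\<close>.\<close>
      have lim: "(\<lambda>n. (ln d + ln (cmod (?a n))) / ln (real n)) \<longlonglongrightarrow> lam ^ 2 / (8 * F)" for d
      proof -
        have "(\<lambda>n. ln d / ln (real n)) \<longlonglongrightarrow> 0"
          by (rule real_tendsto_divide_at_top[OF tendsto_const ln_at_top_seq])
        from tendsto_add[OF this growth] show ?thesis by (simp add: add_divide_distrib)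
      qed
      show "(\<lambda>n. ln (prufer_R F E \<psi> n) / ln (real n)) \<longlonglongrightarrow> lam ^ 2 / (8 * F)"
      proof (rule tendsto_sandwich[OF _ _ lim[of c1] lim[of c2]])
        show "eventually (\<lambda>n. (ln c1 + ln (cmod (?a n))) / ln (real n) \<le> ln (prufer_R F E \<psi> n) / ln (real n)) sequentially"
          using eventually_gt_at_top[of 1]
        proof eventually_elim
          case (elim n)
          have "ln (c1 * cmod (?a n)) \<le> ln (prufer_R F E \<psi> n)"
            using R[OF \<psi>, of n] elim a[of n] c12 by (intro ln_mono) auto
          then show ?case using elim a[of n] c12 by (intro divide_right_mono) (auto simp: ln_mult)
        qed
        show "eventually (\<lambda>n. ln (prufer_R F E \<psi> n) / ln (real n) \<le> (ln c2 + ln (cmod (?a n))) / ln (real n)) sequentially"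
          using eventually_gt_at_top[of 1]
        proof eventually_elim
          case (elim n)
          have "0 < c1 * cmod (?a n)" using a[of n] c12 by simp
          also have "\<dots> \<le> prufer_R F E \<psi> n" using R[OF \<psi>, of n] elim by simp
          finally have "ln (prufer_R F E \<psi> n) \<le> ln (c2 * cmod (?a n))"
            using R[OF \<psi>, of n] elim by (intro ln_mono) auto
          then show ?case using elim a[of n] c12 by (intro divide_right_mono) (auto simp: ln_mult)
        qed
      qed
    qed
  qed
qed

end
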